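(* Let $d\ge 1$, $1<p<\infty$, $\frac1p+\frac1q=1$, $c(z)=\frac1p|z|^p$ on $\mathbb{R}^d$, and let $\rho_0,\rho_1\ge 0$ be probability densities on $\mathbb{R}^d$ with $\rho_0\in H^1(\mathbb{R}^d)\cap L^1(\mathbb{R}^d)\cap L^\infty(\mathbb{R}^d)$, satisfying the standing assumption of the context. Suppose that $\bar v:\mathbb{R}^d\to\mathbb{R}$ is a maximizer of $$J(v)=\int_{\mathbb{R}^d}\big(\rho_1(x)v(x)-\rho_0(x)\phi(0,x)\big)\,dx,$$ where $\phi$ is the solution of $\phi_t+\frac1q|\nabla\phi|^q=0$ on $[0,1]\times\mathbb{R}^d$, $\phi(1,\cdot)=v$. Suppose $\bar v$ is Lipschitz and semi-convex and, if $p>2$, that there is a constant $\kappa>0$ with $|\nabla\bar v|^2\ge \kappa$ a.e. in $\mathbb{R}^d$. Let $\bar\phi$ be the solution with $\bar\phi(1,\cdot)=\bar v$, let $\bar u=-\bar\phi(0,\cdot)$, and set $$\bar V(t,x)=|\nabla\bar\phi(t,x)|^{q-2}\,\nabla\bar\phi(t,x)$$ (so $\bar V=\nabla\bar\phi$ when $p=2$). Let $\bar\rho\in L^\infty(0,1;L^1(\mathbb{R}^d)\cap L^\infty(\mathbb{R}^d))$ be the unique weak solution of $$\bar\rho_t+\nabla\cdot(\bar\rho\,\bar V)=0,\qquad \bar\rho(0,\cdot)=\rho_0 .$$ Then: (i) $\bar\rho(1,\cdot)=\rho_1$ a.e. in $\mathbb{R}^d$; (ii) $$\int_{\mathbb{R}^d}\big(\rho_0(x)\bar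 u(x)+\rho_1(x)\bar v(x)\big)\,dx=\int_0^1\int_{\mathbb{R}^d}\frac1p\,\bar\rho(t,x)\,|\bar V(t,x)|^p\,dx\,dt;$$ (iii) $(\bar\rho,\bar V)$ is an optimal solution of the control problem of minimizing $\int_0^1\int_{\mathbb{R}^d}\rho\, c(V)\,dx\,dt$ subject to $\rho_t+\nabla\cdot(\rho V)=0$, $\rho(0,\cdot)=\rho_0$, $\rho(1,\cdot)=\rho_1$, and its cost equals the Kantorovich distance: $$d(\rho_0,\rho_1)=\int_0^1\int_{\mathbb{R}^d}\bar\rho(t,x)\,c(\bar V(t,x))\,dx\,dt\le\int_0^1\int_{\mathbb{R}^d}\rho(t,x)\,c(V(t,x))\,dx\,dt$$ for every admissible pair $(\rho,V)$.
   Context: Kantorovich distance: $d(\rho_0,\rho_1)=\inf_M\int_{\mathbb{R}^d}c(x-M(x))\rho_0(x)\,dx$, the infimum being over maps $M:\mathbb{R}^d\to\mathbb{R}^d$ with $\int_A\rho_1\,dx=\int_{\{x:\,M(x)\in A\}}\rho_0\,dx$ for all bounded (Borel) subsets $A$ of $\mathbb{R}^d$. Dual problem: maximize $\int u\rho_0\,dx+\int v\rho_1\,dy$ subject to $u(x)+v(y)\le c(x-y)$ for all $x,y$. Standing assumption (the known basic theorem on the mass transfer problem, taken as given): the dual problem has a maximizer $(u,v)$ consisting of dual $c$-conjugate functions, $u(x)=\inf_y(c(x-y)-v(y))$ and $v(y)=\inf_x(c(x-y)-u(x))$; and the map $M$ determined by $Dc(x-M(x))=\nabla u(x)$ attains the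 infimum defining $d(\rho_0,\rho_1)$, with $d(\rho_0,\rho_1)$ equal to the maximum of the dual problem. Solution of the Hamilton–Jacobi equation: the solution of $\phi_t+\frac1q|\nabla\phi|^q=0$ with terminal value $\phi(1,\cdot)=v$ is the viscosity solution given by the Lax–Hopf formula $\phi(t,x)=\sup_y\{v(y)-(1-t)\,c(\tfrac{x-y}{1-t})\}$ for $0\le t<1$. In particular $-\phi(0,x)=\inf_y(c(x-y)-v(y))$. The functional $J$ is maximized over the functions $v$ for which the integrals defining $J(v)$ make sense. Semi-convex: there is $C\ge0$ such that $v+\frac C2|x|^2$ is convex. The expression $|z|^{q-2}z$ is $0$ at $z=0$. Weak solution: $\lambda\in L^\infty(0,1;L^1(\mathbb{R}^d)\cap L^\infty(\mathbb{R}^d))$, with terminal trace $\lambda(1)\in L^2(\mathbb{R}^d)$, is a weak solution of $\lambda_t+\nabla\cdot(\lambda V)=0$, $\lambda(0)=\rho_0$ if for all $\psi\in C^1_0([0,1]\times\mathbb{R}^d)$ ($C^1$, compactly supported in $[0,1]\times\mathbb{R}^d$) $$\int_0^1\int_{\mathbb{R}^d}(\lambda\psi_t+\lambda V\cdot\nabla\psi)\,dx\,dt=\int_{\mathbb{R}^d}(\lambda(1)\psi(1)-\rho_0\psi(0))\,dx .$$ Admissible pair: a sufficiently smooth pair $(\rho,V)$, $\rho\ge0$, satisfying $\rho_t+\nabla\cdot(\rho V)=0$, $\rho(0)=\rho_0$, $\rho(1)=\rho_1$, smooth enough that the Lagrange coordinate $\frac{d}{dt}X(t,x)=V(t,X(t,x))$,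 $X(0,x)=x$, is defined on $[0,1]$, that $\rho(t,\cdot)\,dx$ is the push-forward of $\rho_0\,dx$ under $X(t,\cdot)$ for every $t\in[0,1]$, and hence that $\int_0^1\int f\rho\,dx\,dt=\int_0^1\int f(t,X(t,x))\rho_0(x)\,dx\,dt$ for nonnegative Borel $f$. *)

theory Defs
  imports "HOL-Analysis.Analysis"
begin

section \<open>Cost, gradient, Lax--Hopf formula\<close>

definition cost :: "real \<Rightarrow> 'a::real_normed_vector \<Rightarrow> real" where
  "cost p z = norm z powr p / p"

definition grad :: "('a::real_inner \<Rightarrow> real) \<Rightarrow> 'a \<Rightarrow> 'a" where
  "grad f x = (if \<exists>D. GDERIV f x :> D then (THE D. GDERIV f x :> D) else 0)"

text \<open>The map $z \mapsto |z|^{q-2} z$; since \<open>0 powr a = 0\<close>, its value at \<open>0\<close> is \<open>0\<close>.\<close>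
definition flux :: "real \<Rightarrow> 'a::real_normed_vector \<Rightarrow> 'a" where
  "flux q z = (norm z powr (q - 2)) *\<^sub>R z"

text \<open>Viscosity solution of $\phi_t + \frac1q |\nabla\phi|^q = 0$ with $\phi(1,\cdot) = v$.
  The supremum is taken in \<open>real\<close>, so it is meaningful only where the family is bounded above.\<close>
definition lax_hopf :: "real \<Rightarrow> ('a::real_normed_vector \<Rightarrow> real) \<Rightarrow> real \<Rightarrow> 'a \<Rightarrow> real" where
  "lax_hopf p v t x =
     (if t < 1 then (SUP y. v y - (1 - t) * cost p ((1 / (1 - t)) *\<^sub>R (x - y))) else v x)"

definition semi_convex :: "('a::real_inner \<Rightarrow> real) \<Rightarrow> bool" where
  "semi_convex v \<longleftrightarrow> (\<exists>C\<ge>0. convex_on UNIV (\<lambda>x. v x + C / 2 * (norm x)\<^sup>2))"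


section \<open>Densities and the space $H^1$\<close>

definition prob_density :: "('a::euclidean_space \<Rightarrow> real) \<Rightarrow> bool" where
  "prob_density f \<longleftrightarrow>
     (\<forall>x. 0 \<le> f x) \<and> integrable lborel f \<and> (LINT x|lborel. f x) = 1"

definition L2_function :: "('a::euclidean_space \<Rightarrow> 'b::euclidean_space) \<Rightarrow> bool" where
  "L2_function f \<longleftrightarrow> f \<in> borel_measurable lborel \<and> integrable lborel (\<lambda>x. (norm (f x))\<^sup>2)"

definition Linf_function :: "('a::euclidean_space \<Rightarrow> real) \<Rightarrow> bool" where
  "Linf_function f \<longleftrightarrow> f \<in> borel_measurable lborel \<and> (\<exists>K. AE x in lborel. \<bar>f x\<bar> \<le> K)"

primrec Ck :: "nat \<Rightarrow> ('a::euclidean_space \<Rightarrow> real) \<Rightarrow> bool" where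
  "Ck 0 f \<longleftrightarrow> continuous_on UNIV f"
| "Ck (Suc k) f \<longleftrightarrow> (\<forall>x. f differentiable (at x)) \<and> (\<forall>b\<in>Basis. Ck k (\<lambda>x. grad f x \<bullet> b))"

definition Cinf_compact_support :: "('a::euclidean_space \<Rightarrow> real) \<Rightarrow> bool" where
  "Cinf_compact_support \<psi> \<longleftrightarrow> (\<forall>k. Ck k \<psi>) \<and> (\<exists>K. compact K \<and> (\<forall>x. x \<notin> K \<longrightarrow> \<psi> x = 0))"

definition weak_gradient :: "('a::euclidean_space \<Rightarrow> real) \<Rightarrow> ('a \<Rightarrow> 'a) \<Rightarrow> bool" where
  "weak_gradient f g \<longleftrightarrow>
     (\<forall>\<psi>. Cinf_compact_support \<psi> \<longrightarrow>
        (\<forall>b\<in>Basis. (LINT x|lborel. f x * (grad \<psi> x \<bullet> b)) = - (LINT x|lborel. (g x \<bullet> b) * \<psi> x)))"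

definition H1_function :: "('a::euclidean_space \<Rightarrow> real) \<Rightarrow> bool" where
  "H1_function f \<longleftrightarrow> L2_function f \<and> (\<exists>g. L2_function g \<and> weak_gradient f g)"


section \<open>Kantorovich distance and the dual problem\<close>

definition transport_map ::
  "('a::euclidean_space \<Rightarrow> real) \<Rightarrow> ('a \<Rightarrow> real) \<Rightarrow> ('a \<Rightarrow> 'a) \<Rightarrow> bool" where
  "transport_map \<rho>0 \<rho>1 M \<longleftrightarrow>
     M \<in> borel_measurable borel \<and>
     (\<forall>A\<in>sets borel. bounded A \<longrightarrow>
        (LINT x:A|lborel. \<rho>1 x) = (LINT x:{x. M x \<in> A}|lborel. \<rho>0 x))"

definition transport_cost ::
  "real \<Rightarrow> ('a::euclidean_space \<Rightarrow> real) \<Rightarrow> ('a \<Rightarrow> 'a) \<Rightarrow> ennreal" where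
  "transport_cost p \<rho>0 M = (\<integral>\<^sup>+x. ennreal (cost p (x - M x) * \<rho>0 x) \<partial>lborel)"

definition kantorovich_distance ::
  "real \<Rightarrow> ('a::euclidean_space \<Rightarrow> real) \<Rightarrow> ('a \<Rightarrow> real) \<Rightarrow> ennreal" where
  "kantorovich_distance p \<rho>0 \<rho>1 = (INF M\<in>{M. transport_map \<rho>0 \<rho>1 M}. transport_cost p \<rho>0 M)"

definition dual_feasible ::
  "real \<Rightarrow> ('a::euclidean_space \<Rightarrow> real) \<Rightarrow> ('a \<Rightarrow> real) \<Rightarrow> ('a \<Rightarrow> real) \<Rightarrow> ('a \<Rightarrow> real) \<Rightarrow> bool" where
  "dual_feasible p \<rho>0 \<rho>1 u v \<longleftrightarrow>
     integrable lborel (\<lambda>x. u x * \<rho>0 x) \<and> integrable lborel (\<lambda>y. v y * \<rho>1 y) \<and>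
     (\<forall>x y. u x + v y \<le> cost p (x - y))"

definition dual_value ::
  "('a::euclidean_space \<Rightarrow> real) \<Rightarrow> ('a \<Rightarrow> real) \<Rightarrow> ('a \<Rightarrow> real) \<Rightarrow> ('a \<Rightarrow> real) \<Rightarrow> real" where
  "dual_value \<rho>0 \<rho>1 u v = (LINT x|lborel. u x * \<rho>0 x) + (LINT y|lborel. v y * \<rho>1 y)"

definition dual_maximizer ::
  "real \<Rightarrow> ('a::euclidean_space \<Rightarrow> real) \<Rightarrow> ('a \<Rightarrow> real) \<Rightarrow> ('a \<Rightarrow> real) \<Rightarrow> ('a \<Rightarrow> real) \<Rightarrow> bool" where
  "dual_maximizer p \<rho>0 \<rho>1 u v \<longleftrightarrow>
     dual_feasible p \<rho>0 \<rho>1 u v \<and>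
     (\<forall>u' v'. dual_feasible p \<rho>0 \<rho>1 u' v' \<longrightarrow> dual_value \<rho>0 \<rho>1 u' v' \<le> dual_value \<rho>0 \<rho>1 u v)"

text \<open>The infima are bounded below whenever $u(x) + v(y) \le c(x-y)$.\<close>
definition dual_c_conjugate ::
  "real \<Rightarrow> ('a::euclidean_space \<Rightarrow> real) \<Rightarrow> ('a \<Rightarrow> real) \<Rightarrow> bool" where
  "dual_c_conjugate p u v \<longleftrightarrow>
     (\<forall>x. u x = (INF y. cost p (x - y) - v y)) \<and>
     (\<forall>y. v y = (INF x. cost p (x - y) - u x))"

text \<open>The basic theorem on the mass transfer problem, as a property of the two densities.\<close>
definition mass_transfer_theorem ::
  "real \<Rightarrow> ('a::euclidean_space \<Rightarrow> real) \<Rightarrow> ('a \<Rightarrow> real) \<Rightarrow> bool" where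
  "mass_transfer_theorem p \<rho>0 \<rho>1 \<longleftrightarrow>
     (\<exists>u v M. dual_maximizer p \<rho>0 \<rho>1 u v \<and> dual_c_conjugate p u v \<and>
        transport_map \<rho>0 \<rho>1 M \<and>
        (AE x in density lborel (\<lambda>x. ennreal (\<rho>0 x)). GDERIV u x :> grad (cost p) (x - M x)) \<and>
        transport_cost p \<rho>0 M = kantorovich_distance p \<rho>0 \<rho>1 \<and>
        kantorovich_distance p \<rho>0 \<rho>1 = ennreal (dual_value \<rho>0 \<rho>1 u v))"


section \<open>The functional $J$\<close>

text \<open>The functions for which $J(v)$ makes sense: $\phi(0,\cdot)$ is finite and both integrals exist.\<close>
definition J_domain ::
  "real \<Rightarrow> ('a::euclidean_space \<Rightarrow> real) \<Rightarrow> ('a \<Rightarrow> real) \<Rightarrow> ('a \<Rightarrow> real) set" where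
  "J_domain p \<rho>0 \<rho>1 =
     {v. (\<forall>x. bdd_above (range (\<lambda>y. v y - cost p (x - y)))) \<and>
         integrable lborel (\<lambda>x. \<rho>1 x * v x) \<and>
         integrable lborel (\<lambda>x. \<rho>0 x * lax_hopf p v 0 x)}"

definition J ::
  "real \<Rightarrow> ('a::euclidean_space \<Rightarrow> real) \<Rightarrow> ('a \<Rightarrow> real) \<Rightarrow> ('a \<Rightarrow> real) \<Rightarrow> real" where
  "J p \<rho>0 \<rho>1 v = (LINT x|lborel. \<rho>1 x * v x - \<rho>0 x * lax_hopf p v 0 x)"

definition J_maximizer ::
  "real \<Rightarrow> ('a::euclidean_space \<Rightarrow> real) \<Rightarrow> ('a \<Rightarrow> real) \<Rightarrow> ('a \<Rightarrow> real) \<Rightarrow> bool" where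
  "J_maximizer p \<rho>0 \<rho>1 v \<longleftrightarrow>
     v \<in> J_domain p \<rho>0 \<rho>1 \<and> (\<forall>w\<in>J_domain p \<rho>0 \<rho>1. J p \<rho>0 \<rho>1 w \<le> J p \<rho>0 \<rho>1 v)"


section \<open>Continuity equation\<close>

text \<open>\<open>\<psi>\<close> belongs to $C^1_0([0,1]\times\mathbb{R}^d)$, with (at \<open>t = 0, 1\<close> one-sided) time
  derivative \<open>\<psi>t\<close> and spatial gradient \<open>\<psi>x\<close>.\<close>
definition C1_test ::
  "(real \<Rightarrow> 'a::euclidean_space \<Rightarrow> real) \<Rightarrow> (real \<Rightarrow> 'a \<Rightarrow> real) \<Rightarrow> (real \<Rightarrow> 'a \<Rightarrow> 'a) \<Rightarrow> bool" where
  "C1_test \<psi> \<psi>t \<psi>x \<longleftrightarrow>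
     (\<forall>t\<in>{0..1}. \<forall>x. ((\<lambda>(s, y). \<psi> s y) has_derivative (\<lambda>(s, y). s * \<psi>t t x + y \<bullet> \<psi>x t x))
                          (at (t, x) within {0..1} \<times> UNIV)) \<and>
     continuous_on ({0..1} \<times> UNIV) (\<lambda>(t, x). \<psi>t t x) \<and>
     continuous_on ({0..1} \<times> UNIV) (\<lambda>(t, x). \<psi>x t x) \<and>
     (\<exists>K. compact K \<and> (\<forall>t\<in>{0..1}. \<forall>x. (t, x) \<notin> K \<longrightarrow> \<psi> t x = 0))"

text \<open>Weak form of $\lambda_t + \nabla\cdot(\lambda V) = 0$ on $(0,1)\times\mathbb{R}^d$ with
  boundary values \<open>\<mu>0\<close>, \<open>\<mu>1\<close> at \<open>t = 0, 1\<close>.\<close>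
definition continuity_equation ::
  "(real \<Rightarrow> 'a::euclidean_space \<Rightarrow> real) \<Rightarrow> (real \<Rightarrow> 'a \<Rightarrow> 'a) \<Rightarrow>
   ('a \<Rightarrow> real) \<Rightarrow> ('a \<Rightarrow> real) \<Rightarrow> bool" where
  "continuity_equation lam V \<mu>0 \<mu>1 \<longleftrightarrow>
     (\<forall>\<psi> \<psi>t \<psi>x. C1_test \<psi> \<psi>t \<psi>x \<longrightarrow>
        set_integrable lborel ({0<..<1} \<times> UNIV)
          (\<lambda>(t, x). lam t x * \<psi>t t x + (lam t x *\<^sub>R V t x) \<bullet> \<psi>x t x) \<and>
        (LINT (t, x):{0<..<1} \<times> UNIV|lborel.
            lam t x * \<psi>t t x + (lam t x *\<^sub>R V t x) \<bullet> \<psi>x t x)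
          = (LINT x|lborel. \<mu>1 x * \<psi> 1 x - \<mu>0 x * \<psi> 0 x))"

text \<open>$\lambda \in L^\infty(0,1; L^1 \cap L^\infty)$; values outside \<open>0 < t < 1\<close> are irrelevant.\<close>
definition Linf_L1_Linf :: "(real \<Rightarrow> 'a::euclidean_space \<Rightarrow> real) \<Rightarrow> bool" where
  "Linf_L1_Linf lam \<longleftrightarrow>
     set_borel_measurable lborel ({0<..<1} \<times> UNIV) (\<lambda>(t, x). lam t x) \<and>
     (\<exists>K. AE t in lborel. t \<in> {0<..<1} \<longrightarrow>
        integrable lborel (lam t) \<and> (LINT x|lborel. \<bar>lam t x\<bar>) \<le> K \<and>
        (AE x in lborel. \<bar>lam t x\<bar> \<le> K))"

text \<open>The value \<open>lam 1\<close> represents the terminal trace.\<close>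
definition weak_solution ::
  "(real \<Rightarrow> 'a::euclidean_space \<Rightarrow> real) \<Rightarrow> (real \<Rightarrow> 'a \<Rightarrow> 'a) \<Rightarrow> ('a \<Rightarrow> real) \<Rightarrow> bool" where
  "weak_solution lam V \<rho>0 \<longleftrightarrow>
     Linf_L1_Linf lam \<and> L2_function (lam 1) \<and> continuity_equation lam V \<rho>0 (lam 1)"

definition unique_weak_solution ::
  "(real \<Rightarrow> 'a::euclidean_space \<Rightarrow> real) \<Rightarrow> (real \<Rightarrow> 'a \<Rightarrow> 'a) \<Rightarrow> ('a \<Rightarrow> real) \<Rightarrow> bool" where
  "unique_weak_solution \<rho> V \<rho>0 \<longleftrightarrow>
     weak_solution \<rho> V \<rho>0 \<and>
     (\<forall>lam. weak_solution lam V \<rho>0 \<longrightarrow>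
        (AE (t, x) in lborel. t \<in> {0<..<1} \<longrightarrow> lam t x = \<rho> t x))"

definition Lagrange_coordinate ::
  "(real \<Rightarrow> 'a::euclidean_space \<Rightarrow> 'a) \<Rightarrow> (real \<Rightarrow> 'a \<Rightarrow> 'a) \<Rightarrow> bool" where
  "Lagrange_coordinate V X \<longleftrightarrow>
     (\<forall>x. X 0 x = x \<and>
        (\<forall>t\<in>{0..1}. ((\<lambda>s. X s x) has_vector_derivative V t (X t x)) (at t within {0..1})))"

definition admissible_pair ::
  "('a::euclidean_space \<Rightarrow> real) \<Rightarrow> ('a \<Rightarrow> real) \<Rightarrow>
   (real \<Rightarrow> 'a \<Rightarrow> real) \<Rightarrow> (real \<Rightarrow> 'a \<Rightarrow> 'a) \<Rightarrow> bool" where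
  "admissible_pair \<rho>0 \<rho>1 \<rho> V \<longleftrightarrow>
     set_borel_measurable lborel ({0..1} \<times> UNIV) (\<lambda>(t, x). \<rho> t x) \<and>
     set_borel_measurable lborel ({0..1} \<times> UNIV) (\<lambda>(t, x). V t x) \<and>
     (\<forall>t\<in>{0..1}. \<forall>x. 0 \<le> \<rho> t x) \<and>
     continuity_equation \<rho> V \<rho>0 \<rho>1 \<and>
     (AE x in lborel. \<rho> 0 x = \<rho>0 x) \<and> (AE x in lborel. \<rho> 1 x = \<rho>1 x) \<and>
     (\<exists>X. Lagrange_coordinate V X \<and>
        (\<forall>t\<in>{0..1}. X t \<in> borel_measurable borel \<and>
           distr (density lborel (\<lambda>x. ennreal (\<rho>0 x))) lborel (X t)
             = density lborel (\<lambda>x. ennreal (\<rho> t x))))"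

end

theory Submission
  imports Defs
begin

text \<open>
  The maximizer \<open>vbar\<close> of \<open>J\<close> and \<open>ubar = - lax_hopf p vbar 0\<close> form an optimal pair for the dual problem,
  because \<open>J\<close> is the dual functional on such pairs. Since the optimal transport map \<open>M\<close> has
  the same value, the constraint \<open>ubar x + vbar y \<le> cost p (x - y)\<close> is active at \<open>(x, M x)\<close> for
  \<open>\<rho>0\<close>-almost every \<open>x\<close> (\<open>J_maximizer_contact\<close>). Everything else happens on the straight rays
  \<open>X t x = x + t (M x - x)\<close> starting at such points.

  On a ray, the Lax--Hopf formula forward from time \<open>0\<close> and backward from time \<open>1\<close> squeezes the solution
  of the Hamilton--Jacobi equation between two differentiable functions, so its gradient exists there and the
  velocity field takes the value \<open>M x - x\<close> (\<open>GDERIV_along_ray\<close>, \<open>V_along_X\<close>). Hence the image of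
  \<open>\<rho>0\<close> under \<open>X t\<close> is transported by the velocity field, reaches \<open>\<rho>1\<close> at time \<open>1\<close>, and has
  kinetic energy equal to the transport cost of \<open>M\<close>.

  To compare it with the given weak solution by uniqueness one needs a bounded density. The solution inherits
  the semiconvexity constant of \<open>vbar\<close> at all times, and on rays it is also touched from above by the
  cost; together these control the variation of its gradient between points of rays. By strong monotonicity of
  \<open>flux p\<close> they also control the velocities, and \<open>X t\<close> has an inverse which is
  Lipschitz with a constant independent of \<open>t\<close> (\<open>inverse_flow_lipschitz\<close>). A map with Lipschitz inverse
  cannot compress volume by more than a constant factor (\<open>emeasure_le_of_expanding_map\<close>), so boundedness
  of \<open>\<rho>0\<close> passes to all times, and in particular to \<open>\<rho>1\<close>. For \<open>p > 2\<close> the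
  inverse of \<open>flux p\<close> is singular at \<open>0\<close>; the lower gradient bound keeps the
  speeds of the rays away from it.

  Finally, for an admissible pair the Lagrange coordinate at time \<open>1\<close> is a transport map, and Jensen's
  inequality along its trajectories bounds its cost by the action (\<open>kantorovich_distance_le_action\<close>).
\<close>

section \<open>Convexity estimates for the power cost\<close>

lemma powr_concave_tangent:
  fixes a s \<sigma> :: real
  assumes "0 \<le> a" "a \<le> 1" "0 < s" "0 \<le> \<sigma>"
  shows "\<sigma> powr a \<le> s powr a + a * s powr (a - 1) * (\<sigma> - s)"
proof (cases "\<sigma> = 0")
  case True
  have "s powr a = s powr (a - 1) * s"
    using assms by (simp add: powr_diff)
  moreover have "a * (s powr (a - 1) * s) \<le> 1 * (s powr (a - 1) * s)"
    using assms by (intro mult_right_mono) auto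
  ultimately show ?thesis using True by (simp add: mult.assoc)
next
  case False
  have "\<sigma> powr a * s powr (1 - a) \<le> a * \<sigma> + (1 - a) * s"
    using Youngs_inequality_0[of a "1 - a" \<sigma> s] assms False by simp
  then have "\<sigma> powr a * s powr (1 - a) * s powr (a - 1) \<le> (a * \<sigma> + (1 - a) * s) * s powr (a - 1)"
    by (rule mult_right_mono) simp
  moreover have "s powr (1 - a) * s powr (a - 1) = 1"
    using assms by (simp flip: powr_add)
  moreover have "s powr a = s * s powr (a - 1)"
    using assms by (simp add: powr_diff)
  ultimately show ?thesis
    by (simp add: algebra_simps)
qed

lemma powr_convex_tangent:
  fixes a s \<sigma> :: real
  assumes "1 \<le> a" "0 \<le> s" "0 \<le> \<sigma>"
  shows "s powr a + a * s powr (a - 1) * (\<sigma> - s) \<le> \<sigma> powr a"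
proof (cases "s = 0")
  case False
  then have s: "s > 0" using assms by simp
  have "(\<sigma> powr a) powr (1 / a) \<le> (s powr a) powr (1 / a)
          + 1 / a * (s powr a) powr (1 / a - 1) * (\<sigma> powr a - s powr a)"
    using assms s by (intro powr_concave_tangent) auto
  moreover have "(\<sigma> powr a) powr (1 / a) = \<sigma>" "(s powr a) powr (1 / a) = s"
    using assms by (simp_all add: powr_powr)
  moreover have "(s powr a) powr (1 / a - 1) = s powr (1 - a)"
    using assms by (simp add: powr_powr algebra_simps)
  ultimately have "a * (\<sigma> - s) \<le> s powr (1 - a) * (\<sigma> powr a - s powr a)"
    using assms by (simp add: field_simps)
  then have "a * (\<sigma> - s) * s powr (a - 1)
      \<le> s powr (1 - a) * (\<sigma> powr a - s powr a) * s powr (a - 1)"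
    by (rule mult_right_mono) simp
  moreover have "s powr (1 - a) * s powr (a - 1) = 1"
    using s by (simp flip: powr_add)
  ultimately show ?thesis
    by (simp add: algebra_simps)
qed (use assms in simp)

lemma norm_flux:
  assumes "1 < p"
  shows "norm (flux p z) = norm z powr (p - 1)"
proof (cases "z = 0")
  case False
  have "norm (flux p z) = norm z powr (p - 2) * norm z powr 1"
    using False by (simp add: flux_def)
  also have "\<dots> = norm z powr (p - 1)"
    using False by (subst powr_add[symmetric]) simp
  finally show ?thesis .
qed (simp add: flux_def)

lemma inner_flux_self:
  fixes z :: "'a::real_inner"
  assumes "1 < p"
  shows "flux p z \<bullet> z = norm z powr p"
proof (cases "z = 0")
  case False
  have "flux p z \<bullet> z = norm z powr (p - 2) * norm z powr 2"
    using False by (simp add: flux_def power2_norm_eq_inner[symmetric])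
  also have "\<dots> = norm z powr p"
    using False by (subst powr_add[symmetric]) simp
  finally show ?thesis .
qed (simp add: flux_def)

lemma flux_flux:
  assumes "1 < p" "1 / p + 1 / q = 1"
  shows "flux q (flux p z) = z"
proof (cases "z = 0")
  case False
  have "q \<noteq> 0" using assms by auto
  then have q: "q = p / (p - 1)"
    using assms by (simp add: field_simps)
  have "(p - 1) * (q - 2) + (p - 2) = 0"
    using assms by (simp add: q field_simps)
  then have "(norm z powr (p - 1)) powr (q - 2) * norm z powr (p - 2) = 1"
    using False by (simp add: powr_powr flip: powr_add)
  then show ?thesis
    by (simp add: flux_def[of q] norm_flux[OF assms(1)]) (simp add: flux_def)
qed (simp add: flux_def)

lemma flux_minus: "flux p (- z) = - flux p z"
  by (simp add: flux_def)

lemma cost_minus: "cost p (- z) = cost p z"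
  by (simp add: cost_def)

lemma cost_diff_commute: "cost p (x - y) = cost p (y - x)"
  by (simp add: cost_def norm_minus_commute)

lemma cost_nonneg: "1 < p \<Longrightarrow> 0 \<le> cost p z"
  by (simp add: cost_def)

lemma cost_tangent:
  fixes z w :: "'a::real_inner"
  assumes "1 < p"
  shows "cost p z + flux p z \<bullet> (w - z) \<le> cost p w"
proof -
  define A where "A = norm z powr (p - 1)"
  have Az: "norm z powr p = A * norm z"
    by (cases "z = 0") (auto simp: A_def powr_diff)
  have "flux p z \<bullet> w \<le> A * norm w"
    using norm_cauchy_schwarz[of "flux p z" w] by (simp add: norm_flux[OF assms] A_def)
  then have "p * (flux p z \<bullet> w) \<le> p * (A * norm w)"
    using assms by (intro mult_left_mono) auto
  moreover have "norm z powr p + p * norm z powr (p - 1) * (norm w - norm z) \<le> norm w powr p"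
    using assms by (intro powr_convex_tangent) auto
  then have "A * norm z + (p * (A * norm w) - p * (A * norm z)) \<le> norm w powr p"
    unfolding Az A_def[symmetric] by (simp only: right_diff_distrib mult.assoc)
  moreover have "p * (flux p z \<bullet> (w - z)) = p * (flux p z \<bullet> w) - p * (A * norm z)"
    by (simp add: inner_diff_right inner_flux_self[OF assms] Az right_diff_distrib)
  ultimately have "norm z powr p + p * (flux p z \<bullet> (w - z)) \<le> norm w powr p"
    unfolding Az by linarith
  then have "(norm z powr p + p * (flux p z \<bullet> (w - z))) / p \<le> norm w powr p / p"
    using assms by (intro divide_right_mono) auto
  then show ?thesis
    using assms by (simp add: cost_def add_divide_distrib)
qed

lemma cost_convex_combination:
  fixes a b :: "'a::real_inner"
  assumes "1 < p" "0 \<le> t" "t \<le> 1"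
  shows "cost p ((1 - t) *\<^sub>R a + t *\<^sub>R b) \<le> (1 - t) * cost p a + t * cost p b"
proof -
  define z where "z = (1 - t) *\<^sub>R a + t *\<^sub>R b"
  have "(1 - t) * (cost p z + flux p z \<bullet> (a - z)) + t * (cost p z + flux p z \<bullet> (b - z))
      \<le> (1 - t) * cost p a + t * cost p b"
    using assms by (intro add_mono mult_left_mono cost_tangent) auto
  moreover have "(1 - t) *\<^sub>R (a - z) + t *\<^sub>R (b - z) = 0"
    by (simp add: z_def algebra_simps)
  then have "(1 - t) * (flux p z \<bullet> (a - z)) + t * (flux p z \<bullet> (b - z)) = 0"
    by (metis inner_add_right inner_scaleR_right inner_zero_right)
  ultimately show ?thesis
    unfolding z_def[symmetric] by (simp add: algebra_simps)
qed

lemma isCont_flux: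
  fixes z :: "'a::real_inner"
  assumes "1 < p"
  shows "isCont (flux p) z"
proof (cases "z = 0")
  case True
  have "((\<lambda>z::'a. norm z powr (p - 1)) \<longlongrightarrow> norm (0::'a) powr (p - 1)) (at 0)"
    using assms by (intro tendsto_powr' tendsto_intros) auto
  then have "((\<lambda>z::'a. norm (flux p z)) \<longlongrightarrow> 0) (at 0)"
    by (simp add: norm_flux[OF assms])
  then have "(flux p \<longlongrightarrow> (0::'a)) (at 0)"
    by (rule tendsto_norm_zero_cancel)
  then show ?thesis
    using True by (simp add: isCont_def) (simp add: flux_def)
next
  case False
  then show ?thesis
    unfolding flux_def by (intro continuous_intros) auto
qed

lemma GDERIV_sandwich:
  fixes f h l :: "'a::real_inner \<Rightarrow> real"
  assumes h: "GDERIV h y :> g" and l: "GDERIV l y :> g"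
    and fh: "\<And>x. f x \<le> h x" and lf: "\<And>x. l x \<le> f x"
    and eq: "f y = h y" "f y = l y"
  shows "GDERIV f y :> g"
  unfolding gderiv_def has_derivative_at_alt
proof (intro conjI allI impI)
  show "bounded_linear (\<lambda>h. h \<bullet> g)" by (rule bounded_linear_inner_left)
  fix e :: real assume "0 < e"
  obtain d1 where d1: "d1 > 0" "\<And>x. norm (x - y) < d1 \<Longrightarrow> norm (h x - h y - (x - y) \<bullet> g) \<le> e * norm (x - y)"
    using h \<open>0 < e\<close> unfolding gderiv_def has_derivative_at_alt by blast
  obtain d2 where d2: "d2 > 0" "\<And>x. norm (x - y) < d2 \<Longrightarrow> norm (l x - l y - (x - y) \<bullet> g) \<le> e * norm (x - y)"
    using l \<open>0 < e\<close> unfolding gderiv_def has_derivative_at_alt by blast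
  show "\<exists>d>0. \<forall>x. norm (x - y) < d \<longrightarrow> norm (f x - f y - (x - y) \<bullet> g) \<le> e * norm (x - y)"
  proof (intro exI[of _ "min d1 d2"] conjI allI impI)
    fix x assume "norm (x - y) < min d1 d2"
    then have "norm (x - y) < d1" "norm (x - y) < d2" by auto
    from d1(2)[OF this(1)] d2(2)[OF this(2)] fh[of x] lf[of x] eq
    show "norm (f x - f y - (x - y) \<bullet> g) \<le> e * norm (x - y)"
      unfolding real_norm_def abs_le_iff by auto
  qed (use d1 d2 in auto)
qed

lemma GDERIV_cost:
  fixes z :: "'a::real_inner"
  assumes p: "1 < p"
  shows "GDERIV (cost p) z :> flux p z"
  unfolding gderiv_def has_derivative_at_alt
proof (intro conjI allI impI)
  show "bounded_linear (\<lambda>h. h \<bullet> flux p z)" by (rule bounded_linear_inner_left)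
  fix e :: real assume "0 < e"
  then obtain d where d: "d > 0" "\<And>x. norm (x - z) < d \<Longrightarrow> norm (flux p x - flux p z) < e"
    using isCont_flux[OF p, of z] unfolding continuous_at_eps_delta dist_norm by meson
  show "\<exists>d>0. \<forall>x. norm (x - z) < d \<longrightarrow> norm (cost p x - cost p z - (x - z) \<bullet> flux p z) \<le> e * norm (x - z)"
  proof (intro exI[of _ d] conjI allI impI)
    fix x assume x: "norm (x - z) < d"
    have 1: "0 \<le> cost p x - cost p z - (x - z) \<bullet> flux p z"
      using cost_tangent[OF p, of z x] by (simp add: inner_commute)
    have "cost p x - cost p z - (x - z) \<bullet> flux p z \<le> (flux p x - flux p z) \<bullet> (x - z)"
      using cost_tangent[OF p, of x z] by (simp add: inner_diff_left inner_diff_right inner_commute)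
    also have "\<dots> \<le> norm (flux p x - flux p z) * norm (x - z)"
      by (rule norm_cauchy_schwarz)
    also have "\<dots> \<le> e * norm (x - z)"
      using d(2)[OF x] by (intro mult_right_mono) auto
    finally show "norm (cost p x - cost p z - (x - z) \<bullet> flux p z) \<le> e * norm (x - z)"
      using 1 by simp
  qed (use d in auto)
qed

lemma GDERIV_unique:
  assumes "GDERIV f x :> D" "GDERIV f x :> E"
  shows "D = E"
proof -
  have "(\<lambda>h. h \<bullet> D) = (\<lambda>h. h \<bullet> E)"
    using assms unfolding gderiv_def by (rule has_derivative_unique)
  then have "(D - E) \<bullet> D = (D - E) \<bullet> E" by meson
  then have "(D - E) \<bullet> (D - E) = 0" by (simp add: inner_diff_right)
  then show ?thesis by simp
qed

lemma grad_eqI: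
  assumes "GDERIV f x :> D"
  shows "grad f x = D"
proof -
  have "(THE D. GDERIV f x :> D) = D"
    using assms by (rule the_equality) (rule GDERIV_unique[OF _ assms])
  then show ?thesis unfolding grad_def using assms by auto
qed

lemma continuous_on_cost: "1 < p \<Longrightarrow> continuous_on UNIV (cost p :: 'a::real_inner \<Rightarrow> real)"
  unfolding cost_def by (intro continuous_on_divide continuous_on_powr' continuous_on_norm continuous_on_id continuous_on_const) auto

text \<open>For \<open>p \<le> 2\<close> the cost is a concave function of \<open>|z|\<^sup>2\<close>; the tangent line of that
  function at \<open>|z|\<^sup>2\<close> is an upper paraboloid touching at \<open>z\<close>.\<close>
lemma cost_upper_subquadratic:
  fixes z k :: "'a::real_inner"
  assumes "1 < p" "p \<le> 2" "z \<noteq> 0"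
  shows "cost p (z + k) \<le> cost p z + flux p z \<bullet> k + norm z powr (p - 2) / 2 * (norm k)\<^sup>2"
proof -
  have 1: "((norm (z + k))\<^sup>2) powr (p / 2) \<le> ((norm z)\<^sup>2) powr (p / 2)
      + p / 2 * ((norm z)\<^sup>2) powr (p / 2 - 1) * ((norm (z + k))\<^sup>2 - (norm z)\<^sup>2)"
    using assms by (intro powr_concave_tangent) auto
  have sq: "((norm x)\<^sup>2) powr a = norm x powr (2 * a)" for x :: 'a and a
  proof -
    have "(norm x)\<^sup>2 = norm x powr 2" by simp
    then show ?thesis by (simp only: powr_powr)
  qed
  have "(norm (z + k))\<^sup>2 - (norm z)\<^sup>2 = 2 * (z \<bullet> k) + (norm k)\<^sup>2"
    by (simp add: power2_norm_eq_inner inner_add_left inner_add_right inner_commute)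
  with 1 have "norm (z + k) powr p \<le> norm z powr p
      + p / 2 * norm z powr (p - 2) * (2 * (z \<bullet> k) + (norm k)\<^sup>2)"
    by (simp add: sq right_diff_distrib)
  then have "norm (z + k) powr p / p \<le> (norm z powr p
      + p / 2 * norm z powr (p - 2) * (2 * (z \<bullet> k) + (norm k)\<^sup>2)) / p"
    using assms by (intro divide_right_mono) auto
  also have "\<dots> = cost p z + flux p z \<bullet> k + norm z powr (p - 2) / 2 * (norm k)\<^sup>2"
    using assms by (simp add: cost_def flux_def add_divide_distrib distrib_left)
  finally show ?thesis
    by (simp add: cost_def)
qed

lemma flux_lipschitz_superquadratic:
  fixes x y :: "'a::real_inner"
  assumes p: "2 \<le> p" and R: "norm x \<le> R" "norm y \<le> R"
  shows "norm (flux p x - flux p y) \<le> p * R powr (p - 2) * norm (x - y)"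
proof -
  have *: "norm (flux p x - flux p y) \<le> p * R powr (p - 2) * norm (x - y)"
    if le: "norm y \<le> norm x" and R: "norm x \<le> R" for x y :: 'a
  proof (cases "x = 0")
    case True then show ?thesis using le by (simp add: flux_def)
  next
    case False
    let ?s = "norm x" and ?\<sigma> = "norm y"
    have s: "?s > 0" using False by simp
    have "flux p x - flux p y = (?s powr (p - 2)) *\<^sub>R (x - y) + (?s powr (p - 2) - ?\<sigma> powr (p - 2)) *\<^sub>R y"
      by (simp add: flux_def algebra_simps)
    then have "norm (flux p x - flux p y)
        \<le> norm ((?s powr (p - 2)) *\<^sub>R (x - y)) + norm ((?s powr (p - 2) - ?\<sigma> powr (p - 2)) *\<^sub>R y)"
      by (metis norm_triangle_ineq)
    also have "\<dots> = ?s powr (p - 2) * norm (x - y) + (?s powr (p - 2) - ?\<sigma> powr (p - 2)) * ?\<sigma>"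
      using p le by (cases "y = 0") (auto simp: powr_mono2)
    also have "(?s powr (p - 2) - ?\<sigma> powr (p - 2)) * ?\<sigma> \<le> (p - 1) * ?s powr (p - 2) * norm (x - y)"
    proof (cases "y = 0")
      case True then show ?thesis using p by simp
    next
      case y: False
      have "?s powr (p - 2) * ?\<sigma> \<le> ?s powr (p - 2) * ?s"
        using le by (intro mult_left_mono) auto
      moreover have "?s powr (p - 2) * ?s = ?s powr (p - 1)" "?\<sigma> powr (p - 2) * ?\<sigma> = ?\<sigma> powr (p - 1)"
        using False y powr_add[of ?s "p - 2" 1] powr_add[of ?\<sigma> "p - 2" 1] by auto
      moreover have "?s powr (p - 1) + (p - 1) * ?s powr (p - 1 - 1) * (?\<sigma> - ?s) \<le> ?\<sigma> powr (p - 1)"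
        using p by (intro powr_convex_tangent) auto
      moreover have "(p - 1) * ?s powr (p - 2) * (?s - ?\<sigma>) \<le> (p - 1) * ?s powr (p - 2) * norm (x - y)"
        using p norm_triangle_ineq2[of x y] by (intro mult_left_mono) auto
      ultimately show ?thesis by (simp add: algebra_simps)
    qed
    also have "?s powr (p - 2) * norm (x - y) + (p - 1) * ?s powr (p - 2) * norm (x - y)
        = p * ?s powr (p - 2) * norm (x - y)"
      by (simp add: algebra_simps)
    also have "\<dots> \<le> p * R powr (p - 2) * norm (x - y)"
      using p R by (intro mult_right_mono mult_left_mono powr_mono2) auto
    finally show ?thesis by simp
  qed
  show ?thesis
    using *[of y x] *[of x y] R by (cases "norm y \<le> norm x") (auto simp: norm_minus_commute)
qed

lemma cost_upper_superquadratic: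
  fixes z k :: "'a::real_inner"
  assumes p: "2 \<le> p" and "norm z \<le> R" "norm k \<le> 1"
  shows "cost p (z + k) \<le> cost p z + flux p z \<bullet> k + p * (R + 1) powr (p - 2) * (norm k)\<^sup>2"
proof -
  have "norm (z + k) \<le> R + 1"
    using assms norm_triangle_ineq[of z k] by linarith
  then have "norm (flux p (z + k) - flux p z) \<le> p * (R + 1) powr (p - 2) * norm (z + k - z)"
    using assms by (intro flux_lipschitz_superquadratic) auto
  then have "norm (flux p (z + k) - flux p z) * norm k \<le> p * (R + 1) powr (p - 2) * norm k * norm k"
    by (intro mult_right_mono) auto
  moreover have "(flux p (z + k) - flux p z) \<bullet> k \<le> norm (flux p (z + k) - flux p z) * norm k"
    by (rule norm_cauchy_schwarz)
  moreover have "cost p (z + k) + flux p (z + k) \<bullet> (z - (z + k)) \<le> cost p z"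
    using p by (intro cost_tangent) auto
  ultimately show ?thesis
    by (simp add: inner_diff_left power2_eq_square algebra_simps)
qed

lemma flux_strongly_monotone_superquadratic:
  fixes x y :: "'a::real_inner"
  assumes p: "2 \<le> p" and r: "0 < r" "r \<le> norm x" "r \<le> norm y"
  shows "r powr (p - 2) * norm (x - y) \<le> norm (flux p x - flux p y)"
proof -
  have *: "r powr (p - 2) * norm (x - y) \<le> norm (flux p x - flux p y)"
    if le: "norm y \<le> norm x" and r: "r \<le> norm y" for x y :: 'a
  proof (cases "x = y")
    case False
    let ?a = "norm x powr (p - 2)" and ?b = "norm y powr (p - 2)"
    have ab: "?b \<le> ?a" "r powr (p - 2) \<le> ?b"
      using p le r \<open>0 < r\<close> by (auto intro!: powr_mono2)
    have "x \<bullet> y \<le> norm x * norm x"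
      using norm_cauchy_schwarz[of x y] le mult_left_mono[of "norm y" "norm x" "norm x"] by simp
    then have "0 \<le> (?a - ?b) * (x \<bullet> (x - y))"
      using ab by (intro mult_nonneg_nonneg) (auto simp: inner_diff_right power2_norm_eq_inner power2_eq_square[symmetric])
    moreover have "r powr (p - 2) * (norm (x - y))\<^sup>2 \<le> ?b * (norm (x - y))\<^sup>2"
      using ab by (intro mult_right_mono) auto
    ultimately have "r powr (p - 2) * (norm (x - y))\<^sup>2 \<le> (flux p x - flux p y) \<bullet> (x - y)"
      by (simp add: flux_def power2_norm_eq_inner inner_diff_left inner_diff_right inner_commute algebra_simps)
    also have "\<dots> \<le> norm (flux p x - flux p y) * norm (x - y)"
      by (rule norm_cauchy_schwarz)
    finally show ?thesis
      using False by (simp add: power2_eq_square)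
  qed simp
  show ?thesis
    using *[of y x] *[of x y] r by (cases "norm y \<le> norm x") (auto simp: norm_minus_commute)
qed

lemma flux_strongly_monotone_subquadratic:
  fixes x y :: "'a::real_inner"
  assumes p: "1 < p" "p \<le> 2" and le: "norm y \<le> norm x"
  shows "(p - 1) * norm x powr (p - 2) * norm (x - y) \<le> norm (flux p x - flux p y)"
proof -
  consider "x = y" | "y = 0" "x \<noteq> 0" | "x \<noteq> y" "y \<noteq> 0" "x \<noteq> 0" using le by force
  then show ?thesis
  proof cases
    case 1 then show ?thesis by simp
  next
    case 2
    then have "norm (flux p x - flux p y) = norm x powr (p - 2) * norm x"
      by (simp add: flux_def)
    then show ?thesis using 2 p by (simp add: mult_left_le_one_le mult.assoc)
  next
    case 3
    let ?s = "norm x" and ?\<sigma> = "norm y"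
    let ?a = "?s powr (p - 2)" and ?b = "?\<sigma> powr (p - 2)"
    have ab: "?a \<le> ?b"
      using p le 3 by (intro powr_mono2') auto
    have "(p - 1) * ?a \<le> 1 * ?a"
      using p by (intro mult_right_mono) auto
    then have coef: "0 \<le> ?a + ?b - 2 * ((p - 1) * ?a)"
      using ab by linarith
    have "x \<bullet> y \<le> ?s * ?\<sigma>"
      by (rule norm_cauchy_schwarz)
    then have "(?a + ?b - 2 * ((p - 1) * ?a)) * (x \<bullet> y) \<le> (?a + ?b - 2 * ((p - 1) * ?a)) * (?s * ?\<sigma>)"
      using coef by (rule mult_left_mono)
    moreover have "(p - 1) * ?a * (?s - ?\<sigma>)\<^sup>2 \<le> (?a * ?s - ?b * ?\<sigma>) * (?s - ?\<sigma>)"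
    proof -
      have "?\<sigma> powr (p - 1) \<le> ?s powr (p - 1) + (p - 1) * ?s powr (p - 1 - 1) * (?\<sigma> - ?s)"
        using p 3 by (intro powr_concave_tangent) auto
      moreover have "?a * ?s = ?s powr (p - 1)" "?b * ?\<sigma> = ?\<sigma> powr (p - 1)"
        using 3 powr_add[of ?s "p - 2" 1] powr_add[of ?\<sigma> "p - 2" 1] by auto
      ultimately have "(p - 1) * ?a * (?s - ?\<sigma>) \<le> ?a * ?s - ?b * ?\<sigma>"
        by (simp add: algebra_simps)
      then have "(p - 1) * ?a * (?s - ?\<sigma>) * (?s - ?\<sigma>) \<le> (?a * ?s - ?b * ?\<sigma>) * (?s - ?\<sigma>)"
        using le by (intro mult_right_mono) auto
      then show ?thesis by (simp add: power2_eq_square mult.assoc)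
    qed
    moreover have "(norm (x - y))\<^sup>2 = ?s\<^sup>2 + ?\<sigma>\<^sup>2 - 2 * (x \<bullet> y)"
      by (simp add: power2_norm_eq_inner inner_diff_left inner_diff_right inner_commute)
    moreover have "(flux p x - flux p y) \<bullet> (x - y) = ?a * ?s\<^sup>2 + ?b * ?\<sigma>\<^sup>2 - (?a + ?b) * (x \<bullet> y)"
      by (simp add: flux_def power2_norm_eq_inner inner_diff_left inner_diff_right inner_commute algebra_simps)
    moreover have alg: "c * (s\<^sup>2 + \<sigma>\<^sup>2 - 2 * \<tau>) \<le> a * s\<^sup>2 + b * \<sigma>\<^sup>2 - (a + b) * \<tau>"
      if "(a + b - 2 * c) * \<tau> \<le> (a + b - 2 * c) * (s * \<sigma>)"
         "c * (s - \<sigma>)\<^sup>2 \<le> (a * s - b * \<sigma>) * (s - \<sigma>)" for a b c s \<sigma> \<tau> :: real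
      using that by (simp add: algebra_simps power2_eq_square)
    ultimately have "(p - 1) * ?a * (norm (x - y))\<^sup>2 \<le> (flux p x - flux p y) \<bullet> (x - y)"
      using alg[of ?a ?b "(p - 1) * ?a" "x \<bullet> y" ?s ?\<sigma>] by presburger
    also have "\<dots> \<le> norm (flux p x - flux p y) * norm (x - y)"
      by (rule norm_cauchy_schwarz)
    finally show ?thesis
      using 3 by (simp add: power2_eq_square)
  qed
qed


section \<open>Semiconvex functions\<close>

text \<open>Convexity of \<open>v + C / 2 |x|\<^sup>2\<close>, written without the quadratic function so that invariance
  under translations and suprema is apparent.\<close>
definition semiconvex_with :: "real \<Rightarrow> ('a::real_inner \<Rightarrow> real) \<Rightarrow> bool" where
  "semiconvex_with C v \<longleftrightarrow>
     (\<forall>a b s. 0 \<le> s \<and> s \<le> 1 \<longrightarrow>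
        v (s *\<^sub>R a + (1 - s) *\<^sub>R b) \<le> s * v a + (1 - s) * v b + C / 2 * (s * (1 - s) * (norm (a - b))\<^sup>2))"

lemma semi_convex_imp_semiconvex_with:
  assumes "semi_convex v"
  obtains C where "0 \<le> C" "semiconvex_with C v"
proof -
  obtain C where C: "C \<ge> 0" "convex_on UNIV (\<lambda>x. v x + C / 2 * (norm x)\<^sup>2)"
    using assms unfolding semi_convex_def by blast
  have "semiconvex_with C v"
    unfolding semiconvex_with_def
  proof (intro allI impI)
    fix a b :: 'a and s :: real assume s: "0 \<le> s \<and> s \<le> 1"
    let ?w = "s *\<^sub>R a + (1 - s) *\<^sub>R b"
    have "v ?w + C / 2 * (norm ?w)\<^sup>2 \<le> s * (v a + C / 2 * (norm a)\<^sup>2) + (1 - s) * (v b + C / 2 * (norm b)\<^sup>2)"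
      using C(2) s unfolding convex_on_def by auto
    moreover have "(norm ?w)\<^sup>2 = s * (norm a)\<^sup>2 + (1 - s) * (norm b)\<^sup>2 - s * (1 - s) * (norm (a - b))\<^sup>2"
      by (simp add: power2_norm_eq_inner inner_add_left inner_add_right inner_diff_left inner_diff_right
          inner_commute algebra_simps)
    then have "C / 2 * (norm ?w)\<^sup>2 = s * (C / 2 * (norm a)\<^sup>2) + (1 - s) * (C / 2 * (norm b)\<^sup>2)
        - C / 2 * (s * (1 - s) * (norm (a - b))\<^sup>2)"
      by (simp only:) (simp add: algebra_simps add_divide_distrib diff_divide_distrib)
    ultimately show "v ?w \<le> s * v a + (1 - s) * v b + C / 2 * (s * (1 - s) * (norm (a - b))\<^sup>2)"
      unfolding distrib_left by linarith
  qed
  with C(1) show ?thesis by (rule that)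
qed

text \<open>Convexity along the line through \<open>y\<close>: the value at \<open>y\<close> lies below the chord from
  \<open>y - s h\<close> to \<open>y + h\<close>, and letting \<open>s\<close> tend to \<open>0\<close> turns the gradient of an upper touching
  function into a subgradient.\<close>
lemma semiconvex_touched_above:
  fixes v H :: "'a::real_inner \<Rightarrow> real"
  assumes sc: "semiconvex_with C v" and H: "GDERIV H y :> g"
    and le: "\<And>x. v x \<le> H x" and eq: "v y = H y"
  shows "v y + g \<bullet> h - C / 2 * (norm h)\<^sup>2 \<le> v (y + h)"
proof -
  have *: "v y + (H y - H (y - s *\<^sub>R h)) / s - C / 2 * ((1 + s) * (norm h)\<^sup>2) \<le> v (y + h)" if s: "s > 0" for s
  proof -
    define l where "l = s / (1 + s)"
    have l: "0 \<le> l" "l \<le> 1" "1 - l = 1 / (1 + s)" using s by (auto simp: l_def field_simps)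
    have "l *\<^sub>R (y + h) + (1 - l) *\<^sub>R (y - s *\<^sub>R h) = (l + (1 - l)) *\<^sub>R y + (l - (1 - l) * s) *\<^sub>R h"
      by (simp add: algebra_simps)
    also have "l - (1 - l) * s = 0" using l(3) by (simp add: l_def)
    finally have y: "l *\<^sub>R (y + h) + (1 - l) *\<^sub>R (y - s *\<^sub>R h) = y" by simp
    have d: "(y + h) - (y - s *\<^sub>R h) = (1 + s) *\<^sub>R h" by (simp add: algebra_simps)
    have "v y \<le> l * v (y + h) + (1 - l) * v (y - s *\<^sub>R h)
        + C / 2 * (l * (1 - l) * (norm ((1 + s) *\<^sub>R h))\<^sup>2)"
      using sc l(1,2) unfolding semiconvex_with_def by (metis y d)
    also have "l * (1 - l) * (norm ((1 + s) *\<^sub>R h))\<^sup>2 = s * (norm h)\<^sup>2"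
      using s unfolding l(3) by (simp add: l_def power_mult_distrib power2_eq_square)
    finally have "v y \<le> l * v (y + h) + (1 - l) * v (y - s *\<^sub>R h) + C / 2 * (s * (norm h)\<^sup>2)" .
    moreover have "(1 - l) * v (y - s *\<^sub>R h) \<le> (1 - l) * H (y - s *\<^sub>R h)"
      using l(2) le by (intro mult_left_mono) (simp_all only: diff_ge_0_iff_ge)
    ultimately have "v y \<le> l * v (y + h) + (1 - l) * H (y - s *\<^sub>R h) + C / 2 * (s * (norm h)\<^sup>2)"
      by linarith
    then have "(1 + s) * v y \<le> (1 + s) * (l * v (y + h) + (1 - l) * H (y - s *\<^sub>R h) + C / 2 * (s * (norm h)\<^sup>2))"
      using s by (intro mult_left_mono) auto
    also have "\<dots> = ((1 + s) * l) * v (y + h) + ((1 + s) * (1 - l)) * H (y - s *\<^sub>R h) + s * (C / 2 * ((1 + s) * (norm h)\<^sup>2))"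
      by (simp add: algebra_simps)
    also have "(1 + s) * l = s" using s by (simp add: l_def)
    also have "(1 + s) * (1 - l) = 1" using s by (simp add: l(3))
    finally have "(1 + s) * v y \<le> s * v (y + h) + 1 * H (y - s *\<^sub>R h)
        + s * (C / 2 * ((1 + s) * (norm h)\<^sup>2))" .
    moreover have "s * ((H y - H (y - s *\<^sub>R h)) / s) = H y - H (y - s *\<^sub>R h)" using s by simp
    moreover have "(1 + s) * v y = v y + s * v y" by (simp add: distrib_right)
    ultimately have "s * (v y + (H y - H (y - s *\<^sub>R h)) / s - C / 2 * ((1 + s) * (norm h)\<^sup>2)) \<le> s * v (y + h)"
      unfolding right_diff_distrib distrib_left using eq by linarith
    then show ?thesis using s by simp
  qed
  have "((\<lambda>s. y - s *\<^sub>R h) has_derivative (\<lambda>s. - (s *\<^sub>R h))) (at 0)"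
    by (auto intro!: derivative_eq_intros)
  then have "((\<lambda>s. H (y - s *\<^sub>R h)) has_derivative (\<lambda>s. (- (s *\<^sub>R h)) \<bullet> g)) (at 0)"
    by (rule has_derivative_compose) (use H in \<open>simp add: gderiv_def\<close>)
  then have "((\<lambda>s. H (y - s *\<^sub>R h)) has_real_derivative (- (g \<bullet> h))) (at 0)"
    by (rule has_derivative_imp_has_field_derivative) (simp add: inner_commute)
  then have "((\<lambda>s. (H (y - s *\<^sub>R h) - H y) / s) \<longlongrightarrow> - (g \<bullet> h)) (at_right 0)"
    unfolding DERIV_def by (simp add: filterlim_at_split)
  then have "((\<lambda>s. - ((H (y - s *\<^sub>R h) - H y) / s)) \<longlongrightarrow> g \<bullet> h) (at_right 0)"
    using tendsto_minus by fastforce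
  then have lim: "((\<lambda>s. (H y - H (y - s *\<^sub>R h)) / s) \<longlongrightarrow> g \<bullet> h) (at_right 0)"
    by (simp add: minus_divide_left)
  have lim': "((\<lambda>s. v y + (H y - H (y - s *\<^sub>R h)) / s - C / 2 * ((1 + s) * (norm h)\<^sup>2))
      \<longlongrightarrow> v y + g \<bullet> h - C / 2 * ((1 + 0) * (norm h)\<^sup>2)) (at_right 0)"
    by (intro tendsto_intros lim)
  have "v y + g \<bullet> h - C / 2 * ((1 + 0) * (norm h)\<^sup>2) \<le> v (y + h)"
    by (rule tendsto_upperbound[OF lim' eventually_mono[OF eventually_at_right_less[of 0]]])
      (rule *, simp_all)
  then show ?thesis by simp
qed

text \<open>Compare the subgradient inequality at \<open>x2\<close> with the upper paraboloid at \<open>x1\<close> in the point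
  \<open>x2 + h\<close>, where \<open>h\<close> has length \<open>d\<close> and the direction of \<open>g2 - g1\<close>. The free parameter \<open>d\<close>
  also covers \<open>x1 = x2\<close>, where \<open>d\<close> may be arbitrarily small.\<close>
lemma subgradient_difference_bound:
  fixes f :: "'a::real_inner \<Rightarrow> real"
  assumes low1: "\<And>h. f x1 + g1 \<bullet> h - C / 2 * (norm h)\<^sup>2 \<le> f (x1 + h)"
    and low2: "\<And>h. f x2 + g2 \<bullet> h - C / 2 * (norm h)\<^sup>2 \<le> f (x2 + h)"
    and up1: "\<And>h. norm h \<le> 2 * d \<Longrightarrow> f (x1 + h) \<le> f x1 + g1 \<bullet> h + A / 2 * (norm h)\<^sup>2"
    and d: "0 < d" "norm (x2 - x1) \<le> d" and C: "0 \<le> C" and A: "0 \<le> A"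
  shows "norm (g2 - g1) \<le> (C + 2 * A) * d"
proof (cases "g2 = g1")
  case False
  define h where "h = (d / norm (g2 - g1)) *\<^sub>R (g2 - g1)"
  have nh: "norm h = d" using d False by (simp add: h_def)
  have gh: "(g2 - g1) \<bullet> h = d * norm (g2 - g1)"
    using False by (simp add: h_def power2_norm_eq_inner[symmetric] power2_eq_square)
  let ?w = "x2 - x1"
  have n: "norm (?w + h) \<le> 2 * d"
    using norm_triangle_ineq[of ?w h] d nh by linarith
  have "f (x1 + (?w + h)) \<le> f x1 + g1 \<bullet> (?w + h) + A / 2 * (norm (?w + h))\<^sup>2"
    by (rule up1) (rule n)
  moreover have "A / 2 * (norm (?w + h))\<^sup>2 \<le> A / 2 * (2 * d)\<^sup>2"
    using A n by (intro mult_left_mono power_mono) auto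
  moreover have "f x2 + g2 \<bullet> h - C / 2 * (norm h)\<^sup>2 \<le> f (x2 + h)" by (rule low2)
  moreover have "f x1 + g1 \<bullet> ?w - C / 2 * (norm ?w)\<^sup>2 \<le> f (x1 + ?w)" by (rule low1)
  moreover have "C / 2 * (norm ?w)\<^sup>2 \<le> C / 2 * d\<^sup>2"
    using C d by (intro mult_left_mono power_mono) auto
  moreover have "C / 2 * (norm h)\<^sup>2 = C / 2 * d\<^sup>2" by (simp add: nh)
  moreover have "x1 + (?w + h) = x2 + h" "x1 + ?w = x2" by auto
  moreover have "g1 \<bullet> (?w + h) = g1 \<bullet> ?w + g1 \<bullet> h" by (rule inner_add_right)
  moreover have "(g2 - g1) \<bullet> h = g2 \<bullet> h - g1 \<bullet> h" by (rule inner_diff_left)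
  moreover have "A / 2 * (2 * d)\<^sup>2 = 2 * A * d\<^sup>2" by (simp add: power2_eq_square)
  ultimately have "d * norm (g2 - g1) \<le> C * d\<^sup>2 + 2 * A * d\<^sup>2"
    using gh by (simp only:)
  then have "d * norm (g2 - g1) \<le> d * ((C + 2 * A) * d)"
    by (simp add: power2_eq_square algebra_simps)
  then show ?thesis using d by simp
qed (use d C A in auto)


section \<open>Contact points of the Lax--Hopf formula\<close>

lemma cost_scale_mono:
  fixes z :: "'a::real_inner"
  assumes "1 < p" "0 < s" "s \<le> 1"
  shows "cost p z \<le> s * cost p ((1 / s) *\<^sub>R z)"
  using cost_convex_combination[of p s 0 "(1 / s) *\<^sub>R z"] assms by (simp add: cost_def)

lemma lax_hopf_1 [simp]: "lax_hopf p v 1 = v"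
  by (simp add: lax_hopf_def fun_eq_iff)

lemma lax_hopf_0: "lax_hopf p v 0 x = (SUP y. v y - cost p (x - y))"
  by (simp add: lax_hopf_def)

lemma lax_hopf_bdd_above:
  fixes v :: "'a::real_inner \<Rightarrow> real"
  assumes p: "1 < p" and bdd: "\<And>x. bdd_above (range (\<lambda>y. v y - cost p (x - y)))"
    and t: "0 \<le> t" "t < 1"
  shows "bdd_above (range (\<lambda>y. v y - (1 - t) * cost p ((1 / (1 - t)) *\<^sub>R (x - y))))"
proof -
  obtain B where B: "\<And>y. v y - cost p (x - y) \<le> B"
    using bdd[of x] by (auto simp: bdd_above_def)
  show ?thesis
  proof (rule bdd_aboveI2)
    fix y show "v y - (1 - t) * cost p ((1 / (1 - t)) *\<^sub>R (x - y)) \<le> B"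
      using B[of y] cost_scale_mono[of p "1 - t" "x - y"] p t by auto
  qed
qed

lemma lax_hopf_ge:
  fixes v :: "'a::real_inner \<Rightarrow> real"
  assumes "1 < p" "\<And>x. bdd_above (range (\<lambda>y. v y - cost p (x - y)))" "0 \<le> t" "t < 1"
  shows "v y - (1 - t) * cost p ((1 / (1 - t)) *\<^sub>R (x - y)) \<le> lax_hopf p v t x"
  using cSUP_upper[OF UNIV_I lax_hopf_bdd_above[OF assms], of y] assms by (simp add: lax_hopf_def)

lemma lax_hopf_0_ge:
  fixes v :: "'a::real_inner \<Rightarrow> real"
  assumes "1 < p" "\<And>x. bdd_above (range (\<lambda>y. v y - cost p (x - y)))"
  shows "v y - cost p (x - y) \<le> lax_hopf p v 0 x"
  using lax_hopf_ge[OF assms, of 0 y x] by simp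

text \<open>By convexity of the cost, the straight path from \<open>x\<close> to a competitor has at most the action
  of a path broken at time \<open>t\<close> in the point \<open>y\<close>.\<close>
lemma lax_hopf_0_ge_lax_hopf:
  fixes v :: "'a::real_inner \<Rightarrow> real"
  assumes p: "1 < p" and bdd: "\<And>x. bdd_above (range (\<lambda>y. v y - cost p (x - y)))"
    and t: "0 < t" "t \<le> 1"
  shows "lax_hopf p v t y - t * cost p ((1 / t) *\<^sub>R (y - x)) \<le> lax_hopf p v 0 x"
proof (cases "t = 1")
  case True
  then show ?thesis using lax_hopf_0_ge[OF p bdd, of y x] by (simp add: cost_diff_commute)
next
  case False
  then have t1: "t < 1" using t by simp
  have "lax_hopf p v t y \<le> lax_hopf p v 0 x + t * cost p ((1 / t) *\<^sub>R (y - x))"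
    using t1 unfolding lax_hopf_def[of p v t y]
  proof (simp only: if_True, intro cSUP_least)
    fix m
    let ?a = "(1 / (1 - t)) *\<^sub>R (y - m)" and ?b = "(1 / t) *\<^sub>R (x - y)"
    have "(1 - t) *\<^sub>R ?a + t *\<^sub>R ?b = x - m" using t t1 by simp
    then have "cost p (x - m) \<le> (1 - t) * cost p ?a + t * cost p ?b"
      using cost_convex_combination[OF p, of t ?a ?b] t t1 by simp
    moreover have "v m - cost p (x - m) \<le> lax_hopf p v 0 x"
      by (rule lax_hopf_0_ge[OF p bdd])
    moreover have "cost p ?b = cost p ((1 / t) *\<^sub>R (y - x))"
      by (simp add: cost_def norm_minus_commute)
    ultimately show "v m - (1 - t) * cost p ?a \<le> lax_hopf p v 0 x + t * cost p ((1 / t) *\<^sub>R (y - x))"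
      by simp
  qed simp
  then show ?thesis by simp
qed

text \<open>Substituting \<open>z = x - y\<close> exhibits \<open>lax_hopf p v t\<close> as a supremum of translates of \<open>v\<close> plus
  constants, so a bound that is invariant under translations passes from \<open>v\<close> to it.\<close>
lemma semiconvex_lax_hopf:
  fixes v :: "'a::real_inner \<Rightarrow> real"
  assumes p: "1 < p" and bdd: "\<And>x. bdd_above (range (\<lambda>y. v y - cost p (x - y)))"
    and sc: "semiconvex_with C v" and t: "0 \<le> t" "t \<le> 1"
  shows "semiconvex_with C (lax_hopf p v t)"
proof (cases "t = 1")
  case False
  then have t1: "t < 1" using t by simp
  show ?thesis
    unfolding semiconvex_with_def
  proof (intro allI impI)
    fix a b :: 'a and s :: real assume s: "0 \<le> s \<and> s \<le> 1"
    let ?w = "s *\<^sub>R a + (1 - s) *\<^sub>R b"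
    let ?e = "C / 2 * (s * (1 - s) * (norm (a - b))\<^sup>2)"
    show "lax_hopf p v t ?w \<le> s * lax_hopf p v t a + (1 - s) * lax_hopf p v t b + ?e"
      using t1 unfolding lax_hopf_def[of p v t ?w]
    proof (simp only: if_True, intro cSUP_least)
      fix y
      define z where "z = ?w - y"
      let ?k = "(1 - t) * cost p ((1 / (1 - t)) *\<^sub>R z)"
      have y: "y = s *\<^sub>R (a - z) + (1 - s) *\<^sub>R (b - z)"
        by (simp add: z_def algebra_simps)
      have "v y \<le> s * v (a - z) + (1 - s) * v (b - z) + C / 2 * (s * (1 - s) * (norm ((a - z) - (b - z)))\<^sup>2)"
        unfolding y using sc s unfolding semiconvex_with_def by blast
      then have "v y \<le> s * v (a - z) + (1 - s) * v (b - z) + ?e" by simp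
      moreover have "s * (v (a - z) - ?k) \<le> s * lax_hopf p v t a"
        using lax_hopf_ge[OF p bdd t(1) t1, of "a - z" a] s by (intro mult_left_mono) auto
      moreover have "(1 - s) * (v (b - z) - ?k) \<le> (1 - s) * lax_hopf p v t b"
        using lax_hopf_ge[OF p bdd t(1) t1, of "b - z" b] s by (intro mult_left_mono) auto
      moreover have "s * (v (a - z) - ?k) + (1 - s) * (v (b - z) - ?k) = s * v (a - z) + (1 - s) * v (b - z) - ?k"
        by (simp add: left_diff_distrib right_diff_distrib)
      ultimately show "v y - (1 - t) * cost p ((1 / (1 - t)) *\<^sub>R (?w - y))
          \<le> s * lax_hopf p v t a + (1 - s) * lax_hopf p v t b + ?e"
        unfolding z_def[symmetric] by linarith
    qed simp
  qed
qed (use sc in simp)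

lemma lipschitz_lax_hopf_0:
  fixes v :: "'a::real_inner \<Rightarrow> real"
  assumes p: "1 < p" and bdd: "\<And>x. bdd_above (range (\<lambda>y. v y - cost p (x - y)))"
    and L: "L-lipschitz_on UNIV v"
  shows "L-lipschitz_on UNIV (lax_hopf p v 0)"
proof -
  have *: "lax_hopf p v 0 a \<le> lax_hopf p v 0 b + L * norm (a - b)" for a b
    unfolding lax_hopf_0[of p v a]
  proof (rule cSUP_least)
    fix y
    have "v y \<le> v (y - a + b) + L * norm (a - b)"
      using lipschitz_onD[OF L UNIV_I UNIV_I, of y "y - a + b"] by (simp add: dist_norm abs_le_iff)
    moreover have "v (y - a + b) - cost p (b - (y - a + b)) \<le> lax_hopf p v 0 b"
      by (rule lax_hopf_0_ge[OF p bdd])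
    ultimately show "v y - cost p (a - y) \<le> lax_hopf p v 0 b + L * norm (a - b)"
      by simp
  qed simp
  show ?thesis
  proof (rule lipschitz_onI)
    fix x y show "dist (lax_hopf p v 0 x) (lax_hopf p v 0 y) \<le> L * dist x y"
      using *[of x y] *[of y x] by (simp add: dist_norm abs_le_iff norm_minus_commute)
  qed (rule lipschitz_on_nonneg[OF L])
qed

text \<open>The pair \<open>(x, y)\<close> is active: \<open>y\<close> attains the supremum in the Lax--Hopf formula at \<open>(0, x)\<close>.\<close>
locale contact =
  fixes p :: real and v :: "'a::real_inner \<Rightarrow> real" and x y :: 'a
  assumes p: "1 < p" and bdd: "\<And>x. bdd_above (range (\<lambda>y. v y - cost p (x - y)))"
    and contact: "lax_hopf p v 0 x = v y - cost p (y - x)"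
begin

lemma value_along_ray:
  assumes t: "0 < t" "t \<le> 1"
  shows "lax_hopf p v t (x + t *\<^sub>R (y - x)) = v y - (1 - t) * cost p (y - x)"
proof (cases "t = 1")
  case False
  then have t1: "t < 1" using t by simp
  have "(1 / (1 - t)) *\<^sub>R (x + t *\<^sub>R (y - x) - y) = - (y - x)"
  proof -
    have "x + t *\<^sub>R (y - x) - y = (1 - t) *\<^sub>R (- (y - x))" by (simp add: algebra_simps)
    then show ?thesis using t1 by simp
  qed
  then have "v y - (1 - t) * cost p (y - x) \<le> lax_hopf p v t (x + t *\<^sub>R (y - x))"
    using lax_hopf_ge[OF p bdd, of t y "x + t *\<^sub>R (y - x)"] t t1 by (metis cost_minus less_eq_real_def)
  moreover have "lax_hopf p v t (x + t *\<^sub>R (y - x)) - t * cost p (y - x) \<le> lax_hopf p v 0 x"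
    using lax_hopf_0_ge_lax_hopf[OF p bdd t, of "x + t *\<^sub>R (y - x)" x] t by simp
  ultimately show ?thesis using contact by (simp add: algebra_simps)
qed simp

lemma above_along_ray:
  assumes t: "0 < t" "t \<le> 1"
  shows "lax_hopf p v t (x + t *\<^sub>R (y - x) + h)
      \<le> lax_hopf p v t (x + t *\<^sub>R (y - x)) + t * (cost p (y - x + (1 / t) *\<^sub>R h) - cost p (y - x))"
proof -
  have "(1 / t) *\<^sub>R (x + t *\<^sub>R (y - x) + h - x) = y - x + (1 / t) *\<^sub>R h"
    using t by (simp add: scaleR_add_right)
  then have "lax_hopf p v t (x + t *\<^sub>R (y - x) + h) - t * cost p (y - x + (1 / t) *\<^sub>R h) \<le> lax_hopf p v 0 x"
    using lax_hopf_0_ge_lax_hopf[OF p bdd t, of "x + t *\<^sub>R (y - x) + h" x] by simp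
  then show ?thesis
    using contact value_along_ray[OF t] by (simp add: algebra_simps)
qed

lemma GDERIV_above:
  assumes t: "0 < t"
  shows "GDERIV (\<lambda>w. k + t * (cost p (y - x + (1 / t) *\<^sub>R (w - (x + t *\<^sub>R (y - x)))) - cost p (y - x)))
     (x + t *\<^sub>R (y - x)) :> flux p (y - x)"
proof -
  let ?X = "x + t *\<^sub>R (y - x)"
  have "((\<lambda>w. y - x + (1 / t) *\<^sub>R (w - ?X)) has_derivative (\<lambda>h. (1 / t) *\<^sub>R h)) (at ?X)"
    by (auto intro!: derivative_eq_intros)
  moreover have "(cost p has_derivative (\<lambda>h. h \<bullet> flux p (y - x))) (at (y - x + (1 / t) *\<^sub>R (?X - ?X)))"
    using GDERIV_cost[OF p, of "y - x"] by (simp add: gderiv_def)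
  ultimately have "((\<lambda>w. cost p (y - x + (1 / t) *\<^sub>R (w - ?X))) has_derivative
      (\<lambda>h. ((1 / t) *\<^sub>R h) \<bullet> flux p (y - x))) (at ?X)"
    by (rule has_derivative_compose)
  then have "((\<lambda>w. k + t * (cost p (y - x + (1 / t) *\<^sub>R (w - ?X)) - cost p (y - x))) has_derivative
      (\<lambda>h. t * (((1 / t) *\<^sub>R h) \<bullet> flux p (y - x)))) (at ?X)"
    by (auto intro!: derivative_eq_intros)
  then show ?thesis
    using t by (simp add: gderiv_def)
qed

lemma subgradient_along_ray:
  assumes t: "0 < t" "t \<le> 1" and sc: "semiconvex_with C v"
  shows "lax_hopf p v t (x + t *\<^sub>R (y - x)) + flux p (y - x) \<bullet> h - C / 2 * (norm h)\<^sup>2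
      \<le> lax_hopf p v t (x + t *\<^sub>R (y - x) + h)"
proof (rule semiconvex_touched_above)
  show "semiconvex_with C (lax_hopf p v t)"
    using t by (intro semiconvex_lax_hopf[OF p bdd sc]) auto
  let ?X = "x + t *\<^sub>R (y - x)"
  let ?H = "\<lambda>w. lax_hopf p v t ?X + t * (cost p (y - x + (1 / t) *\<^sub>R (w - ?X)) - cost p (y - x))"
  show "GDERIV ?H ?X :> flux p (y - x)" by (rule GDERIV_above[OF t(1)])
  show "lax_hopf p v t w \<le> ?H w" for w
    using above_along_ray[OF t, of "w - ?X"] by (simp add: algebra_simps)
  show "lax_hopf p v t ?X = ?H ?X" by simp
qed

text \<open>The ray is a characteristic: the forward and the backward Lax--Hopf formulas squeeze
  \<open>lax_hopf p v t\<close> between two differentiable functions touching it on the ray, so it is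
  differentiable there with the gradient that belongs to the speed of the ray.\<close>
lemma GDERIV_along_ray:
  assumes t: "0 < t" "t < 1"
  shows "GDERIV (lax_hopf p v t) (x + t *\<^sub>R (y - x)) :> flux p (y - x)"
proof (rule GDERIV_sandwich)
  let ?X = "x + t *\<^sub>R (y - x)"
  let ?H = "\<lambda>w. lax_hopf p v t ?X + t * (cost p (y - x + (1 / t) *\<^sub>R (w - ?X)) - cost p (y - x))"
  show "GDERIV ?H ?X :> flux p (y - x)" by (rule GDERIV_above[OF t(1)])
  show "lax_hopf p v t w \<le> ?H w" for w
    using above_along_ray[of t "w - ?X"] t by (simp add: algebra_simps)
  show "lax_hopf p v t ?X = ?H ?X" by simp
  let ?l = "\<lambda>w. v y - (1 - t) * cost p ((1 / (1 - t)) *\<^sub>R (w - y))"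
  show "?l w \<le> lax_hopf p v t w" for w
    using lax_hopf_ge[OF p bdd] t by simp
  have eq: "(1 / (1 - t)) *\<^sub>R (?X - y) = - (y - x)"
  proof -
    have "?X - y = (1 - t) *\<^sub>R (- (y - x))" by (simp add: algebra_simps)
    then show ?thesis using t by simp
  qed
  show "lax_hopf p v t ?X = ?l ?X"
    unfolding eq using value_along_ray t by (simp only: cost_minus)
  have "((\<lambda>w. (1 / (1 - t)) *\<^sub>R (w - y)) has_derivative (\<lambda>h. (1 / (1 - t)) *\<^sub>R h)) (at ?X)"
    by (auto intro!: derivative_eq_intros)
  moreover have "(cost p has_derivative (\<lambda>h. h \<bullet> flux p (- (y - x)))) (at ((1 / (1 - t)) *\<^sub>R (?X - y)))"
    unfolding eq using GDERIV_cost[OF p, of "- (y - x)"] unfolding gderiv_def .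
  ultimately have "((\<lambda>w. cost p ((1 / (1 - t)) *\<^sub>R (w - y))) has_derivative
      (\<lambda>h. ((1 / (1 - t)) *\<^sub>R h) \<bullet> flux p (- (y - x)))) (at ?X)"
    by (rule has_derivative_compose)
  then have "(?l has_derivative (\<lambda>h. - ((1 - t) * (((1 / (1 - t)) *\<^sub>R h) \<bullet> flux p (- (y - x)))))) (at ?X)"
    by (auto intro!: derivative_eq_intros)
  then show "GDERIV ?l ?X :> flux p (y - x)"
    using t unfolding gderiv_def flux_minus by simp
qed

lemma GDERIV_endpoint:
  assumes sc: "semiconvex_with C v"
  shows "GDERIV v y :> flux p (y - x)"
proof (rule GDERIV_sandwich)
  let ?H = "\<lambda>w. v y + (cost p (y - x + (w - y)) - cost p (y - x))"
  show "GDERIV ?H y :> flux p (y - x)" using GDERIV_above[of 1 "v y"] by simp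
  show "v w \<le> ?H w" for w
    using above_along_ray[of 1 "w - y"] by simp
  show "v y = ?H y" by simp
  let ?l = "\<lambda>w. v y + flux p (y - x) \<bullet> (w - y) - C / 2 * ((w - y) \<bullet> (w - y))"
  show "?l w \<le> v w" for w
    using subgradient_along_ray[OF _ _ sc, of 1 "w - y"] by (simp add: power2_norm_eq_inner)
  show "v y = ?l y" by simp
  have "(?l has_derivative (\<lambda>h. flux p (y - x) \<bullet> h)) (at y)"
    by (auto intro!: derivative_eq_intros)
  then show "GDERIV ?l y :> flux p (y - x)"
    unfolding gderiv_def by (simp add: inner_commute)
qed

lemma speed_le:
  assumes L: "L-lipschitz_on UNIV v"
  shows "norm (y - x) \<le> (p * L) powr (1 / (p - 1))"
proof (cases "y = x")
  case False
  let ?n = "norm (y - x)"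
  have n: "?n > 0" using False by simp
  have "v x - cost p (x - x) \<le> lax_hopf p v 0 x"
    by (rule lax_hopf_0_ge[OF p bdd])
  then have "cost p (y - x) \<le> v y - v x"
    using contact by (simp add: cost_def)
  also have "\<dots> \<le> L * ?n"
    using lipschitz_onD[OF L UNIV_I UNIV_I, of y x] by (simp add: dist_norm abs_le_iff)
  finally have "?n powr p \<le> p * L * ?n"
    using p by (simp add: cost_def field_simps)
  moreover have "?n powr p = ?n powr (p - 1) * ?n"
    using n by (simp add: powr_diff)
  ultimately have "?n powr (p - 1) \<le> p * L"
    using n by simp
  then have "(?n powr (p - 1)) powr (1 / (p - 1)) \<le> (p * L) powr (1 / (p - 1))"
    using p by (intro powr_mono2) auto
  then show ?thesis using p n by (simp add: powr_powr)
qed simp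

lemma speed_ge:
  assumes sc: "semiconvex_with C v" and \<kappa>: "0 < \<kappa>" "\<kappa> \<le> (norm (grad v y))\<^sup>2"
  shows "\<kappa> powr (1 / (2 * (p - 1))) \<le> norm (y - x)"
proof (cases "y = x")
  case True
  then show ?thesis
    using \<kappa> grad_eqI[OF GDERIV_endpoint[OF sc]] by (simp add: flux_def)
next
  case False
  have "\<kappa> \<le> (norm (y - x) powr (p - 1))\<^sup>2"
    using \<kappa> grad_eqI[OF GDERIV_endpoint[OF sc]] by (simp add: norm_flux[OF p])
  also have "\<dots> = norm (y - x) powr (2 * (p - 1))"
    using False by (simp add: powr_realpow[symmetric] powr_powr mult.commute)
  finally have "\<kappa> powr (1 / (2 * (p - 1))) \<le> (norm (y - x) powr (2 * (p - 1))) powr (1 / (2 * (p - 1)))"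
    using \<kappa> p by (intro powr_mono2) auto
  then show ?thesis using p by (simp add: powr_powr)
qed

end


section \<open>The inverse of the interpolated transport is Lipschitz\<close>

text \<open>The three summands belong to the case \<open>p \<le> 2\<close>, and for \<open>p > 2\<close> to points at distance at
  least \<open>t / 2\<close> and to nearby points.\<close>
definition inverse_flow_const :: "real \<Rightarrow> real \<Rightarrow> real \<Rightarrow> real \<Rightarrow> real" where
  "inverse_flow_const C p R r =
     (C * R powr (2 - p) + 2) / (p - 1) + 4 * R
       + (C + 4 * (p * (R + 1) powr (p - 2))) / r powr (p - 2)"

text \<open>The upper paraboloids coming from the cost have opening of order \<open>1 / t\<close>; the factor \<open>t\<close> in
  the displacement compensates this, so the constant does not depend on \<open>t\<close>. For \<open>p < 2\<close> the opening
  \<open>|z1| powr (p - 2) / t\<close> blows up at small speeds at the same rate as the strong monotonicity of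
  \<open>flux p\<close> improves. For \<open>p > 2\<close> the paraboloid is only local, but distances
  of at least \<open>t / 2\<close> need no estimate because the speeds are bounded.\<close>
lemma velocity_lipschitz_aux:
  fixes f :: "'a::real_inner \<Rightarrow> real"
  assumes p: "1 < p" and C: "0 \<le> C" and t: "0 < t" "t \<le> 1" and r: "0 < r"
    and low1: "\<And>h. f x1 + flux p z1 \<bullet> h - C / 2 * (norm h)\<^sup>2 \<le> f (x1 + h)"
    and low2: "\<And>h. f x2 + flux p z2 \<bullet> h - C / 2 * (norm h)\<^sup>2 \<le> f (x2 + h)"
    and up1: "\<And>h. f (x1 + h) \<le> f x1 + t * (cost p (z1 + (1 / t) *\<^sub>R h) - cost p z1)"
    and R: "norm z1 \<le> R" "norm z2 \<le> R" and order: "norm z2 \<le> norm z1"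
    and r': "2 < p \<Longrightarrow> r \<le> norm z1" "2 < p \<Longrightarrow> r \<le> norm z2"
    and d: "0 < d" "norm (x2 - x1) \<le> d"
  shows "t * norm (z1 - z2) \<le> inverse_flow_const C p R r * d"
proof -
  have R0: "0 \<le> R" using R(1) norm_ge_zero[of z1] by linarith
  have terms: "0 \<le> (C * R powr (2 - p) + 2) / (p - 1)"
      "0 \<le> (C + 4 * (p * (R + 1) powr (p - 2))) / r powr (p - 2)"
    using C p R0 by (auto intro!: divide_nonneg_nonneg add_nonneg_nonneg mult_nonneg_nonneg)
  consider (zero) "z1 = 0" | (sub) "z1 \<noteq> 0" "p \<le> 2" | (far) "2 < p" "t / 2 \<le> d" | (near) "2 < p" "d < t / 2"
    by fastforce
  then show ?thesis
  proof cases
    case zero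
    then have "z2 = 0" using order by simp
    then show ?thesis
      using zero terms R0 d by (simp add: inverse_flow_const_def)
  next
    case sub
    let ?N = "norm z1 powr (p - 2)"
    have N: "?N > 0" "norm z1 powr (2 - p) * ?N = 1"
      using sub by (auto simp flip: powr_add)
    have up: "f (x1 + h) \<le> f x1 + flux p z1 \<bullet> h + (?N / t) / 2 * (norm h)\<^sup>2" for h
    proof -
      have "t * (cost p (z1 + (1 / t) *\<^sub>R h) - cost p z1)
          \<le> t * (flux p z1 \<bullet> ((1 / t) *\<^sub>R h) + ?N / 2 * (norm ((1 / t) *\<^sub>R h))\<^sup>2)"
        using cost_upper_subquadratic[OF p sub(2,1), of "(1 / t) *\<^sub>R h"] t by (intro mult_left_mono) auto
      also have "\<dots> = flux p z1 \<bullet> h + (?N / t) / 2 * (norm h)\<^sup>2"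
        using t by (simp add: field_simps power2_eq_square)
      finally show ?thesis using up1[of h] by linarith
    qed
    have "norm (flux p z2 - flux p z1) \<le> (C + 2 * (?N / t)) * d"
      using up t C d by (intro subgradient_difference_bound[OF low1 low2]) auto
    moreover have "(p - 1) * ?N * norm (z1 - z2) \<le> norm (flux p z1 - flux p z2)"
      by (rule flux_strongly_monotone_subquadratic[OF p sub(2) order])
    ultimately have "(p - 1) * ?N * norm (z1 - z2) \<le> (C + 2 * (?N / t)) * d"
      by (simp add: norm_minus_commute)
    then have "(t * norm z1 powr (2 - p)) * ((p - 1) * ?N * norm (z1 - z2))
        \<le> (t * norm z1 powr (2 - p)) * ((C + 2 * (?N / t)) * d)"
      using t by (intro mult_left_mono) auto
    moreover have "(t * norm z1 powr (2 - p)) * ((p - 1) * ?N * norm (z1 - z2))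
        = (norm z1 powr (2 - p) * ?N) * ((p - 1) * (t * norm (z1 - z2)))"
      by (simp add: mult_ac)
    moreover have "(t * norm z1 powr (2 - p)) * ((C + 2 * (?N / t)) * d)
        = (C * (t * norm z1 powr (2 - p)) + 2 * (norm z1 powr (2 - p) * ?N)) * d"
      using t by (simp add: field_simps)
    ultimately have "(p - 1) * (t * norm (z1 - z2)) \<le> (C * (t * norm z1 powr (2 - p)) + 2) * d"
      unfolding N(2) by (simp only: mult_1_left mult_1_right)
    also have "\<dots> \<le> (C * (1 * R powr (2 - p)) + 2) * d"
      using t C d R sub by (intro mult_right_mono add_mono mult_left_mono mult_mono powr_mono2) auto
    finally have "t * norm (z1 - z2) \<le> (C * R powr (2 - p) + 2) / (p - 1) * d"
      using p by (simp add: field_simps)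
    also have "\<dots> \<le> inverse_flow_const C p R r * d"
      using terms R0 d unfolding inverse_flow_const_def by (intro mult_right_mono) auto
    finally show ?thesis .
  next
    case far
    have "t * norm (z1 - z2) \<le> t * (R + R)"
      using t R norm_triangle_ineq4[of z1 z2] by (intro mult_left_mono) auto
    also have "\<dots> \<le> 4 * R * d"
      using far R0 mult_left_mono[of "t / 2" d "4 * R"] by (simp add: algebra_simps)
    also have "\<dots> \<le> inverse_flow_const C p R r * d"
      using terms R0 d unfolding inverse_flow_const_def by (intro mult_right_mono) auto
    finally show ?thesis .
  next
    case near
    let ?B = "p * (R + 1) powr (p - 2)"
    have B: "0 \<le> ?B" using p by simp
    have up: "f (x1 + h) \<le> f x1 + flux p z1 \<bullet> h + (2 * ?B / t) / 2 * (norm h)\<^sup>2" if h: "norm h \<le> 2 * d" for h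
    proof -
      have h1: "norm ((1 / t) *\<^sub>R h) \<le> 1" using h near t by (simp add: field_simps)
      have "cost p (z1 + (1 / t) *\<^sub>R h) \<le> cost p z1 + flux p z1 \<bullet> ((1 / t) *\<^sub>R h) + ?B * (norm ((1 / t) *\<^sub>R h))\<^sup>2"
        using near by (intro cost_upper_superquadratic R h1) auto
      then have "t * (cost p (z1 + (1 / t) *\<^sub>R h) - cost p z1)
          \<le> t * (flux p z1 \<bullet> ((1 / t) *\<^sub>R h) + ?B * (norm ((1 / t) *\<^sub>R h))\<^sup>2)"
        using t by (intro mult_left_mono) auto
      also have "\<dots> = flux p z1 \<bullet> h + (2 * ?B / t) / 2 * (norm h)\<^sup>2"
        using t by (simp add: field_simps power2_eq_square)
      finally show ?thesis using up1[of h] by linarith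
    qed
    have "0 \<le> 2 * ?B / t" using p t by simp
    then have "norm (flux p z2 - flux p z1) \<le> (C + 2 * (2 * ?B / t)) * d"
      by (intro subgradient_difference_bound[OF low1 low2 up] d C)
    moreover have "r powr (p - 2) * norm (z1 - z2) \<le> norm (flux p z1 - flux p z2)"
      using near r r' by (intro flux_strongly_monotone_superquadratic) auto
    ultimately have "r powr (p - 2) * norm (z1 - z2) \<le> (C + 2 * (2 * ?B / t)) * d"
      by (simp add: norm_minus_commute)
    then have "t * (r powr (p - 2) * norm (z1 - z2)) \<le> t * ((C + 2 * (2 * ?B / t)) * d)"
      using t by (intro mult_left_mono) auto
    also have "\<dots> = (t * C + 4 * ?B) * d"
      using t by (simp add: field_simps)
    also have "\<dots> \<le> (1 * C + 4 * ?B) * d"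
      using t C d B by (intro mult_right_mono add_mono) (auto simp: mult_left_le_one_le)
    finally have "t * norm (z1 - z2) \<le> (C + 4 * ?B) / r powr (p - 2) * d"
      using r by (simp add: field_simps)
    also have "\<dots> \<le> inverse_flow_const C p R r * d"
      using terms R0 d unfolding inverse_flow_const_def by (intro mult_right_mono) auto
    finally show ?thesis .
  qed
qed

lemma inverse_flow_lipschitz:
  fixes v :: "'a::real_inner \<Rightarrow> real"
  assumes c1: "contact p v x1 y1" and c2: "contact p v x2 y2"
    and sc: "semiconvex_with C v" and C: "0 \<le> C" and t: "0 < t" "t \<le> 1" and r: "0 < r"
    and R: "norm (y1 - x1) \<le> R" "norm (y2 - x2) \<le> R"
    and r': "2 < p \<Longrightarrow> r \<le> norm (y1 - x1)" "2 < p \<Longrightarrow> r \<le> norm (y2 - x2)"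
  shows "norm (x1 - x2) \<le> (1 + inverse_flow_const C p R r)
           * norm ((x1 + t *\<^sub>R (y1 - x1)) - (x2 + t *\<^sub>R (y2 - x2)))"
proof -
  interpret c1: contact p v x1 y1 by (rule c1)
  interpret c2: contact p v x2 y2 by (rule c2)
  let ?z1 = "y1 - x1" and ?z2 = "y2 - x2"
  let ?X1 = "x1 + t *\<^sub>R ?z1" and ?X2 = "x2 + t *\<^sub>R ?z2"
  let ?K = "inverse_flow_const C p R r"
  have *: "t * norm (?z1 - ?z2) \<le> ?K * d" if d: "0 < d" "norm (?X1 - ?X2) \<le> d" for d
  proof (cases "norm ?z2 \<le> norm ?z1")
    case True
    then show ?thesis
      using d
      by (intro velocity_lipschitz_aux[where f = "lax_hopf p v t" and ?x1.0 = ?X1 and ?x2.0 = ?X2]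
          c1.p C t r R r' c1.subgradient_along_ray[OF t sc] c2.subgradient_along_ray[OF t sc]
          c1.above_along_ray[OF t]) (auto simp: norm_minus_commute)
  next
    case False
    then have "t * norm (?z2 - ?z1) \<le> ?K * d"
      using d
      by (intro velocity_lipschitz_aux[where f = "lax_hopf p v t" and ?x1.0 = ?X2 and ?x2.0 = ?X1]
          c1.p C t r R r' c1.subgradient_along_ray[OF t sc] c2.subgradient_along_ray[OF t sc]
          c2.above_along_ray[OF t]) (auto simp: norm_minus_commute)
    then show ?thesis by (simp add: norm_minus_commute)
  qed
  have "t * norm (?z1 - ?z2) \<le> ?K * norm (?X1 - ?X2)"
  proof (cases "?X1 = ?X2")
    case True
    have "((\<lambda>d. ?K * d) \<longlongrightarrow> ?K * 0) (at_right 0)"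
      by (intro tendsto_intros)
    moreover have "\<forall>\<^sub>F d in at_right 0. t * norm (?z1 - ?z2) \<le> ?K * d"
      by (rule eventually_mono[OF eventually_at_right_less[of 0]]) (rule *, use True in auto)
    ultimately have "t * norm (?z1 - ?z2) \<le> ?K * 0"
      by (rule tendsto_lowerbound) simp
    then show ?thesis using True by simp
  qed (use * in auto)
  moreover have "x1 - x2 = (?X1 - ?X2) - t *\<^sub>R (?z1 - ?z2)"
    by (simp add: algebra_simps)
  then have "norm (x1 - x2) \<le> norm (?X1 - ?X2) + t * norm (?z1 - ?z2)"
    using norm_triangle_ineq4[of "?X1 - ?X2" "t *\<^sub>R (?z1 - ?z2)"] t by (simp only: norm_scaleR abs_of_pos)
  ultimately show ?thesis by (simp add: distrib_right)
qed


section \<open>Measure theory of transport maps\<close>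

lemma emeasure_lborel_cube:
  fixes u v :: "'a::euclidean_space"
  assumes "0 \<le> s" "\<And>i. i \<in> Basis \<Longrightarrow> v \<bullet> i - u \<bullet> i = s"
  shows "emeasure lborel (cbox u v) = ennreal (s ^ DIM('a))"
    and "emeasure lborel (box u v) = ennreal (s ^ DIM('a))"
proof -
  have "u \<bullet> b \<le> v \<bullet> b" if "b \<in> Basis" for b using assms(1) assms(2)[OF that] by linarith
  moreover have "(\<Prod>b\<in>Basis. (v - u) \<bullet> b) = s ^ DIM('a)"
    using assms(2) by (simp add: inner_diff_left)
  ultimately show "emeasure lborel (cbox u v) = ennreal (s ^ DIM('a))"
    and "emeasure lborel (box u v) = ennreal (s ^ DIM('a))"
    by (auto simp: emeasure_lborel_cbox_eq emeasure_lborel_box_eq)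
qed

text \<open>Cover \<open>B\<close> economically by small cubes. The preimage of each cube has comparable diameter,
  hence lies in a cube of comparable volume.\<close>
lemma emeasure_le_of_expanding_map_bounded:
  fixes h :: "'a::euclidean_space \<Rightarrow> 'a"
  assumes D: "D \<in> sets borel" and B: "B \<in> sets borel" and hD: "\<And>x. x \<in> D \<Longrightarrow> h x \<in> B"
    and bounded: "bounded B" and K: "0 < K"
    and expand: "\<And>x y. x \<in> D \<Longrightarrow> y \<in> D \<Longrightarrow> norm (x - y) \<le> K * norm (h x - h y)"
  shows "emeasure lborel D \<le> ennreal ((2 * K * DIM('a)) ^ DIM('a)) * emeasure lborel B"
proof -
  let ?n = "DIM('a)"
  let ?c = "ennreal ((2 * K * ?n) ^ ?n)"
  have main: "emeasure lborel D \<le> ?c * (emeasure lborel B + ennreal e)" if e: "e > 0" for e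
  proof -
    obtain U where U: "open U" "B \<subseteq> U" "emeasure lborel (U - B) \<le> ennreal e"
      using outer_regular_lborel_le[OF B e] by blast
    obtain k where k: "k > 0" "B \<subseteq> cbox (- (k *\<^sub>R One)) (k *\<^sub>R One)"
    proof -
      obtain k where k: "k > 0" "\<And>x. x \<in> B \<Longrightarrow> norm x \<le> k"
        using bounded by (auto simp: bounded_pos)
      then have "B \<subseteq> cbox (- (k *\<^sub>R One)) (k *\<^sub>R One)"
        by (auto simp: mem_box inner_simps) (meson Basis_le_norm order_trans abs_le_iff minus_le_iff)+
      with k(1) show ?thesis by (rule that)
    qed
    have box_ne: "box (- (k *\<^sub>R One)) (k *\<^sub>R One :: 'a) \<noteq> {}"
      using k(1) by (auto simp: box_ne_empty inner_simps)
    have "gauge (\<lambda>x. if x \<in> U then U else UNIV)"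
      using U(1) by (auto simp: gauge_def)
    from covering_lemma[OF k(2) box_ne this] obtain F where
      F: "countable F" "\<Union>F \<subseteq> cbox (- (k *\<^sub>R One)) (k *\<^sub>R One)"
        "\<And>K. K \<in> F \<Longrightarrow> interior K \<noteq> {} \<and> (\<exists>c d. K = cbox c d)"
        "pairwise (\<lambda>A B. interior A \<inter> interior B = {}) F"
        "\<And>K. K \<in> F \<Longrightarrow> \<exists>x \<in> B \<inter> K. K \<subseteq> (if x \<in> U then U else UNIV)"
        "\<And>u v. cbox u v \<in> F \<Longrightarrow> \<exists>n. \<forall>i\<in>Basis. v \<bullet> i - u \<bullet> i
            = (k *\<^sub>R One \<bullet> i - (- (k *\<^sub>R One)) \<bullet> i) / 2 ^ n"
        "B \<subseteq> \<Union>F"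
      by blast
    have FU: "Q \<subseteq> U" if Q: "Q \<in> F" for Q
    proof -
      obtain x where "x \<in> B" "Q \<subseteq> (if x \<in> U then U else UNIV)" using F(5) Q by blast
      moreover from this U(2) have "x \<in> U" by blast
      ultimately show ?thesis by simp
    qed
    have ex: "\<exists>s R. 0 \<le> s \<and> emeasure lborel (interior Q) = ennreal (s ^ ?n)
        \<and> R \<in> sets borel \<and> emeasure lborel R \<le> ?c * emeasure lborel (interior Q)
        \<and> D \<inter> h -` Q \<subseteq> R" if Q: "Q \<in> F" for Q
    proof -
      obtain u v where uv: "Q = cbox u v" using F(3)[OF Q] by blast
      obtain m where m: "\<And>i. i \<in> Basis \<Longrightarrow> v \<bullet> i - u \<bullet> i = 2 * k / 2 ^ m"
        using F(6)[of u v] Q uv by (auto simp: inner_simps)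
      define s where "s = 2 * k / 2 ^ m"
      have s: "0 \<le> s" using k by (simp add: s_def)
      have int: "emeasure lborel (interior Q) = ennreal (s ^ ?n)"
        unfolding uv interior_cbox using s m by (intro emeasure_lborel_cube) (auto simp: s_def)
      show ?thesis
      proof (cases "D \<inter> h -` Q = {}")
        case True
        then show ?thesis using s int by (intro exI[of _ s] exI[of _ "{}"]) auto
      next
        case False
        then obtain x0 where x0: "x0 \<in> D" "h x0 \<in> Q" by auto
        define r where "r = K * ?n * s"
        have r: "0 \<le> r" using K s by (simp add: r_def)
        let ?R = "cbox (x0 - r *\<^sub>R One) (x0 + r *\<^sub>R One)"
        have "D \<inter> h -` Q \<subseteq> ?R"
        proof
          fix x assume x: "x \<in> D \<inter> h -` Q"
          have "\<bar>(h x - h x0) \<bullet> i\<bar> \<le> s" if i: "i \<in> Basis" for i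
          proof -
            have "u \<bullet> i \<le> h x \<bullet> i" "h x \<bullet> i \<le> v \<bullet> i" "u \<bullet> i \<le> h x0 \<bullet> i" "h x0 \<bullet> i \<le> v \<bullet> i"
              using x x0 i uv by (auto simp: mem_box)
            then show ?thesis using m[OF i] unfolding s_def[symmetric] inner_diff_left by linarith
          qed
          then have "norm (h x - h x0) \<le> ?n * s"
            using norm_le_l1[of "h x - h x0"] sum_bounded_above[of Basis "\<lambda>i. \<bar>(h x - h x0) \<bullet> i\<bar>" s]
            by simp
          then have "K * norm (h x - h x0) \<le> r"
            using K unfolding r_def mult.assoc by (intro mult_left_mono) auto
          with expand[of x x0] x x0 have nr: "norm (x - x0) \<le> r" by auto
          have "\<bar>(x - x0) \<bullet> i\<bar> \<le> r" if "i \<in> Basis" for i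
            using Basis_le_norm[OF that, of "x - x0"] nr by linarith
          then show "x \<in> ?R"
            by (fastforce simp: mem_box inner_simps abs_le_iff)
        qed
        moreover have "emeasure lborel ?R = ennreal ((2 * r) ^ ?n)"
          using r by (intro emeasure_lborel_cube) (auto simp: inner_simps)
        moreover have "(2 * r) ^ ?n = (2 * K * ?n) ^ ?n * s ^ ?n"
          by (simp add: r_def mult_ac flip: power_mult_distrib)
        moreover have "ennreal ((2 * K * ?n) ^ ?n * s ^ ?n) = ?c * ennreal (s ^ ?n)"
          using K s by (intro ennreal_mult) auto
        ultimately show ?thesis
          using s int by (intro exI[of _ s] exI[of _ ?R]) auto
      qed
    qed
    then obtain R where R: "\<And>Q. Q \<in> F \<Longrightarrow> R Q \<in> sets borel"
        "\<And>Q. Q \<in> F \<Longrightarrow> emeasure lborel (R Q) \<le> ?c * emeasure lborel (interior Q)"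
        "\<And>Q. Q \<in> F \<Longrightarrow> D \<inter> h -` Q \<subseteq> R Q"
      by metis
    define I where "I = to_nat_on F ` F"
    define g where "g = from_nat_into F"
    have g: "g (to_nat_on F Q) = Q" if "Q \<in> F" for Q
      using F(1) that by (simp add: g_def)
    have gI: "g i \<in> F" "to_nat_on F (g i) = i" if "i \<in> I" for i
      using that g by (auto simp: I_def)
    define A where "A i = (if i \<in> I then interior (g i) else {})" for i
    define S where "S i = (if i \<in> I then R (g i) else {})" for i
    have S: "S i \<in> sets lborel" for i using R(1) gI by (auto simp: S_def)
    have "disjoint_family A"
    proof (unfold disjoint_family_on_def, intro ballI impI)
      fix i j :: nat assume "i \<noteq> j"
      then have "interior (g i) \<inter> interior (g j) = {}" if "i \<in> I" "j \<in> I"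
        using F(4) gI[OF that(1)] gI[OF that(2)] unfolding pairwise_def by metis
      then show "A i \<inter> A j = {}"
        unfolding A_def by auto
    qed
    moreover have "range A \<subseteq> sets lborel" by (auto simp: A_def)
    ultimately have sumA: "(\<Sum>i. emeasure lborel (A i)) = emeasure lborel (\<Union>i. A i)"
      by (intro suminf_emeasure)
    have "D \<subseteq> (\<Union>i. S i)"
    proof
      fix x assume x: "x \<in> D"
      then obtain Q where Q: "Q \<in> F" "h x \<in> Q" using F(7) hD by blast
      then have "x \<in> R Q" using R(3)[OF Q(1)] x by auto
      then have "x \<in> S (to_nat_on F Q)" using Q g by (auto simp: S_def I_def)
      then show "x \<in> (\<Union>i. S i)" by blast
    qed
    then have "emeasure lborel D \<le> emeasure lborel (\<Union>i. S i)"
      using S by (intro emeasure_mono) auto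
    also have "\<dots> \<le> (\<Sum>i. emeasure lborel (S i))"
      using S by (intro emeasure_subadditive_countably) auto
    also have "\<dots> \<le> (\<Sum>i. ?c * emeasure lborel (A i))"
      using R(2) gI by (intro suminf_le) (auto simp: S_def A_def)
    also have "\<dots> = ?c * emeasure lborel (\<Union>i. A i)"
      by (simp add: sumA)
    also have "emeasure lborel (\<Union>i. A i) \<le> emeasure lborel U"
      using FU gI interior_subset U(1) by (intro emeasure_mono) (auto simp: A_def split: if_splits, blast)
    also have "emeasure lborel U \<le> emeasure lborel B + emeasure lborel (U - B)"
    proof -
      have "U = B \<union> (U - B)" using U(2) by auto
      then show ?thesis using emeasure_subadditive[of B lborel "U - B"] B U(1) by auto
    qed
    also have "\<dots> \<le> emeasure lborel B + ennreal e" using U(3) by (intro add_left_mono)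
    finally show ?thesis by (simp add: mult_left_mono)
  qed
  have "0 < (2 * K * ?n) ^ ?n" using K by (intro zero_less_power) auto
  then have "?c \<noteq> 0" by (simp add: ennreal_eq_0_iff not_le)
  then have "((\<lambda>e. ?c * (emeasure lborel B + ennreal e)) \<longlongrightarrow> ?c * (emeasure lborel B + ennreal 0)) (at_right 0)"
    by (intro tendsto_mult_ennreal tendsto_add tendsto_const tendsto_ennrealI tendsto_ident_at) auto
  then have "emeasure lborel D \<le> ?c * (emeasure lborel B + ennreal 0)"
    by (rule tendsto_lowerbound) (auto intro!: eventually_mono[OF eventually_at_right_less[of 0]] main)
  then show ?thesis by simp
qed

lemma emeasure_le_of_expanding_map:
  fixes h :: "'a::euclidean_space \<Rightarrow> 'a"
  assumes D[measurable]: "D \<in> sets borel" and B[measurable]: "B \<in> sets borel" and hD: "\<And>x. x \<in> D \<Longrightarrow> h x \<in> B"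
    and h[measurable]: "h \<in> borel_measurable borel" and K: "0 < K"
    and expand: "\<And>x y. x \<in> D \<Longrightarrow> y \<in> D \<Longrightarrow> norm (x - y) \<le> K * norm (h x - h y)"
  shows "emeasure lborel D \<le> ennreal ((2 * K * DIM('a)) ^ DIM('a)) * emeasure lborel B"
proof -
  let ?c = "ennreal ((2 * K * DIM('a)) ^ DIM('a))"
  define E where "E n = {x \<in> D. norm (h x) \<le> real n}" for n
  have E[measurable]: "E n \<in> sets borel" for n unfolding E_def by measurable
  have "D = (\<Union>n. E n)"
    by (auto simp: E_def) (use real_arch_simple in auto)
  moreover have "incseq E"
    by (auto simp: E_def incseq_def)
  ultimately have "emeasure lborel D = (SUP n. emeasure lborel (E n))"
    using SUP_emeasure_incseq[of E lborel] by (simp add: image_subset_iff)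
  also have "\<dots> \<le> ?c * emeasure lborel B"
  proof (rule SUP_least)
    fix n
    have "emeasure lborel (E n) \<le> ?c * emeasure lborel (B \<inter> cball 0 (real n))"
      using hD expand K by (intro emeasure_le_of_expanding_map_bounded[where h = h]) (auto simp: E_def[of n])
    also have "\<dots> \<le> ?c * emeasure lborel B"
      by (intro mult_left_mono emeasure_mono) auto
    finally show "emeasure lborel (E n) \<le> ?c * emeasure lborel B" .
  qed
  finally show ?thesis .
qed

text \<open>For the Radon--Nikodym density \<open>f\<close>, the functions \<open>max f K\<close> and \<open>K\<close> have the same integral
  over every set, so \<open>f \<le> K\<close> almost everywhere, and truncation makes the bound hold everywhere.\<close>
lemma (in sigma_finite_measure) bounded_density:
  assumes sets: "sets N = sets M" and K: "0 \<le> K"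
    and le: "\<And>A. A \<in> sets M \<Longrightarrow> emeasure N A \<le> ennreal K * emeasure M A"
  obtains l where "l \<in> borel_measurable M" "\<And>x. 0 \<le> l x" "\<And>x. l x \<le> K"
    "N = density M (\<lambda>x. ennreal (l x))"
proof -
  have "absolutely_continuous M N"
    unfolding absolutely_continuous_def
  proof
    fix A assume A: "A \<in> null_sets M"
    then have "emeasure N A \<le> 0" using le[of A] by (simp add: null_setsD1 null_setsD2)
    then show "A \<in> null_sets N" using A sets by auto
  qed
  then obtain f where f[measurable]: "f \<in> borel_measurable M" and dens: "density M f = N"
    using Radon_Nikodym[OF _ sets] by blast
  have "density M (\<lambda>x. max (f x) (ennreal K)) = density M (\<lambda>x. ennreal K)"
  proof (rule measure_eqI)
    fix A assume "A \<in> sets (density M (\<lambda>x. max (f x) (ennreal K)))"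
    then have A[measurable]: "A \<in> sets M" by simp
    let ?G = "{x \<in> space M. ennreal K < f x}"
    have "emeasure (density M (\<lambda>x. max (f x) (ennreal K))) A
        = (\<integral>\<^sup>+x. f x * indicator (A \<inter> ?G) x + ennreal K * indicator (A - ?G) x \<partial>M)"
      by (subst emeasure_density) (auto intro!: nn_integral_cong split: split_indicator simp: max_def)
    also have "\<dots> = emeasure N (A \<inter> ?G) + ennreal K * emeasure M (A - ?G)"
      by (subst nn_integral_add) (auto simp: dens[symmetric] emeasure_density nn_integral_cmult_indicator)
    also have "\<dots> \<le> ennreal K * emeasure M (A \<inter> ?G) + ennreal K * emeasure M (A - ?G)"
      by (intro add_right_mono le) auto
    also have "\<dots> = ennreal K * emeasure M A"
    proof -
      have "emeasure M (A \<inter> ?G) + emeasure M (A - ?G) = emeasure M ((A \<inter> ?G) \<union> (A - ?G))"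
        by (intro plus_emeasure) auto
      also have "(A \<inter> ?G) \<union> (A - ?G) = A" by auto
      finally show ?thesis by (simp add: distrib_left[symmetric])
    qed
    finally have "emeasure (density M (\<lambda>x. max (f x) (ennreal K))) A \<le> emeasure (density M (\<lambda>x. ennreal K)) A"
      by (simp add: emeasure_density nn_integral_cmult_indicator)
    moreover have "emeasure (density M (\<lambda>x. ennreal K)) A \<le> emeasure (density M (\<lambda>x. max (f x) (ennreal K))) A"
      by (auto simp: emeasure_density intro!: nn_integral_mono mult_right_mono)
    ultimately show "emeasure (density M (\<lambda>x. max (f x) (ennreal K))) A = emeasure (density M (\<lambda>x. ennreal K)) A"
      by simp
  qed simp
  then have "AE x in M. max (f x) (ennreal K) = ennreal K"
    by (subst (asm) density_unique_iff) auto
  then have ae: "AE x in M. f x = ennreal (enn2real (min (f x) (ennreal K)))"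
  proof eventually_elim
    case (elim x)
    then have "f x \<le> ennreal K" by (metis max.cobounded1)
    moreover from this have "f x < top" by (auto simp: top_unique less_top[symmetric])
    ultimately show ?case by (simp add: min_absorb1)
  qed
  show ?thesis
  proof (rule that[of "\<lambda>x. enn2real (min (f x) (ennreal K))"])
    show "N = density M (\<lambda>x. ennreal (enn2real (min (f x) (ennreal K))))"
      unfolding dens[symmetric] by (rule density_cong[OF _ _ ae]) auto
    show "enn2real (min (f x) (ennreal K)) \<le> K" for x
      using K enn2real_mono[of "min (f x) (ennreal K)" "ennreal K"] by simp
  qed auto
qed

lemma prob_density_measurable: "prob_density \<rho> \<Longrightarrow> \<rho> \<in> borel_measurable borel"
  unfolding prob_density_def using borel_measurable_integrable by force

lemma prob_density_nonneg: "prob_density \<rho> \<Longrightarrow> 0 \<le> \<rho> x"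
  unfolding prob_density_def by simp

abbreviation law :: "('a::euclidean_space \<Rightarrow> real) \<Rightarrow> 'a measure" where
  "law \<rho> \<equiv> density lborel (\<lambda>x. ennreal (\<rho> x))"

lemma emeasure_prob_density:
  assumes \<rho>: "prob_density \<rho>" and A: "A \<in> sets borel"
  shows "emeasure (law \<rho>) A = ennreal (LINT x:A|lborel. \<rho> x)"
proof -
  note [measurable] = prob_density_measurable[OF \<rho>] A
  have "emeasure (law \<rho>) A = (\<integral>\<^sup>+x. ennreal (indicator A x * \<rho> x) \<partial>lborel)"
    by (subst emeasure_density) (auto intro!: nn_integral_cong split: split_indicator)
  also have "\<dots> = ennreal (\<integral>x. indicator A x * \<rho> x \<partial>lborel)"
    using \<rho> A integrable_mult_indicator[of A lborel \<rho>]
    by (intro nn_integral_eq_integral) (auto simp: prob_density_def)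
  finally show ?thesis by (simp add: set_lebesgue_integral_def)
qed

lemma set_lebesgue_integral_prob_density_nonneg:
  "prob_density \<rho> \<Longrightarrow> 0 \<le> (LINT x:A|lborel. \<rho> x)"
  unfolding set_lebesgue_integral_def by (intro integral_nonneg_AE) (auto simp: prob_density_nonneg)

lemma emeasure_prob_density_UNIV:
  assumes "prob_density \<rho>"
  shows "emeasure (law \<rho>) UNIV = 1"
proof -
  have "(LINT x:UNIV|lborel. \<rho> x) = 1"
    using assms by (simp add: prob_density_def set_lebesgue_integral_def)
  then show ?thesis
    using emeasure_prob_density[OF assms, of UNIV] by simp
qed

lemma finite_measure_prob_density:
  "prob_density \<rho> \<Longrightarrow> finite_measure (law \<rho>)"
  by (rule finite_measureI) (simp add: emeasure_prob_density_UNIV)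

lemma transport_map_iff:
  fixes \<rho>0 \<rho>1 :: "'a::euclidean_space \<Rightarrow> real"
  assumes \<rho>0: "prob_density \<rho>0" and \<rho>1: "prob_density \<rho>1"
  shows "transport_map \<rho>0 \<rho>1 M \<longleftrightarrow> M \<in> borel_measurable borel \<and>
     distr (law \<rho>0) borel M = law \<rho>1"
proof (cases "M \<in> borel_measurable borel")
  case M[measurable]: True
  let ?P = "law \<rho>0" and ?Q = "law \<rho>1"
  have d: "emeasure (distr ?P borel M) A = ennreal (LINT x:{x. M x \<in> A}|lborel. \<rho>0 x)" if A: "A \<in> sets borel" for A
  proof -
    have "emeasure (distr ?P borel M) A = emeasure ?P (M -` A)"
      using A by (subst emeasure_distr) auto
    also have "M -` A = {x. M x \<in> A}" by auto
    finally show ?thesis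
      using A by (subst (asm) emeasure_prob_density[OF \<rho>0]) (auto intro: pred_sets1)
  qed
  have eq: "emeasure (distr ?P borel M) A = emeasure ?Q A
      \<longleftrightarrow> (LINT x:A|lborel. \<rho>1 x) = (LINT x:{x. M x \<in> A}|lborel. \<rho>0 x)" if A: "A \<in> sets borel" for A
    using d[OF A] emeasure_prob_density[OF \<rho>1 A] set_lebesgue_integral_prob_density_nonneg[OF \<rho>0]
      set_lebesgue_integral_prob_density_nonneg[OF \<rho>1] by (auto simp: ennreal_inj)
  show ?thesis
  proof
    assume tm: "transport_map \<rho>0 \<rho>1 M"
    have "distr ?P borel M = ?Q"
    proof (rule measure_eqI)
      fix A assume "A \<in> sets (distr ?P borel M)"
      then have A: "A \<in> sets borel" by simp
      have inc: "incseq (\<lambda>n. A \<inter> cball 0 (real n))" by (auto simp: incseq_def)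
      have U: "(\<Union>n. A \<inter> cball 0 (real n)) = A"
        using real_arch_simple by auto
      have "emeasure (distr ?P borel M) A = (SUP n. emeasure (distr ?P borel M) (A \<inter> cball 0 (real n)))"
        using SUP_emeasure_incseq[OF _ inc, of "distr ?P borel M"] A U by (simp add: image_subset_iff)
      also have "\<dots> = (SUP n. emeasure ?Q (A \<inter> cball 0 (real n)))"
      proof (intro SUP_cong refl)
        fix n
        have "A \<inter> cball 0 (real n) \<in> sets borel" "bounded (A \<inter> cball 0 (real n))"
          using A by auto
        then show "emeasure (distr ?P borel M) (A \<inter> cball 0 (real n)) = emeasure ?Q (A \<inter> cball 0 (real n))"
          using tm eq unfolding transport_map_def by blast
      qed
      also have "\<dots> = emeasure ?Q A"
        using SUP_emeasure_incseq[OF _ inc, of ?Q] A U by (simp add: image_subset_iff)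
      finally show "emeasure (distr ?P borel M) A = emeasure ?Q A" .
    qed simp
    then show "M \<in> borel_measurable borel \<and> distr ?P borel M = ?Q" by simp
  next
    assume "M \<in> borel_measurable borel \<and> distr ?P borel M = ?Q"
    then show "transport_map \<rho>0 \<rho>1 M"
      using eq unfolding transport_map_def by auto
  qed
qed (auto simp: transport_map_def)

lemma emeasure_density_bounded:
  assumes \<rho>: "prob_density \<rho>" and bd: "AE x in lborel. \<bar>\<rho> x\<bar> \<le> K" and K: "0 \<le> K" and A: "A \<in> sets borel"
  shows "emeasure (law \<rho>) A \<le> ennreal K * emeasure lborel A"
proof -
  note [measurable] = prob_density_measurable[OF \<rho>] A
  have "emeasure (law \<rho>) A = (\<integral>\<^sup>+x. ennreal (\<rho> x) * indicator A x \<partial>lborel)"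
    by (rule emeasure_density) auto
  also have "\<dots> \<le> (\<integral>\<^sup>+x. ennreal K * indicator A x \<partial>lborel)"
    using bd by (intro nn_integral_mono_AE) (auto elim!: eventually_mono intro!: mult_right_mono ennreal_leI)
  also have "\<dots> = ennreal K * emeasure lborel A"
    by (rule nn_integral_cmult_indicator) auto
  finally show ?thesis .
qed


section \<open>Test functions\<close>

definition C1_grad :: "('a::real_inner \<Rightarrow> real) \<Rightarrow> ('a \<Rightarrow> 'a) \<Rightarrow> bool" where
  "C1_grad f g \<longleftrightarrow> (\<forall>x. GDERIV f x :> g x) \<and> continuous_on UNIV g"

lemma C1_grad_continuous: "C1_grad f g \<Longrightarrow> continuous_on UNIV f"
  unfolding C1_grad_def gderiv_def
  by (meson continuous_at_imp_continuous_on has_derivative_continuous)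

lemma C1_grad_inner: "C1_grad (\<lambda>x. x \<bullet> b - c) (\<lambda>x. b)"
  unfolding C1_grad_def gderiv_def by (auto intro!: derivative_eq_intros)

lemma C1_grad_mult:
  assumes "C1_grad f g" "C1_grad f' g'"
  shows "C1_grad (\<lambda>x. f x * f' x) (\<lambda>x. f x *\<^sub>R g' x + f' x *\<^sub>R g x)"
  using assms C1_grad_continuous[OF assms(1)] C1_grad_continuous[OF assms(2)]
  unfolding C1_grad_def by (auto intro!: GDERIV_mult continuous_intros)

lemma C1_grad_compose:
  assumes f: "C1_grad f g" and h: "\<And>x. DERIV h (f x) :> h' (f x)" and h': "continuous_on (range f) h'"
  shows "C1_grad (\<lambda>x. h (f x)) (\<lambda>x. h' (f x) *\<^sub>R g x)"
  using f h C1_grad_continuous[OF f] unfolding C1_grad_def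
  by (auto intro!: GDERIV_DERIV_compose[of f _ _ h] continuous_on_scaleR continuous_on_compose2[OF h'])

lemma C1_grad_prod:
  assumes "finite I" "\<And>i. i \<in> I \<Longrightarrow> \<exists>g. C1_grad (f i) g"
  shows "\<exists>g. C1_grad (\<lambda>x. \<Prod>i\<in>I. f i x) g"
  using assms
proof (induction I rule: finite_induct)
  case empty
  show ?case
    by (intro exI[of _ "\<lambda>x. 0"]) (auto simp: C1_grad_def GDERIV_const)
next
  case (insert i I)
  then obtain g g' where "C1_grad (f i) g" "C1_grad (\<lambda>x. \<Prod>i\<in>I. f i x) g'" by blast
  from C1_grad_mult[OF this] insert.hyps show ?case by auto
qed

lemma C1_test_static:
  fixes \<zeta> :: "'a::euclidean_space \<Rightarrow> real"
  assumes \<zeta>: "C1_grad \<zeta> g" and K: "compact K" "\<And>x. x \<notin> K \<Longrightarrow> \<zeta> x = 0"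
  shows "C1_test (\<lambda>_. \<zeta>) (\<lambda>_ _. 0) (\<lambda>_. g)"
  unfolding C1_test_def
proof (intro conjI ballI allI)
  fix t :: real and x :: 'a assume "t \<in> {0..1}"
  have "(snd has_derivative snd) (at (t, x))"
    by (rule bounded_linear_imp_has_derivative[OF bounded_linear_snd])
  moreover have "(\<zeta> has_derivative (\<lambda>h. h \<bullet> g x)) (at (snd (t, x)))"
    using \<zeta> unfolding C1_grad_def gderiv_def by simp
  ultimately have "((\<lambda>z. \<zeta> (snd z)) has_derivative (\<lambda>h. snd h \<bullet> g x)) (at (t, x))"
    by (rule has_derivative_compose)
  then show "((\<lambda>(s, y). \<zeta> y) has_derivative (\<lambda>(s, y). s * 0 + y \<bullet> g x)) (at (t, x) within {0..1} \<times> UNIV)"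
    by (simp add: case_prod_unfold has_derivative_at_withinI)
next
  show "continuous_on ({0..1::real} \<times> UNIV) (\<lambda>(t, x). g x)"
    using \<zeta> unfolding C1_grad_def case_prod_unfold
    by (intro continuous_on_compose2[of UNIV g _ snd] continuous_intros) auto
  show "\<exists>K. compact K \<and> (\<forall>t\<in>{0..1::real}. \<forall>x. (t, x) \<notin> K \<longrightarrow> \<zeta> x = 0)"
    using compact_Times[OF compact_Icc[of 0 "1::real"] K(1)] K(2) by (intro exI[of _ "{0..1} \<times> K"]) simp
qed (simp add: case_prod_unfold)

text \<open>A \<open>C\<^sup>1\<close> function that is positive exactly on the positive half-line, so that products of
  its compositions with coordinates are bumps on boxes.\<close>
definition hump :: "real \<Rightarrow> real" where
  "hump s = (max 0 s)\<^sup>2"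

lemma DERIV_hump: "DERIV hump s :> 2 * max 0 s"
proof -
  consider "s < 0" | "s = 0" | "s > 0" by linarith
  then show ?thesis
  proof cases
    case 1
    have "DERIV (\<lambda>s. 0 :: real) s :> 2 * max 0 s" using 1 by simp
    then show ?thesis
      by (rule has_field_derivative_transform_within[where d = "- s"]) (use 1 in \<open>auto simp: hump_def dist_real_def\<close>)
  next
    case 2
    have "GDERIV hump (0 :: real) :> 0"
      by (rule GDERIV_sandwich[where h = "\<lambda>s. s\<^sup>2" and l = "\<lambda>s. 0"])
        (auto simp: hump_def max_def intro!: derivative_eq_intros)
    then show ?thesis using 2 by simp
  next
    case 3
    have "DERIV (\<lambda>s. s\<^sup>2 :: real) s :> 2 * max 0 s" using 3 by (auto intro!: derivative_eq_intros)
    then show ?thesis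
      by (rule has_field_derivative_transform_within[where d = s]) (use 3 in \<open>auto simp: hump_def dist_real_def max_def\<close>)
  qed
qed

lemma hump_nonneg: "0 \<le> hump s" and hump_eq_0_iff: "hump s = 0 \<longleftrightarrow> s \<le> 0"
  by (auto simp: hump_def max_def)

lemma continuous_hump: "isCont hump s"
  using DERIV_hump by (rule DERIV_isCont)

lemma C1_grad_hump:
  assumes "C1_grad f g"
  shows "C1_grad (\<lambda>x. hump (f x)) (\<lambda>x. (2 * max 0 (f x)) *\<^sub>R g x)"
  using assms by (rule C1_grad_compose[where h = hump and h' = "\<lambda>s. 2 * max 0 s"])
    (auto intro!: DERIV_hump continuous_intros)

lemma box_bump:
  fixes a b :: "'a::euclidean_space"
  obtains B g where "C1_grad B g" "\<And>x. 0 \<le> B x" "\<And>x. B x \<noteq> 0 \<longleftrightarrow> x \<in> box a b"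
proof -
  let ?B = "\<lambda>x. \<Prod>i\<in>Basis. hump (x \<bullet> i - a \<bullet> i) * hump (x \<bullet> (- i) - (- (b \<bullet> i)))"
  have "\<exists>g. C1_grad ?B g"
    by (intro C1_grad_prod finite_Basis exI)
      (rule C1_grad_mult[OF C1_grad_hump[OF C1_grad_inner] C1_grad_hump[OF C1_grad_inner]])
  then obtain g where "C1_grad ?B g" by blast
  moreover have "0 \<le> ?B x" for x by (intro prod_nonneg ballI mult_nonneg_nonneg hump_nonneg)
  moreover have "?B x \<noteq> 0 \<longleftrightarrow> x \<in> box a b" for x
    by (auto simp: hump_eq_0_iff mem_box not_le)
  ultimately show ?thesis by (rule that)
qed

text \<open>The fundamental lemma of the calculus of variations: \<open>1 - 1 / (1 + k B)\<close>, with \<open>B\<close> a bump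
  supported in a box, increases to the indicator of the box, and boxes generate the Borel sets.\<close>
lemma AE_zero_if_test_integrals_zero:
  fixes f :: "'a::euclidean_space \<Rightarrow> real"
  assumes f[measurable]: "f \<in> borel_measurable borel"
    and int: "\<And>a b. set_integrable lborel (cbox a b) f"
    and zero: "\<And>\<zeta> g K. C1_grad \<zeta> g \<Longrightarrow> compact K \<Longrightarrow> (\<And>x. x \<notin> K \<Longrightarrow> \<zeta> x = 0) \<Longrightarrow>
      (LINT x|lborel. f x * \<zeta> x) = 0"
  shows "AE x in lborel. f x = 0"
proof -
  have int_box: "integrable lborel (\<lambda>x. indicator (box a b) x * f x)" for a b :: 'a
    using set_integrable_subset[OF int[of a b], of "box a b"] box_subset_cbox[of a b]
    by (auto simp: set_integrable_def)
  have box: "(LINT x|lborel. indicator (box a b) x * f x) = 0" for a b :: 'a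
  proof -
    obtain B g where B: "C1_grad B g" "\<And>x. 0 \<le> B x" "\<And>x. B x \<noteq> 0 \<longleftrightarrow> x \<in> box a b"
      using box_bump[of a b] by metis
    define \<zeta> where "\<zeta> k x = 1 - inverse (1 + real k * B x)" for k x
    have pos: "1 + real k * B x > 0" for k x
      using B(2)[of x] by (simp add: add_pos_nonneg)
    have \<zeta>0: "\<zeta> k x = 0" if "x \<notin> box a b" for k x
      using B(3)[of x] that by (simp add: \<zeta>_def)
    have C1: "\<exists>g. C1_grad (\<zeta> k) g" for k
    proof -
      have d: "DERIV (\<lambda>s. 1 - inverse (1 + real k * s)) (B x) :> real k * (inverse (1 + real k * B x))\<^sup>2" for x
        using pos[of k x] by (auto intro!: derivative_eq_intros simp: power2_eq_square)
      have c: "continuous_on (range B) (\<lambda>s. real k * (inverse (1 + real k * s))\<^sup>2)"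
        using pos[of k] by (intro continuous_intros) (metis less_irrefl rangeE)
      show ?thesis
        using C1_grad_compose[OF B(1) d c] unfolding \<zeta>_def by blast
    qed
    have zero_k: "(LINT x|lborel. f x * \<zeta> k x) = 0" for k
      using C1[of k] \<zeta>0 box_subset_cbox[of a b] zero[OF _ compact_cbox[of a b]] by blast
    have [measurable]: "\<zeta> k \<in> borel_measurable borel" for k
      using C1[of k] C1_grad_continuous borel_measurable_continuous_onI by blast
    have "(\<lambda>k. LINT x|lborel. f x * \<zeta> k x) \<longlonglongrightarrow> (LINT x|lborel. indicator (box a b) x * f x)"
    proof (rule integral_dominated_convergence[where w = "\<lambda>x. norm (indicator (box a b) x * f x)"])
      show "integrable lborel (\<lambda>x. norm (indicator (box a b) x * f x))"
        using int_box by (rule integrable_norm)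
      show "AE x in lborel. (\<lambda>k. f x * \<zeta> k x) \<longlonglongrightarrow> indicator (box a b) x * f x"
      proof (rule AE_I2)
        fix x
        show "(\<lambda>k. f x * \<zeta> k x) \<longlonglongrightarrow> indicator (box a b) x * f x"
        proof (cases "x \<in> box a b")
          case True
          then have "B x > 0" using B(2,3)[of x] by (simp add: order_less_le)
          then have "filterlim (\<lambda>k. 1 + real k * B x) at_top sequentially"
            by (intro filterlim_tendsto_add_at_top[OF tendsto_const]
                filterlim_at_top_mult_tendsto_pos[OF tendsto_const] filterlim_real_sequentially)
          then have "(\<lambda>k. inverse (1 + real k * B x)) \<longlonglongrightarrow> 0"
            by (rule tendsto_inverse_0_at_top)
          then have "(\<lambda>k. f x * \<zeta> k x) \<longlonglongrightarrow> f x * (1 - 0)"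
            unfolding \<zeta>_def by (intro tendsto_intros)
          then show ?thesis using True by simp
        qed (simp add: \<zeta>0)
      qed
      show "AE x in lborel. norm (f x * \<zeta> k x) \<le> norm (indicator (box a b) x * f x)" for k
      proof (rule AE_I2)
        fix x
        have "\<bar>\<zeta> k x\<bar> \<le> 1"
          using pos[of k x] B(2)[of x] by (auto simp: \<zeta>_def abs_le_iff inverse_le_1_iff)
        then show "norm (f x * \<zeta> k x) \<le> norm (indicator (box a b) x * f x)"
          using \<zeta>0[of x k] by (auto simp: abs_mult mult_left_le split: split_indicator)
      qed
    qed auto
    then show ?thesis using zero_k by (simp add: LIMSEQ_const_iff)
  qed
  let ?E = "range (\<lambda>(a, b). box a b :: 'a set)"
  let ?P = "density lborel (\<lambda>x. ennreal (f x))" and ?N = "density lborel (\<lambda>x. ennreal (- f x))"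
  have eP: "emeasure ?P (box a b) = (\<integral>\<^sup>+x. ennreal (indicator (box a b) x * f x) \<partial>lborel)"
    and eN: "emeasure ?N (box a b) = (\<integral>\<^sup>+x. ennreal (- (indicator (box a b) x * f x)) \<partial>lborel)" for a b :: 'a
    by (auto simp: emeasure_density intro!: nn_integral_cong split: split_indicator)
  have fin: "emeasure ?P (box a b) \<noteq> \<infinity>" "emeasure ?N (box a b) \<noteq> \<infinity>" for a b :: 'a
    using int_box[of a b] unfolding eP eN real_integrable_def by auto
  have "?P = ?N"
  proof (rule measure_eqI_generator_eq[where E = ?E and \<Omega> = UNIV and A = "\<lambda>n. box (- (real n *\<^sub>R One)) (real n *\<^sub>R One)"])
    show "Int_stable ?E"
      by (auto simp: Int_stable_def box_Int_box)
    show "emeasure ?P X = emeasure ?N X" if X: "X \<in> ?E" for X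
    proof -
      obtain a b where X: "X = box a b" using X by auto
      have "enn2real (emeasure ?P X) = enn2real (emeasure ?N X)"
        using box[of a b] unfolding X eP eN real_lebesgue_integral_def[OF int_box] by simp
      then show ?thesis
        using fin[of a b] unfolding X by (metis ennreal_enn2real infinity_ennreal_def less_top)
    qed
    show "sets ?P = sigma_sets UNIV ?E" "sets ?N = sigma_sets UNIV ?E"
      by (simp_all add: borel_eq_box)
    show "(\<Union>n. box (- (real n *\<^sub>R One)) (real n *\<^sub>R One)) = (UNIV :: 'a set)"
      using UN_box_eq_UNIV by auto
    show "emeasure ?P (box (- (real n *\<^sub>R One)) (real n *\<^sub>R One)) \<noteq> \<infinity>" for n
      by (rule fin)
  qed auto
  then have "AE x in lborel. ennreal (f x) = ennreal (- f x)"
    by (subst (asm) sigma_finite_measure.density_unique_iff[OF sigma_finite_lborel]) auto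
  then show ?thesis
  proof eventually_elim
    case (elim x)
    then show ?case by (cases "f x \<ge> 0") (auto simp: ennreal_neg ennreal_eq_0_iff)
  qed
qed

text \<open>Off its support a test function vanishes in a relative neighbourhood, and derivatives within
  the strip are unique. So its derivatives live on the support as well, where they are continuous on a compact
  set.\<close>
lemma C1_test_bounded:
  fixes \<psi> :: "real \<Rightarrow> 'a::euclidean_space \<Rightarrow> real"
  assumes "C1_test \<psi> \<psi>t \<psi>x"
  obtains B where "\<And>t x. t \<in> {0..1} \<Longrightarrow> \<bar>\<psi> t x\<bar> \<le> B" "\<And>t x. t \<in> {0..1} \<Longrightarrow> \<bar>\<psi>t t x\<bar> \<le> B"
    "\<And>t x. t \<in> {0..1} \<Longrightarrow> norm (\<psi>x t x) \<le> B"
proof -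
  let ?S = "{0..1::real} \<times> (UNIV :: 'a set)"
  have der: "((\<lambda>(s, y). \<psi> s y) has_derivative (\<lambda>(s, y). s * \<psi>t t x + y \<bullet> \<psi>x t x)) (at (t, x) within ?S)"
    if "t \<in> {0..1}" for t x
    using assms that unfolding C1_test_def by blast
  have cont: "continuous_on ?S (\<lambda>(t, x). \<psi>t t x)" "continuous_on ?S (\<lambda>(t, x). \<psi>x t x)"
    using assms unfolding C1_test_def by blast+
  obtain K where K: "compact K" "\<And>t x. t \<in> {0..1} \<Longrightarrow> (t, x) \<notin> K \<Longrightarrow> \<psi> t x = 0"
    using assms unfolding C1_test_def by blast
  have zero: "\<psi>t t x = 0 \<and> \<psi>x t x = 0" if t: "t \<in> {0..1}" and nK: "(t, x) \<notin> K" for t x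
  proof -
    have "\<exists>d>0. ball (t, x) d \<subseteq> - K"
      using nK compact_imp_closed[OF K(1)] by (meson Compl_iff open_Compl open_contains_ball)
    then obtain d where d: "d > 0" "ball (t, x) d \<subseteq> - K" by blast
    have "((\<lambda>z. 0 :: real) has_derivative (\<lambda>(s, y). s * \<psi>t t x + y \<bullet> \<psi>x t x)) (at (t, x) within ?S)"
    proof (rule has_derivative_transform_within[OF der[OF t] d(1)])
      show "(t, x) \<in> ?S" using t by simp
      show "(case z of (s, y) \<Rightarrow> \<psi> s y) = 0" if "z \<in> ?S" "dist z (t, x) < d" for z
        using that d(2) K(2) by (force simp: dist_commute)
    qed
    moreover have "((\<lambda>z. 0 :: real) has_derivative (\<lambda>z. 0)) (at (t, x) within ?S)"
      by (rule has_derivative_const)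
    ultimately have "(\<lambda>(s, y). s * \<psi>t t x + y \<bullet> \<psi>x t x) = (\<lambda>z. 0)"
    proof (rule frechet_derivative_unique_within)
      fix i :: "real \<times> 'a" and e :: real assume i: "i \<in> Basis" and e: "e > 0"
      show "\<exists>d. 0 < \<bar>d\<bar> \<and> \<bar>d\<bar> < e \<and> (t, x) + d *\<^sub>R i \<in> ?S"
      proof (cases "fst i = 0")
        case True
        then show ?thesis using t e by (intro exI[of _ "e / 2"]) (auto simp: mem_Times_iff)
      next
        case False
        then have i1: "fst i = 1" using i by (auto simp: Basis_prod_def)
        define d where "d = (if t < 1 / 2 then min (e / 2) (1 / 2) else - min (e / 2) (1 / 2))"
        have "0 < \<bar>d\<bar> \<and> \<bar>d\<bar> < e \<and> t + d \<in> {0..1}"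
          using t e by (auto simp: d_def min_def)
        then show ?thesis by (intro exI[of _ d]) (auto simp: mem_Times_iff i1)
      qed
    qed
    from fun_cong[OF this, of "(1, 0)"] fun_cong[OF this, of "(0, \<psi>x t x)"] show ?thesis by simp
  qed
  have comp: "compact (K \<inter> ?S)"
    by (intro compact_Int_closed K closed_Times) auto
  have contd: "continuous_on ?S (\<lambda>(t, x). \<psi> t x)"
    unfolding continuous_on_eq_continuous_within using der has_derivative_continuous by fastforce
  have "bounded ((\<lambda>(t, x). \<psi> t x) ` (K \<inter> ?S))" "bounded ((\<lambda>(t, x). \<psi>t t x) ` (K \<inter> ?S))"
      "bounded ((\<lambda>(t, x). \<psi>x t x) ` (K \<inter> ?S))"
    by (intro compact_imp_bounded compact_continuous_image comp continuous_on_subset[OF contd]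
        continuous_on_subset[OF cont(1)] continuous_on_subset[OF cont(2)] Int_lower2)+
  then obtain B1 B2 B3 where B: "\<And>z. z \<in> K \<inter> ?S \<Longrightarrow> norm ((\<lambda>(t, x). \<psi> t x) z) \<le> B1"
      "\<And>z. z \<in> K \<inter> ?S \<Longrightarrow> norm ((\<lambda>(t, x). \<psi>t t x) z) \<le> B2"
      "\<And>z. z \<in> K \<inter> ?S \<Longrightarrow> norm ((\<lambda>(t, x). \<psi>x t x) z) \<le> B3"
    unfolding bounded_iff by (metis imageI)
  let ?B = "max 0 (max B1 (max B2 B3))"
  show ?thesis
  proof (rule that[of ?B])
    fix t :: real and x :: 'a assume t: "t \<in> {0..1}"
    show "\<bar>\<psi> t x\<bar> \<le> ?B" "\<bar>\<psi>t t x\<bar> \<le> ?B"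
      "norm (\<psi>x t x) \<le> ?B"
    proof (atomize (full), cases "(t, x) \<in> K")
      case True
      then have "\<bar>\<psi> t x\<bar> \<le> B1" "\<bar>\<psi>t t x\<bar> \<le> B2" "norm (\<psi>x t x) \<le> B3"
        using B[of "(t, x)"] t by simp_all
      then show "\<bar>\<psi> t x\<bar> \<le> ?B \<and> \<bar>\<psi>t t x\<bar> \<le> ?B \<and>
          norm (\<psi>x t x) \<le> ?B" by linarith
    next
      case False
      then show "\<bar>\<psi> t x\<bar> \<le> ?B \<and> \<bar>\<psi>t t x\<bar> \<le> ?B \<and>
          norm (\<psi>x t x) \<le> ?B"
        using K(2)[OF t] zero[OF t] by simp
    qed
  qed
qed

lemma C1_test_along_ray:
  fixes \<psi> :: "real \<Rightarrow> 'a::euclidean_space \<Rightarrow> real"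
  assumes \<psi>: "C1_test \<psi> \<psi>t \<psi>x"
  shows "(LINT s|lborel. indicator {0<..<1} s * (\<psi>t s (x + s *\<^sub>R z) + z \<bullet> \<psi>x s (x + s *\<^sub>R z)))
     = \<psi> 1 (x + z) - \<psi> 0 x"
proof -
  let ?f = "\<lambda>s. \<psi>t s (x + s *\<^sub>R z) + z \<bullet> \<psi>x s (x + s *\<^sub>R z)"
  let ?S = "{0..1::real} \<times> (UNIV :: 'a set)"
  have der: "((\<lambda>(s, y). \<psi> s y) has_derivative (\<lambda>(s, y). s * \<psi>t t x + y \<bullet> \<psi>x t x)) (at (t, x) within ?S)"
    if "t \<in> {0..1}" for t x
    using \<psi> that unfolding C1_test_def by blast
  have cont: "continuous_on ?S (\<lambda>(t, x). \<psi>t t x)" "continuous_on ?S (\<lambda>(t, x). \<psi>x t x)"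
    using \<psi> unfolding C1_test_def by blast+
  have "((\<lambda>s. \<psi> s (x + s *\<^sub>R z)) has_vector_derivative ?f t) (at t within {0..1})" if t: "t \<in> {0..1}" for t
  proof -
    have "((\<lambda>s. (s, x + s *\<^sub>R z)) has_derivative (\<lambda>h. (h, h *\<^sub>R z))) (at t within {0..1})"
      by (auto intro!: derivative_eq_intros)
    moreover have "((\<lambda>(s, y). \<psi> s y) has_derivative (\<lambda>(s, y). s * \<psi>t t (x + t *\<^sub>R z) + y \<bullet> \<psi>x t (x + t *\<^sub>R z)))
        (at (t, x + t *\<^sub>R z) within (\<lambda>s. (s, x + s *\<^sub>R z)) ` {0..1})"
      by (rule has_derivative_subset[OF der[OF t]]) auto
    ultimately have "((\<lambda>s. (\<lambda>(s, y). \<psi> s y) (s, x + s *\<^sub>R z)) has_derivative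
        (\<lambda>h. (\<lambda>(s, y). s * \<psi>t t (x + t *\<^sub>R z) + y \<bullet> \<psi>x t (x + t *\<^sub>R z)) (h, h *\<^sub>R z))) (at t within {0..1})"
      by (rule has_derivative_in_compose)
    then show ?thesis
      unfolding has_vector_derivative_def by (simp add: algebra_simps)
  qed
  moreover have "continuous_on {0..1} ?f"
  proof -
    have p: "continuous_on {0..1} (\<lambda>s. (s, x + s *\<^sub>R z))" by (intro continuous_intros)
    have im: "(\<lambda>s. (s, x + s *\<^sub>R z)) ` {0..1} \<subseteq> ?S" by auto
    have "continuous_on {0..1} (\<lambda>s. \<psi>t s (x + s *\<^sub>R z))" "continuous_on {0..1} (\<lambda>s. \<psi>x s (x + s *\<^sub>R z))"
      using continuous_on_compose2[OF cont(1) p im] continuous_on_compose2[OF cont(2) p im] by simp_all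
    then show ?thesis by (intro continuous_intros)
  qed
  ultimately have "(LINT s|lborel. indicator {0..1} s *\<^sub>R ?f s) = \<psi> 1 (x + 1 *\<^sub>R z) - \<psi> 0 (x + 0 *\<^sub>R z)"
    by (intro integral_FTC_Icc) auto
  moreover have "(LINT s|lborel. indicator {0<..<1} s * ?f s) = (LINT s|lborel. indicator {0..1} s *\<^sub>R ?f s)"
  proof (rule integral_cong_AE)
    have "(\<lambda>s. indicator {0..1} s *\<^sub>R ?f s) \<in> borel_measurable borel"
      using \<open>continuous_on {0..1} ?f\<close> by (intro borel_measurable_continuous_on_indicator) auto
    then show m: "(\<lambda>s. indicator {0..1} s *\<^sub>R ?f s) \<in> borel_measurable lborel" by simp
    have "(\<lambda>s. indicator {0<..<1} s * (indicator {0..1} s *\<^sub>R ?f s)) \<in> borel_measurable lborel"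
      by (intro borel_measurable_times m) auto
    then show "(\<lambda>s. indicator {0<..<1} s * ?f s) \<in> borel_measurable lborel"
      by (rule measurable_cong[THEN iffD1, rotated]) (auto split: split_indicator)
    have "AE s in lborel. s \<noteq> (0::real)" "AE s in lborel. s \<noteq> (1::real)" by (rule AE_lborel_singleton)+
    then show "AE s in lborel. indicator {0<..<1} s * ?f s = indicator {0..1} s *\<^sub>R ?f s"
      by eventually_elim (auto split: split_indicator)
  qed
  ultimately show ?thesis by simp
qed

text \<open>The weak formulation presupposes that \<open>lam * (V \<bullet> \<nabla>\<psi>)\<close> is measurable for every test
  function; with cut-off coordinate functions as test functions this makes \<open>lam V\<close> measurable.\<close>
lemma momentum_measurable:
  fixes lam :: "real \<Rightarrow> 'a::euclidean_space \<Rightarrow> real"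
  assumes ce: "continuity_equation lam V \<mu>0 \<mu>1"
  shows "(\<lambda>z. indicator ({0<..<1} \<times> UNIV) z *\<^sub>R (lam (fst z) (snd z) *\<^sub>R V (fst z) (snd z))) \<in> borel_measurable borel"
proof (subst borel_measurable_euclidean_space, intro ballI)
  fix b :: 'a assume "b \<in> Basis"
  let ?I = "\<lambda>z. indicator ({0<..<1::real} \<times> (UNIV :: 'a set)) z :: real"
  let ?w = "\<lambda>z a. lam (fst z) (snd z) * (V (fst z) (snd z) \<bullet> a)"
  have meas: "(\<lambda>z. ?I z * ?w z (g (snd z))) \<in> borel_measurable borel"
    if C1: "C1_grad \<zeta> g" and K: "compact K" "\<And>x. x \<notin> K \<Longrightarrow> \<zeta> x = 0" for \<zeta> g K
  proof -
    have "set_integrable lborel ({0<..<1} \<times> UNIV) (\<lambda>(t, x). lam t x * 0 + (lam t x *\<^sub>R V t x) \<bullet> g x)"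
      using ce C1_test_static[OF C1 K] unfolding continuity_equation_def by blast
    then have "(\<lambda>z. ?I z *\<^sub>R (case z of (t, x) \<Rightarrow> lam t x * 0 + (lam t x *\<^sub>R V t x) \<bullet> g x)) \<in> borel_measurable lborel"
      unfolding set_integrable_def by (rule borel_measurable_integrable)
    then show ?thesis by (simp add: case_prod_unfold)
  qed
  let ?c = "\<lambda>n. inverse ((real (Suc n))\<^sup>2)"
  define \<eta> where "\<eta> n x = hump (1 - ?c n * (norm x)\<^sup>2)" for n and x :: 'a
  have norm2: "C1_grad (\<lambda>x::'a. 1 - ?c n * (norm x)\<^sup>2) (\<lambda>x. - (2 * ?c n) *\<^sub>R x)" for n
    unfolding C1_grad_def gderiv_def power2_norm_eq_inner
    by (auto intro!: derivative_eq_intros continuous_intros simp: inner_commute)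
  define g\<eta> where "g\<eta> n x = (2 * max 0 (1 - ?c n * (norm x)\<^sup>2)) *\<^sub>R (- (2 * ?c n) *\<^sub>R x)" for n and x :: 'a
  have \<eta>: "C1_grad (\<eta> n) (g\<eta> n)" for n
    unfolding \<eta>_def g\<eta>_def by (rule C1_grad_hump[OF norm2])
  have supp: "\<eta> n x = 0" if "x \<notin> cball 0 (real (Suc n))" for n x
  proof -
    have "(real (Suc n))\<^sup>2 \<le> (norm x)\<^sup>2" using that by (intro power_mono) auto
    then show ?thesis by (simp add: \<eta>_def hump_eq_0_iff field_simps del: of_nat_Suc)
  qed
  have b: "C1_grad (\<lambda>x. x \<bullet> b) (\<lambda>x. b)" using C1_grad_inner[of b 0] by simp
  have mn: "(\<lambda>z. ?I z * ?w z b * \<eta> n (snd z)) \<in> borel_measurable borel" for n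
  proof -
    have 1: "(\<lambda>z. ?I z * ?w z (g\<eta> n (snd z))) \<in> borel_measurable borel"
      by (rule meas[OF \<eta> compact_cball[of 0 "real (Suc n)"] supp])
    have 2: "(\<lambda>z. ?I z * ?w z ((snd z \<bullet> b) *\<^sub>R g\<eta> n (snd z) + \<eta> n (snd z) *\<^sub>R b)) \<in> borel_measurable borel"
      using C1_grad_mult[OF b \<eta>[of n]] by (rule meas[OF _ compact_cball[of 0 "real (Suc n)"]]) (auto simp: supp)
    have "(\<lambda>z. ?I z * ?w z ((snd z \<bullet> b) *\<^sub>R g\<eta> n (snd z) + \<eta> n (snd z) *\<^sub>R b)
        - (snd z \<bullet> b) * (?I z * ?w z (g\<eta> n (snd z)))) \<in> borel_measurable borel"
      by (intro borel_measurable_diff 2 borel_measurable_times 1 borel_measurable_continuous_onI continuous_intros)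
    then show ?thesis by (simp add: inner_add_right algebra_simps)
  qed
  have "(\<lambda>z. ?I z * ?w z b) \<in> borel_measurable borel"
  proof (rule borel_measurable_LIMSEQ_real[OF _ mn])
    fix z :: "real \<times> 'a"
    have "(\<lambda>n. (norm (snd z))\<^sup>2 * (inverse (real (Suc n)))\<^sup>2) \<longlonglongrightarrow> (norm (snd z))\<^sup>2 * 0\<^sup>2"
      by (intro tendsto_intros LIMSEQ_inverse_real_of_nat)
    then have "(\<lambda>n. 1 - ?c n * (norm (snd z))\<^sup>2) \<longlonglongrightarrow> 1 - 0"
      by (intro tendsto_intros) (simp add: mult.commute power_inverse del: of_nat_Suc)
    then have "(\<lambda>n. \<eta> n (snd z)) \<longlonglongrightarrow> hump (1 - 0)"
      unfolding \<eta>_def by (rule isCont_tendsto_compose[OF continuous_hump])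
    then have "(\<lambda>n. ?I z * ?w z b * \<eta> n (snd z))
        \<longlonglongrightarrow> ?I z * ?w z b * hump (1 - 0)"
      by (intro tendsto_mult tendsto_const)
    then show "(\<lambda>n. ?I z * ?w z b * \<eta> n (snd z))
        \<longlonglongrightarrow> ?I z * ?w z b"
      by (simp add: hump_def)
  qed
  then show "(\<lambda>z. (?I z *\<^sub>R (lam (fst z) (snd z) *\<^sub>R V (fst z) (snd z))) \<bullet> b) \<in> borel_measurable borel"
    by (simp add: mult.assoc)
qed


section \<open>Transport along the characteristics\<close>

abbreviation unit_time :: "real measure" where
  "unit_time \<equiv> density lborel (\<lambda>t. ennreal (indicator {0<..<1} t))"

lemma finite_measure_unit_time: "finite_measure unit_time"
proof (rule finite_measureI)
  have "emeasure unit_time UNIV = (\<integral>\<^sup>+t. indicator {0<..<1 :: real} t \<partial>lborel)"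
    by (subst emeasure_density) (simp_all add: ennreal_indicator)
  then have "emeasure unit_time UNIV = emeasure lborel {0<..<1 :: real}" by simp
  then show "emeasure unit_time (space unit_time) \<noteq> \<infinity>" by simp
qed

locale characteristic_flow =
  fixes p q C L :: real and \<rho>0 \<rho>1 v :: "'a::euclidean_space \<Rightarrow> real" and M :: "'a \<Rightarrow> 'a" and K0 r :: real
  assumes p: "1 < p" and pq: "1 / p + 1 / q = 1"
    and \<rho>0: "prob_density \<rho>0" and bounded0: "AE x in lborel. \<bar>\<rho>0 x\<bar> \<le> K0"
    and \<rho>1: "prob_density \<rho>1"
    and bdd: "\<And>x. bdd_above (range (\<lambda>y. v y - cost p (x - y)))"
    and lipschitz: "L-lipschitz_on UNIV v"
    and C: "0 \<le> C" and semiconvex: "semiconvex_with C v"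
    and transport: "transport_map \<rho>0 \<rho>1 M"
    and contact_AE: "AE x in law \<rho>0. lax_hopf p v 0 x = v (M x) - cost p (M x - x)"
    and r: "0 < r" and speed_ge_AE: "AE x in law \<rho>0. 2 < p \<longrightarrow> r \<le> norm (M x - x)"
begin

abbreviation P :: "'a measure" where
  "P \<equiv> law \<rho>0"

definition R :: real where "R = (p * L) powr (1 / (p - 1))"

definition X :: "real \<Rightarrow> 'a \<Rightarrow> 'a" where "X t x = x + t *\<^sub>R (M x - x)"

definition V :: "real \<Rightarrow> 'a \<Rightarrow> 'a" where "V t x = flux q (grad (lax_hopf p v t) x)"

definition good :: "'a set" where
  "good = {x. lax_hopf p v 0 x = v (M x) - cost p (M x - x) \<and> (2 < p \<longrightarrow> r \<le> norm (M x - x))}"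

text \<open>An optimal ray with velocity \<open>z\<close> through \<open>y\<close> at time \<open>t\<close> runs from \<open>y - t z\<close> to
  \<open>y + (1 - t) z\<close>. Optimality is stated at the end points, where it involves only the continuous functions
  \<open>lax_hopf p v 0\<close> and \<open>v\<close>; this makes the set measurable.\<close>
definition rays :: "(real \<times> 'a) set" where
  "rays = {(t, y). 0 < t \<and> t < 1 \<and>
     (\<exists>z\<in>cball 0 R. lax_hopf p v 0 (y - t *\<^sub>R z) = v (y + (1 - t) *\<^sub>R z) - cost p z)}"

lemma M_measurable[measurable]: "M \<in> borel_measurable borel"
  using transport unfolding transport_map_def by blast

lemma distr_M: "distr P borel M = law \<rho>1"
  using transport transport_map_iff[OF \<rho>0 \<rho>1] by blast

lemmas [measurable] = prob_density_measurable[OF \<rho>0] prob_density_measurable[OF \<rho>1]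

lemma continuous_v: "continuous_on UNIV v" and continuous_lax0: "continuous_on UNIV (lax_hopf p v 0)"
  using lipschitz_on_continuous_on[OF lipschitz]
    lipschitz_on_continuous_on[OF lipschitz_lax_hopf_0[OF p bdd lipschitz]] by auto

lemma [measurable]: "v \<in> borel_measurable borel" "lax_hopf p v 0 \<in> borel_measurable borel"
    "(cost p :: 'a \<Rightarrow> real) \<in> borel_measurable borel"
  using continuous_v continuous_lax0 continuous_on_cost[OF p] by (auto intro: borel_measurable_continuous_onI)

lemma good_sets[measurable]: "good \<in> sets borel"
  unfolding good_def by measurable

lemma AE_good: "AE x in P. x \<in> good"
  using contact_AE speed_ge_AE by eventually_elim (simp add: good_def)

lemma contact_good: "x \<in> good \<Longrightarrow> contact p v x (M x)"
  by unfold_locales (auto simp: good_def p bdd)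

lemma speed_le_R: "contact p v x y \<Longrightarrow> norm (y - x) \<le> R"
  unfolding R_def using contact.speed_le lipschitz by blast

lemma V_on_ray:
  assumes t: "0 < t" "t < 1" and eq: "lax_hopf p v 0 (y - t *\<^sub>R z) = v (y + (1 - t) *\<^sub>R z) - cost p z"
  shows "V t y = z"
proof -
  have z: "y + (1 - t) *\<^sub>R z - (y - t *\<^sub>R z) = z" by (simp add: algebra_simps)
  have "contact p v (y - t *\<^sub>R z) (y + (1 - t) *\<^sub>R z)"
    by unfold_locales (use p bdd eq z in auto)
  from contact.GDERIV_along_ray[OF this t] have "GDERIV (lax_hopf p v t) y :> flux p z"
    by (simp add: z)
  then show ?thesis
    unfolding V_def by (simp add: grad_eqI flux_flux[OF p pq])
qed

lemma V_along_X: "x \<in> good \<Longrightarrow> 0 < t \<Longrightarrow> t < 1 \<Longrightarrow> V t (X t x) = M x - x"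
  by (rule V_on_ray) (auto simp: X_def good_def algebra_simps)

lemma X_in_rays: "x \<in> good \<Longrightarrow> 0 < t \<Longrightarrow> t < 1 \<Longrightarrow> (t, X t x) \<in> rays"
  using speed_le_R[OF contact_good, of x]
  unfolding rays_def by (auto intro!: bexI[of _ "M x - x"] simp: X_def good_def algebra_simps)

lemma V_rays_norm_le: "(t, y) \<in> rays \<Longrightarrow> norm (V t y) \<le> R"
  unfolding rays_def using V_on_ray by force

lemma rays_measurable[measurable]: "rays \<in> sets borel"
proof -
  let ?U = "{w :: 'a \<times> real \<times> 'a. lax_hopf p v 0 (snd (snd w) - fst (snd w) *\<^sub>R fst w)
      = v (snd (snd w) + (1 - fst (snd w)) *\<^sub>R fst w) - cost p (fst w)}"
  have "closed ?U"
    by (intro closed_Collect_eq continuous_intros continuous_on_compose2[OF continuous_lax0]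
        continuous_on_compose2[OF continuous_v] continuous_on_compose2[OF continuous_on_cost[OF p]]) auto
  then have "closedin (top_of_set (cball 0 R \<times> UNIV)) ((cball 0 R \<times> UNIV) \<inter> ?U)"
    by (rule closedin_closed_Int)
  from closedin_compact_projection[OF compact_cball this]
  have "closed {y. \<exists>x. x \<in> cball 0 R \<and> (x, y) \<in> (cball 0 R \<times> UNIV) \<inter> ?U}"
    by simp
  then have c: "{y. \<exists>x. x \<in> cball 0 R \<and> (x, y) \<in> (cball 0 R \<times> UNIV) \<inter> ?U} \<in> sets borel"
    by (rule borel_closed)
  have o: "{0<..<1::real} \<times> (UNIV :: 'a set) \<in> sets borel"
    by (intro borel_open open_Times) auto
  have "rays = {y. \<exists>x. x \<in> cball 0 R \<and> (x, y) \<in> (cball 0 R \<times> UNIV) \<inter> ?U} \<inter> ({0<..<1} \<times> UNIV)"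
    by (auto simp: rays_def)
  then show ?thesis using sets.Int[OF c o] by simp
qed

text \<open>On the rays the velocity is the unique solution of a closed condition, so its graph is closed.\<close>
lemma continuous_on_V_rays: "continuous_on rays (\<lambda>z. V (fst z) (snd z))"
proof -
  let ?U = "{w :: (real \<times> 'a) \<times> 'a. lax_hopf p v 0 (snd (fst w) - fst (fst w) *\<^sub>R snd w)
      = v (snd (fst w) + (1 - fst (fst w)) *\<^sub>R snd w) - cost p (snd w)}"
  have "closed ?U"
    by (intro closed_Collect_eq continuous_intros continuous_on_compose2[OF continuous_lax0]
        continuous_on_compose2[OF continuous_v] continuous_on_compose2[OF continuous_on_cost[OF p]]) auto
  then have cl: "closedin (top_of_set (rays \<times> cball 0 R)) ((rays \<times> cball 0 R) \<inter> ?U)"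
    by (rule closedin_closed_Int)
  have eqn: "lax_hopf p v 0 (y - t *\<^sub>R V t y) = v (y + (1 - t) *\<^sub>R V t y) - cost p (V t y)"
    if "(t, y) \<in> rays" for t y
    using that V_on_ray[of t y] unfolding rays_def by force
  have "(rays \<times> cball 0 R) \<inter> ?U = (\<lambda>z. (z, V (fst z) (snd z))) ` rays"
  proof (intro set_eqI iffI)
    fix w assume w: "w \<in> (rays \<times> cball 0 R) \<inter> ?U"
    obtain t y z where wt: "w = ((t, y), z)" by (metis prod.exhaust)
    have "V t y = z"
      using w unfolding wt by (intro V_on_ray) (auto simp: rays_def)
    then show "w \<in> (\<lambda>z. (z, V (fst z) (snd z))) ` rays"
      using w unfolding wt by force
  qed (use eqn V_rays_norm_le in auto)
  with cl show ?thesis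
    by (subst continuous_closed_graph_eq[OF compact_cball[of 0 R]]) (use V_rays_norm_le in auto)
qed

lemma V_measurable[measurable]:
  "(\<lambda>z. indicator rays z *\<^sub>R V (fst z) (snd z)) \<in> borel_measurable borel"
  by (rule borel_measurable_continuous_on_indicator[OF rays_measurable continuous_on_V_rays])

lemma X_measurable[measurable]: "X t \<in> borel_measurable borel"
  unfolding X_def by measurable

definition density_const :: real where
  "density_const = max 0 K0 * (2 * (1 + inverse_flow_const C p R r) * DIM('a)) ^ DIM('a)"

lemma inverse_flow_const_nonneg: "0 \<le> inverse_flow_const C p R r"
proof -
  have "0 \<le> R" by (simp add: R_def)
  then show ?thesis
    unfolding inverse_flow_const_def using C p by simp
qed

lemma density_const_nonneg: "0 \<le> density_const"
  unfolding density_const_def using inverse_flow_const_nonneg by simp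

text \<open>Up to a null set \<open>X t\<close> has a Lipschitz inverse, with the same constant for all \<open>t\<close>.\<close>
lemma push_forward_bound:
  assumes t: "0 < t" "t \<le> 1" and B[measurable]: "B \<in> sets borel"
  shows "emeasure P (X t -` B) \<le> ennreal density_const * emeasure lborel B"
proof -
  let ?D = "{x \<in> good. X t x \<in> B}"
  have D: "?D \<in> sets borel" by measurable
  have "emeasure P (X t -` B) = emeasure P ?D"
  proof (rule emeasure_eq_AE)
    show "AE x in P. x \<in> X t -` B \<longleftrightarrow> x \<in> ?D"
      using AE_good by eventually_elim auto
    show "X t -` B \<in> sets P" using measurable_sets_borel[OF X_measurable B] by simp
  qed (use D in simp)
  also have "\<dots> \<le> ennreal (max 0 K0) * emeasure lborel ?D"
    using bounded0 by (intro emeasure_density_bounded[OF \<rho>0 _ _ D]) (auto elim!: eventually_mono)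
  also have "emeasure lborel ?D \<le> ennreal ((2 * (1 + inverse_flow_const C p R r) * DIM('a)) ^ DIM('a)) * emeasure lborel B"
  proof (rule emeasure_le_of_expanding_map[where h = "X t"])
    show "0 < 1 + inverse_flow_const C p R r" using inverse_flow_const_nonneg by linarith
    fix x y assume "x \<in> ?D" "y \<in> ?D"
    then show "norm (x - y) \<le> (1 + inverse_flow_const C p R r) * norm (X t x - X t y)"
      unfolding X_def using contact_good[of x] contact_good[of y] speed_le_R r
      by (intro inverse_flow_lipschitz[OF _ _ semiconvex C t]) (auto simp: good_def)
  qed auto
  finally show ?thesis
    using inverse_flow_const_nonneg
    by (simp add: density_const_def ennreal_mult mult.assoc mult_left_mono)
qed

lemma X_1: "X 1 = M"
  by (simp add: X_def fun_eq_iff)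

lemma \<rho>1_bounded: "AE x in lborel. \<rho>1 x \<le> density_const"
proof -
  let ?Q = "law \<rho>1"
  have "emeasure ?Q A \<le> ennreal density_const * emeasure lborel A" if "A \<in> sets lborel" for A
    using push_forward_bound[of 1 A] that unfolding distr_M[symmetric] X_1
    by (simp add: emeasure_distr)
  then obtain l where l: "l \<in> borel_measurable lborel" "\<And>x. 0 \<le> l x" "\<And>x. l x \<le> density_const"
      "?Q = density lborel (\<lambda>x. ennreal (l x))"
    using sigma_finite_measure.bounded_density[OF sigma_finite_lborel, of ?Q density_const]
      density_const_nonneg by auto
  have "AE x in lborel. ennreal (\<rho>1 x) = ennreal (l x)"
    using l(1,4) by (subst (asm) sigma_finite_measure.density_unique_iff[OF sigma_finite_lborel]) auto
  then show ?thesis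
    by eventually_elim (use l(2,3) prob_density_nonneg[OF \<rho>1] in \<open>metis ennreal_inj\<close>)
qed

lemma L2_\<rho>1: "L2_function \<rho>1"
  unfolding L2_function_def
proof
  have "integrable lborel \<rho>1" using \<rho>1 by (simp add: prob_density_def)
  then have "integrable lborel (\<lambda>x. density_const * \<rho>1 x)" by simp
  then show "integrable lborel (\<lambda>x. (norm (\<rho>1 x))\<^sup>2)"
  proof (rule Bochner_Integration.integrable_bound)
    show "AE x in lborel. norm ((norm (\<rho>1 x))\<^sup>2) \<le> norm (density_const * \<rho>1 x)"
      using \<rho>1_bounded
    proof eventually_elim
      case (elim x)
      then show ?case
        using density_const_nonneg prob_density_nonneg[OF \<rho>1, of x]
        by (simp add: power2_eq_square mult_right_mono)
    qed
  qed simp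
qed simp

interpretation T: finite_measure unit_time by (rule finite_measure_unit_time)
interpretation P: finite_measure P by (rule finite_measure_prob_density[OF \<rho>0])
interpretation TP: pair_sigma_finite unit_time P ..

definition flow :: "real \<times> 'a \<Rightarrow> real \<times> 'a" where
  "flow z = (fst z, X (fst z) (snd z))"

lemma sets_TP: "sets (unit_time \<Otimes>\<^sub>M P) = sets borel"
  by (simp add: borel_prod[symmetric] cong: sets_pair_measure_cong)

lemma measurable_TP: "measurable (unit_time \<Otimes>\<^sub>M P) N = measurable borel N"
  by (rule measurable_cong_sets[OF sets_TP refl])

lemma flow_measurable[measurable]: "flow \<in> borel_measurable borel"
  unfolding flow_def X_def borel_prod[symmetric] by measurable

lemma finite_measure_TP: "finite_measure (unit_time \<Otimes>\<^sub>M P)"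
  by (intro finite_measure_pair_measure finite_measure_unit_time finite_measure_prob_density \<rho>0)

lemma AE_TP: "AE z in unit_time \<Otimes>\<^sub>M P. 0 < fst z \<and> fst z < 1 \<and> snd z \<in> good"
proof (rule TP.AE_pair_measure)
  have "{0<..<1} \<times> good \<in> sets (unit_time \<Otimes>\<^sub>M P)"
    by (intro pair_measureI) auto
  also have "{0<..<1} \<times> good = {z \<in> space (unit_time \<Otimes>\<^sub>M P). 0 < fst z \<and> fst z < 1 \<and> snd z \<in> good}"
    by (auto simp: space_pair_measure)
  finally show "{z \<in> space (unit_time \<Otimes>\<^sub>M P). 0 < fst z \<and> fst z < 1 \<and> snd z \<in> good} \<in> sets (unit_time \<Otimes>\<^sub>M P)" .
  have "AE t in unit_time. 0 < t \<and> t < 1"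
    by (subst AE_density) (auto split: split_indicator)
  then show "AE t in unit_time. AE x in P. 0 < fst (t, x) \<and> fst (t, x) < 1 \<and> snd (t, x) \<in> good"
    by eventually_elim (use AE_good in auto)
qed

lemma AE_flow: "AE z in unit_time \<Otimes>\<^sub>M P. flow z \<in> rays \<and> V (fst (flow z)) (snd (flow z)) = M (snd z) - snd z"
  using AE_TP by eventually_elim (auto simp: flow_def X_in_rays V_along_X)

definition flow_measure :: "(real \<times> 'a) measure" where
  "flow_measure = distr (unit_time \<Otimes>\<^sub>M P) borel flow"

lemma flow_measure_bound:
  assumes A[measurable]: "A \<in> sets borel"
  shows "emeasure flow_measure A \<le> ennreal density_const * emeasure lborel A"
proof -
  have A': "A \<in> sets (borel \<Otimes>\<^sub>M borel)" using A by (subst borel_prod)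
  have fA: "flow -` A \<in> sets (unit_time \<Otimes>\<^sub>M P)"
    using measurable_sets_borel[OF flow_measurable A] sets_TP by blast
  have Pm: "emeasure P (X t -` (Pair t -` A)) \<le> ennreal density_const * emeasure lborel (Pair t -` A)" if "0 < t" "t < 1" for t
    using that sets_Pair1[OF A'] by (intro push_forward_bound) auto
  have "emeasure flow_measure A = emeasure (unit_time \<Otimes>\<^sub>M P) (flow -` A)"
    unfolding flow_measure_def
    by (subst emeasure_distr) (auto simp: measurable_TP space_pair_measure)
  also have "\<dots> = (\<integral>\<^sup>+t. emeasure P (Pair t -` flow -` A) \<partial>unit_time)"
    using fA by (rule P.emeasure_pair_measure_alt)
  also have "\<dots> = (\<integral>\<^sup>+t. ennreal (indicator {0<..<1} t) * emeasure P (Pair t -` flow -` A) \<partial>lborel)"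
  proof (rule nn_integral_density)
    have "(\<lambda>t. emeasure P (Pair t -` flow -` A)) \<in> borel_measurable unit_time"
      using fA by (rule P.measurable_emeasure_Pair)
    then show "(\<lambda>t. emeasure P (Pair t -` flow -` A)) \<in> borel_measurable lborel" by simp
  qed auto
  also have "\<dots> \<le> (\<integral>\<^sup>+t. ennreal density_const * emeasure lborel (Pair t -` A) \<partial>lborel)"
  proof (rule nn_integral_mono)
    fix t :: real
    have "Pair t -` flow -` A = X t -` (Pair t -` A)" by (auto simp: flow_def)
    then show "ennreal (indicator {0<..<1} t) * emeasure P (Pair t -` flow -` A)
        \<le> ennreal density_const * emeasure lborel (Pair t -` A)"
      using Pm[of t] by (auto split: split_indicator)
  qed
  also have "\<dots> = ennreal density_const * (\<integral>\<^sup>+t. emeasure lborel (Pair t -` A) \<partial>lborel)"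
    using A' by (intro nn_integral_cmult lborel.measurable_emeasure_Pair)
      (simp add: sets_pair_measure_cong[OF sets_lborel sets_lborel])
  also have "(\<integral>\<^sup>+t. emeasure lborel (Pair t -` A) \<partial>lborel) = emeasure (lborel \<Otimes>\<^sub>M lborel) A"
    using A' by (intro lborel.emeasure_pair_measure_alt[symmetric])
      (simp add: sets_pair_measure_cong[OF sets_lborel sets_lborel])
  finally show ?thesis by (simp add: lborel_prod)
qed

text \<open>Almost all mass sits on the rays, so the density may be set to \<open>0\<close> elsewhere. Products of the density
  with the velocity field are then Borel, although the field itself is only controlled on the rays.\<close>
lemma flow_density_exists:
  obtains l where "l \<in> borel_measurable borel" "\<And>z. 0 \<le> l z" "\<And>z. l z \<le> density_const"
    "\<And>z. z \<notin> rays \<Longrightarrow> l z = 0" "flow_measure = density lborel (\<lambda>z. ennreal (l z))"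
proof -
  obtain k where k[measurable]: "k \<in> borel_measurable lborel" and k2: "\<And>z. 0 \<le> k z" "\<And>z. k z \<le> density_const"
      "flow_measure = density lborel (\<lambda>z. ennreal (k z))"
  proof (rule sigma_finite_measure.bounded_density[OF sigma_finite_lborel])
    show "sets flow_measure = sets lborel" by (simp add: flow_measure_def)
  qed (use flow_measure_bound density_const_nonneg in auto)
  have ae: "AE z in flow_measure. z \<in> rays"
    unfolding flow_measure_def using AE_flow
    by (subst AE_distr_iff) (auto simp: measurable_TP elim!: eventually_mono)
  have "flow_measure = density flow_measure (\<lambda>z. 1)" by (simp add: density_1)
  also have "\<dots> = density flow_measure (\<lambda>z. ennreal (indicator rays z))"
  proof (rule density_cong)
    show "AE z in flow_measure. 1 = ennreal (indicator rays z)"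
      using ae by eventually_elim simp
  qed (auto simp: flow_measure_def)
  also have "\<dots> = density lborel (\<lambda>z. ennreal (k z) * ennreal (indicator rays z))"
    unfolding k2(3) by (rule density_density_eq) auto
  also have "\<dots> = density lborel (\<lambda>z. ennreal (k z * indicator rays z))"
    by (simp add: ennreal_mult k2)
  finally have "flow_measure = density lborel (\<lambda>z. ennreal (k z * indicator rays z))" .
  then show ?thesis
    using k2 density_const_nonneg k
    by (intro that[of "\<lambda>z. k z * indicator rays z"]) (auto split: split_indicator)
qed

end


section \<open>The weak solution carried by the rays\<close>

lemma C1_test_continuous:
  fixes \<psi> :: "real \<Rightarrow> 'a::euclidean_space \<Rightarrow> real"
  assumes "C1_test \<psi> \<psi>t \<psi>x" "t \<in> {0..1}"
  shows "continuous_on UNIV (\<psi> t)"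
proof -
  have der: "((\<lambda>(s, y). \<psi> s y) has_derivative (\<lambda>(s, y). s * \<psi>t t x + y \<bullet> \<psi>x t x)) (at (t, x) within {0..1} \<times> UNIV)"
    if "t \<in> {0..1}" for t x
    using assms that unfolding C1_test_def by blast
  have c: "continuous_on ({0..1} \<times> UNIV) (\<lambda>(t, x). \<psi> t x)"
    unfolding continuous_on_eq_continuous_within using der has_derivative_continuous by fastforce
  have "continuous_on UNIV (\<lambda>x. (\<lambda>(t, x). \<psi> t x) (t, x))"
    by (rule continuous_on_compose2[OF c]) (use assms(2) in \<open>auto intro!: continuous_intros\<close>)
  then show ?thesis by simp
qed

locale flow_with_density = characteristic_flow p q C L \<rho>0 \<rho>1 v M K0 r
  for p q C L :: real and \<rho>0 \<rho>1 v :: "'a::euclidean_space \<Rightarrow> real" and M :: "'a \<Rightarrow> 'a" and K0 r :: real +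
  fixes l :: "real \<times> 'a \<Rightarrow> real"
  assumes l_measurable[measurable]: "l \<in> borel_measurable borel"
    and l_nonneg: "\<And>z. 0 \<le> l z" and l_le: "\<And>z. l z \<le> density_const"
    and l_off_rays: "\<And>z. z \<notin> rays \<Longrightarrow> l z = 0"
    and flow_measure_eq: "flow_measure = density lborel (\<lambda>z. ennreal (l z))"
begin

interpretation T: finite_measure unit_time by (rule finite_measure_unit_time)
interpretation P: finite_measure P by (rule finite_measure_prob_density[OF \<rho>0])
interpretation TP: pair_sigma_finite unit_time P ..

abbreviation slab :: "(real \<times> 'a) set" where "slab \<equiv> {0<..<1} \<times> UNIV"

definition lam :: "real \<Rightarrow> 'a \<Rightarrow> real" where
  "lam t x = (if t = 1 then \<rho>1 x else l (t, x))"

lemma slab_sets[measurable]: "slab \<in> sets borel"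
  by (intro borel_open open_Times) auto

lemma l_off_slab: "z \<notin> slab \<Longrightarrow> l z = 0"
  by (rule l_off_rays) (auto simp: rays_def)

lemma lam_slab: "indicator slab z * (lam (fst z) (snd z) * c) = l z * c"
  using l_off_slab[of z] by (auto simp: lam_def split: split_indicator)

lemma integral_transfer:
  fixes f :: "real \<times> 'a \<Rightarrow> real"
  assumes f[measurable]: "f \<in> borel_measurable borel" and bd: "AE z in unit_time \<Otimes>\<^sub>M P. norm (f (flow z)) \<le> B"
  shows "integrable lborel (\<lambda>z. l z * f z)"
    and "integrable (unit_time \<Otimes>\<^sub>M P) (\<lambda>z. f (flow z))"
    and "(LINT z|lborel. l z * f z) = (LINT z|(unit_time \<Otimes>\<^sub>M P). f (flow z))"
proof -
  interpret fin: finite_measure "unit_time \<Otimes>\<^sub>M P" by (rule finite_measure_TP)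
  show i: "integrable (unit_time \<Otimes>\<^sub>M P) (\<lambda>z. f (flow z))"
    using bd by (rule fin.integrable_const_bound) (unfold measurable_TP, measurable)
  have "integrable flow_measure f"
    unfolding flow_measure_def using i by (subst integrable_distr_eq) (auto simp: measurable_TP)
  then show "integrable lborel (\<lambda>z. l z * f z)"
    unfolding flow_measure_eq by (subst (asm) integrable_density) (auto simp: l_nonneg)
  have "(LINT z|lborel. l z * f z) = (LINT z|flow_measure. f z)"
    unfolding flow_measure_eq by (subst integral_density) (auto simp: l_nonneg)
  also have "\<dots> = (LINT z|(unit_time \<Otimes>\<^sub>M P). f (flow z))"
    unfolding flow_measure_def by (subst integral_distr) (auto simp: measurable_TP)
  finally show "(LINT z|lborel. l z * f z) = (LINT z|(unit_time \<Otimes>\<^sub>M P). f (flow z))" .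
qed

lemma integral_along_rays:
  fixes f :: "real \<times> 'a \<Rightarrow> real"
  assumes f[measurable]: "f \<in> borel_measurable borel" and bd: "AE z in unit_time \<Otimes>\<^sub>M P. norm (f (flow z)) \<le> B"
  shows "(LINT z|lborel. l z * f z) = (LINT x|P. LINT t|lborel. indicator {0<..<1} t * f (t, X t x))"
proof -
  have i: "integrable (unit_time \<Otimes>\<^sub>M P) (case_prod (\<lambda>t x. f (flow (t, x))))"
    using integral_transfer(2)[OF f bd] by (simp add: case_prod_unfold)
  have "(LINT z|lborel. l z * f z) = (LINT x|P. LINT t|unit_time. f (flow (t, x)))"
    using TP.integral_snd[OF i] integral_transfer(3)[OF f bd] by (simp add: case_prod_unfold)
  also have "\<dots> = (LINT x|P. LINT t|lborel. indicator {0<..<1} t * f (t, X t x))"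
  proof (rule Bochner_Integration.integral_cong[OF refl])
    fix x
    have [measurable]: "(\<lambda>t. f (flow (t, x))) \<in> borel_measurable borel"
      by measurable
    show "(LINT t|unit_time. f (flow (t, x))) = (LINT t|lborel. indicator {0<..<1} t * f (t, X t x))"
      using \<open>(\<lambda>t. f (flow (t, x))) \<in> borel_measurable borel\<close>
      by (subst integral_density) (auto simp: flow_def)
  qed
  finally show ?thesis .
qed

lemma R_nonneg: "0 \<le> R"
  by (simp add: R_def)

lemma velocity_bound: "norm (indicator rays z *\<^sub>R V (fst z) (snd z)) \<le> R"
  using V_rays_norm_le[of "fst z" "snd z"] R_nonneg by (auto split: split_indicator)

lemma continuity_equation_lam: "continuity_equation lam V \<rho>0 \<rho>1"
  unfolding continuity_equation_def
proof (intro allI impI)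
  fix \<psi> \<psi>t :: "real \<Rightarrow> 'a \<Rightarrow> real" and \<psi>x assume \<psi>: "C1_test \<psi> \<psi>t \<psi>x"
  obtain B where B: "\<And>t x. t \<in> {0..1} \<Longrightarrow> \<bar>\<psi> t x\<bar> \<le> B" "\<And>t x. t \<in> {0..1} \<Longrightarrow> \<bar>\<psi>t t x\<bar> \<le> B"
      "\<And>t x. t \<in> {0..1} \<Longrightarrow> norm (\<psi>x t x) \<le> B"
    by (rule C1_test_bounded[OF \<psi>]) blast
  have B0: "0 \<le> B" using B(1)[of 0 0] by simp
  have cont: "continuous_on slab (\<lambda>z. \<psi>t (fst z) (snd z))" "continuous_on slab (\<lambda>z. \<psi>x (fst z) (snd z))"
    using \<psi> unfolding C1_test_def case_prod_unfold by (auto elim!: continuous_on_subset)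
  define f where "f z = indicator slab z *\<^sub>R \<psi>t (fst z) (snd z)
      + (indicator rays z *\<^sub>R V (fst z) (snd z)) \<bullet> (indicator slab z *\<^sub>R \<psi>x (fst z) (snd z))" for z
  have f: "f \<in> borel_measurable borel"
    unfolding f_def
    by (intro borel_measurable_add borel_measurable_inner V_measurable
        borel_measurable_continuous_on_indicator cont slab_sets)
  have bd: "norm (f z) \<le> B + R * B" for z
  proof -
    have 1: "norm (indicator slab z *\<^sub>R \<psi>t (fst z) (snd z)) \<le> B"
      using B(2)[of "fst z" "snd z"] B0 by (auto split: split_indicator)
    have 2: "norm (indicator slab z *\<^sub>R \<psi>x (fst z) (snd z)) \<le> B"
      using B(3)[of "fst z" "snd z"] B0 by (auto split: split_indicator)
    have "norm ((indicator rays z *\<^sub>R V (fst z) (snd z)) \<bullet> (indicator slab z *\<^sub>R \<psi>x (fst z) (snd z))) \<le> R * B"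
      using R_nonneg by (intro order_trans[OF Cauchy_Schwarz_ineq2[folded real_norm_def] mult_mono] velocity_bound 2) auto
    then show ?thesis
      unfolding f_def by (intro order_trans[OF norm_triangle_ineq add_mono] 1)
  qed
  have eq: "indicator slab z *\<^sub>R (case z of (t, x) \<Rightarrow> lam t x * \<psi>t t x + (lam t x *\<^sub>R V t x) \<bullet> \<psi>x t x) = l z * f z" for z
  proof (cases "z \<in> slab")
    case True
    then have "lam (fst z) (snd z) = l z" by (auto simp: lam_def)
    then show ?thesis
      using True l_off_rays[of z] by (cases "z \<in> rays") (auto simp: f_def case_prod_unfold algebra_simps)
  qed (simp add: l_off_slab)
  have int: "integrable lborel (\<lambda>z. l z * f z)"
    by (rule integral_transfer(1)[OF f AE_I2[OF bd]])
  have c0: "continuous_on UNIV (\<psi> 0)" "continuous_on UNIV (\<psi> 1)"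
    by (rule C1_test_continuous[OF \<psi>], simp)+
  then have [measurable]: "\<psi> 0 \<in> borel_measurable borel" "\<psi> 1 \<in> borel_measurable borel"
    by (auto intro: borel_measurable_continuous_onI)
  have ray: "(LINT t|lborel. indicator {0<..<1} t * f (t, X t x)) = \<psi> 1 (M x) - \<psi> 0 x" if x: "x \<in> good" for x
  proof -
    have "(LINT t|lborel. indicator {0<..<1} t * f (t, X t x))
        = (LINT t|lborel. indicator {0<..<1} t * (\<psi>t t (x + t *\<^sub>R (M x - x)) + (M x - x) \<bullet> \<psi>x t (x + t *\<^sub>R (M x - x))))"
    proof (rule Bochner_Integration.integral_cong[OF refl])
      fix t
      show "indicator {0<..<1} t * f (t, X t x)
        = indicator {0<..<1} t * (\<psi>t t (x + t *\<^sub>R (M x - x)) + (M x - x) \<bullet> \<psi>x t (x + t *\<^sub>R (M x - x)))"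
      proof (cases "t \<in> {0<..<1}")
        case True
        then show ?thesis
          using X_in_rays[OF x, of t] V_along_X[OF x, of t] unfolding f_def by (simp add: X_def[symmetric])
      qed simp
    qed
    also have "\<dots> = \<psi> 1 (x + (M x - x)) - \<psi> 0 x"
      by (rule C1_test_along_ray[OF \<psi>])
    finally show ?thesis by simp
  qed
  have i1: "integrable P (\<lambda>x. \<psi> 1 (M x))" "integrable P (\<lambda>x. \<psi> 0 x)"
    using B(1)[of 1] B(1)[of 0] by (auto intro!: P.integrable_const_bound[where B = B])
  interpret Q: finite_measure "law \<rho>1"
    by (rule finite_measure_prob_density[OF \<rho>1])
  have i2: "integrable lborel (\<lambda>x. \<rho>1 x * \<psi> 1 x)" "integrable lborel (\<lambda>x. \<rho>0 x * \<psi> 0 x)"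
  proof -
    have "integrable (law \<rho>1) (\<psi> 1)"
      using B(1)[of 1] by (auto intro!: Q.integrable_const_bound[where B = B])
    then show "integrable lborel (\<lambda>x. \<rho>1 x * \<psi> 1 x)"
      by (subst (asm) integrable_density) (auto simp: prob_density_nonneg[OF \<rho>1])
    show "integrable lborel (\<lambda>x. \<rho>0 x * \<psi> 0 x)"
      using i1(2) by (subst (asm) integrable_density) (auto simp: prob_density_nonneg[OF \<rho>0])
  qed
  have "(LINT z|lborel. l z * f z) = (LINT x|P. LINT t|lborel. indicator {0<..<1} t * f (t, X t x))"
    by (rule integral_along_rays[OF f AE_I2[OF bd]])
  also have "\<dots> = (LINT x|P. \<psi> 1 (M x) - \<psi> 0 x)"
  proof (rule integral_cong_AE)
    show "AE x in P. (LINT t|lborel. indicator {0<..<1} t * f (t, X t x)) = \<psi> 1 (M x) - \<psi> 0 x"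
      using AE_good by eventually_elim (rule ray)
    have [measurable]: "f \<in> borel_measurable (borel \<Otimes>\<^sub>M borel)" using f by (subst borel_prod)
    show "(\<lambda>x. LINT t|lborel. indicator {0<..<1} t * f (t, X t x)) \<in> borel_measurable P"
      unfolding X_def by measurable
  qed measurable
  also have "\<dots> = (LINT x|P. \<psi> 1 (M x)) - (LINT x|P. \<psi> 0 x)"
    by (rule Bochner_Integration.integral_diff[OF i1])
  also have "(LINT x|P. \<psi> 1 (M x)) = (LINT y|distr P borel M. \<psi> 1 y)"
    by (subst integral_distr) auto
  also have "\<dots> = (LINT x|lborel. \<rho>1 x * \<psi> 1 x)"
    unfolding distr_M by (subst integral_density) (auto simp: prob_density_nonneg[OF \<rho>1])
  also have "(LINT x|P. \<psi> 0 x) = (LINT x|lborel. \<rho>0 x * \<psi> 0 x)"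
    by (subst integral_density) (auto simp: prob_density_nonneg[OF \<rho>0])
  also have "(LINT x|lborel. \<rho>1 x * \<psi> 1 x) - (LINT x|lborel. \<rho>0 x * \<psi> 0 x)
      = (LINT x|lborel. \<rho>1 x * \<psi> 1 x - \<rho>0 x * \<psi> 0 x)"
    by (rule Bochner_Integration.integral_diff[OF i2, symmetric])
  finally have val: "(LINT z|lborel. l z * f z) = (LINT x|lborel. \<rho>1 x * \<psi> 1 x - \<rho>0 x * \<psi> 0 x)" .
  show "set_integrable lborel slab (\<lambda>(t, x). lam t x * \<psi>t t x + (lam t x *\<^sub>R V t x) \<bullet> \<psi>x t x) \<and>
      (LINT (t, x):slab|lborel. lam t x * \<psi>t t x + (lam t x *\<^sub>R V t x) \<bullet> \<psi>x t x)
        = (LINT x|lborel. \<rho>1 x * \<psi> 1 x - \<rho>0 x * \<psi> 0 x)"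
    unfolding set_integrable_def set_lebesgue_integral_def eq using int val by simp
qed

text \<open>The time marginal of \<open>flow_measure\<close> is uniform, which fixes the mass of almost every time slice.\<close>
lemma AE_mass: "AE t in lborel. (\<integral>\<^sup>+x. ennreal (l (t, x)) \<partial>lborel) = ennreal (indicator {0<..<1} t)"
proof -
  have lm[measurable]: "l \<in> borel_measurable (lborel \<Otimes>\<^sub>M lborel)" by (simp add: lborel_prod)
  let ?h = "\<lambda>t. \<integral>\<^sup>+x. ennreal (l (t, x)) \<partial>lborel"
  have h[measurable]: "?h \<in> borel_measurable lborel" by measurable
  have "density lborel ?h = unit_time"
  proof (rule measure_eqI)
    fix A assume "A \<in> sets (density lborel ?h)"
    then have A[measurable]: "A \<in> sets borel" by simp
    have AU: "A \<times> (UNIV :: 'a set) \<in> sets borel"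
      by (subst borel_prod[symmetric]) (intro pair_measureI, auto)
    have "emeasure (density lborel ?h) A = (\<integral>\<^sup>+t. ?h t * indicator A t \<partial>lborel)"
      by (rule emeasure_density) auto
    also have "\<dots> = (\<integral>\<^sup>+t. \<integral>\<^sup>+x. ennreal (l (t, x)) * indicator (A \<times> UNIV) (t, x) \<partial>lborel \<partial>lborel)"
      by (subst nn_integral_multc[symmetric]) (auto intro!: nn_integral_cong split: split_indicator)
    also have "\<dots> = (\<integral>\<^sup>+z. ennreal (l z) * indicator (A \<times> UNIV) z \<partial>(lborel \<Otimes>\<^sub>M lborel))"
      by (rule lborel.nn_integral_fst) measurable
    also have "\<dots> = emeasure flow_measure (A \<times> UNIV)"
      unfolding flow_measure_eq lborel_prod using AU by (subst emeasure_density) auto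
    also have "\<dots> = emeasure (unit_time \<Otimes>\<^sub>M P) (flow -` (A \<times> UNIV))"
      unfolding flow_measure_def using AU
      by (subst emeasure_distr) (auto simp: measurable_TP space_pair_measure)
    also have "flow -` (A \<times> UNIV) = A \<times> UNIV" by (auto simp: flow_def)
    also have "emeasure (unit_time \<Otimes>\<^sub>M P) (A \<times> UNIV) = emeasure unit_time A * emeasure P UNIV"
      by (rule P.emeasure_pair_measure_Times) auto
    also have "\<dots> = emeasure unit_time A"
      by (simp add: emeasure_prob_density_UNIV[OF \<rho>0])
    finally show "emeasure (density lborel ?h) A = emeasure unit_time A" .
  qed simp
  then show ?thesis
    by (subst (asm) sigma_finite_measure.density_unique_iff[OF sigma_finite_lborel]) auto
qed

lemma Linf_L1_Linf_lam: "Linf_L1_Linf lam"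
  unfolding Linf_L1_Linf_def
proof (intro conjI exI)
  have "(\<lambda>z. indicator slab z *\<^sub>R (case z of (t, x) \<Rightarrow> lam t x)) = l"
    using lam_slab[of _ 1] by (auto simp: fun_eq_iff case_prod_unfold)
  then show "set_borel_measurable lborel slab (\<lambda>(t, x). lam t x)"
    unfolding set_borel_measurable_def using l_measurable by simp
  show "AE t in lborel. t \<in> {0<..<1} \<longrightarrow> integrable lborel (lam t) \<and>
      (LINT x|lborel. \<bar>lam t x\<bar>) \<le> max 1 density_const \<and> (AE x in lborel. \<bar>lam t x\<bar> \<le> max 1 density_const)"
    using AE_mass
  proof (eventually_elim, intro impI)
    fix t :: real assume nn: "(\<integral>\<^sup>+x. ennreal (l (t, x)) \<partial>lborel) = ennreal (indicator {0<..<1} t)"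
      and t: "t \<in> {0<..<1}"
    have lam: "lam t = (\<lambda>x. l (t, x))" using t by (auto simp: lam_def)
    have m: "(\<lambda>x. l (t, x)) \<in> borel_measurable lborel" by measurable
    have 1: "has_bochner_integral lborel (\<lambda>x. l (t, x)) 1"
      using nn t by (intro has_bochner_integral_nn_integral m) (auto simp: l_nonneg)
    have "\<bar>l (t, x)\<bar> = l (t, x)" for x using l_nonneg by simp
    then show "integrable lborel (lam t) \<and> (LINT x|lborel. \<bar>lam t x\<bar>) \<le> max 1 density_const \<and>
        (AE x in lborel. \<bar>lam t x\<bar> \<le> max 1 density_const)"
      unfolding lam using 1 l_le by (auto simp: has_bochner_integral_iff le_max_iff_disj)
  qed
qed

lemma weak_solution_lam: "weak_solution lam V \<rho>0"
proof -
  have "lam 1 = \<rho>1" by (simp add: lam_def fun_eq_iff)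
  then show ?thesis
    unfolding weak_solution_def using Linf_L1_Linf_lam L2_\<rho>1 continuity_equation_lam by simp
qed

text \<open>Along each ray the speed is constant, so the kinetic energy of a mass element equals its
  transport cost.\<close>
lemma kinetic_energy_lam:
  shows "integrable lborel (\<lambda>z. l z * cost p (V (fst z) (snd z)))"
    and "(LINT z|lborel. l z * cost p (V (fst z) (snd z))) = (LINT x|P. cost p (M x - x))"
proof -
  define f where "f z = cost p (indicator rays z *\<^sub>R V (fst z) (snd z))" for z
  have f[measurable]: "f \<in> borel_measurable borel"
    unfolding f_def by (rule measurable_compose[OF V_measurable]) measurable
  have bd: "norm (f z) \<le> R powr p / p" for z
    using p velocity_bound[of z] unfolding f_def cost_def
    by (auto intro!: divide_right_mono powr_mono2 simp del: norm_scaleR)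
  have eq: "l z * cost p (V (fst z) (snd z)) = l z * f z" for z
    using l_off_rays[of z] by (cases "z \<in> rays") (auto simp: f_def)
  show "integrable lborel (\<lambda>z. l z * cost p (V (fst z) (snd z)))"
    unfolding eq by (rule integral_transfer(1)[OF f AE_I2[OF bd]])
  have "(LINT z|lborel. l z * f z) = (LINT x|P. LINT t|lborel. indicator {0<..<1} t * f (t, X t x))"
    by (rule integral_along_rays[OF f AE_I2[OF bd]])
  also have "\<dots> = (LINT x|P. cost p (M x - x))"
  proof (rule integral_cong_AE)
    have "(LINT t|lborel. indicator {0<..<1} t * f (t, X t x)) = cost p (M x - x)" if x: "x \<in> good" for x
    proof -
      have "(LINT t|lborel. indicator {0<..<1} t * f (t, X t x))
          = (LINT t|lborel. indicator {0<..<1::real} t * cost p (M x - x))"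
      proof (rule Bochner_Integration.integral_cong[OF refl])
        fix t
        show "indicator {0<..<1} t * f (t, X t x) = indicator {0<..<1} t * cost p (M x - x)"
          using X_in_rays[OF x, of t] V_along_X[OF x, of t] unfolding f_def by (auto split: split_indicator)
      qed
      then show ?thesis by simp
    qed
    with AE_good show "AE x in P. (LINT t|lborel. indicator {0<..<1} t * f (t, X t x)) = cost p (M x - x)"
      by (auto elim!: eventually_mono)
    have [measurable]: "f \<in> borel_measurable (borel \<Otimes>\<^sub>M borel)" using f by (subst borel_prod)
    show "(\<lambda>x. LINT t|lborel. indicator {0<..<1} t * f (t, X t x)) \<in> borel_measurable P"
      unfolding X_def by measurable
  qed measurable
  finally show "(LINT z|lborel. l z * cost p (V (fst z) (snd z))) = (LINT x|P. cost p (M x - x))"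
    unfolding eq .
qed

end


section \<open>Lower bound for the action of an admissible pair\<close>

text \<open>Jensen's inequality along a curve, from the tangent inequality of the cost at the mean
  velocity. The velocity is only known to be a derivative, so the linear term is integrated in the sense
  of Henstock and Kurzweil.\<close>
lemma cost_displacement_le_action:
  fixes X :: "real \<Rightarrow> 'a::euclidean_space"
  assumes p: "1 < p"
    and der: "\<And>t. t \<in> {0..1} \<Longrightarrow> (X has_vector_derivative W t) (at t within {0..1})"
    and meas: "(\<lambda>t. indicator {0<..<1} t * cost p (W t)) \<in> borel_measurable borel"
  shows "ennreal (cost p (X 1 - X 0)) \<le> (\<integral>\<^sup>+t. ennreal (indicator {0<..<1} t * cost p (W t)) \<partial>lborel)"
proof (cases "(\<integral>\<^sup>+t. ennreal (indicator {0<..<1} t * cost p (W t)) \<partial>lborel) < \<infinity>")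
  case True
  let ?a = "X 1 - X 0" and ?g = "\<lambda>t. indicator {0<..<1::real} t * cost p (W t)"
  have nn: "0 \<le> ?g t" for t by (simp add: cost_nonneg[OF p])
  obtain c where c: "0 \<le> c" "(\<integral>\<^sup>+t. ennreal (?g t) \<partial>lborel) = ennreal c"
    using True by (metis ennreal_cases infinity_ennreal_def less_irrefl)
  have "has_bochner_integral lborel ?g c"
    using meas c nn by (intro has_bochner_integral_nn_integral) auto
  then have "(?g has_integral c) UNIV"
    using has_integral_integral_lborel[of ?g] by (simp add: has_bochner_integral_iff)
  moreover have "?g = (\<lambda>t. if t \<in> {0<..<1} then cost p (W t) else 0)"
    by (auto simp: fun_eq_iff)
  ultimately have "((\<lambda>t. cost p (W t)) has_integral c) {0<..<1}"
    by (simp only: has_integral_restrict_UNIV)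
  then have 1: "((\<lambda>t. cost p (W t)) has_integral c) {0..1}"
    using has_integral_open_interval[of "\<lambda>t. cost p (W t)" c 0 1] by simp
  have "(W has_integral ?a) {0..1}"
    using der by (intro fundamental_theorem_of_calculus) auto
  from has_integral_diff[OF this has_integral_const_real[of ?a 0 1]]
  have "((\<lambda>t. W t - ?a) has_integral (?a - ?a)) {0..1}"
    by simp
  from has_integral_linear[OF this bounded_linear_inner_right[of "flux p ?a"]]
  have "((\<lambda>t. flux p ?a \<bullet> (W t - ?a)) has_integral (flux p ?a \<bullet> (?a - ?a))) {0..1}"
    by (simp only: o_def)
  then have "((\<lambda>t. cost p ?a + flux p ?a \<bullet> (W t - ?a)) has_integral (cost p ?a + 0)) {0..1}"
    using has_integral_const_real[of "cost p ?a" 0 1] by (intro has_integral_add) auto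
  then have "cost p ?a + 0 \<le> c"
    by (rule has_integral_le[OF _ 1]) (rule cost_tangent[OF p])
  then show ?thesis using c by (simp add: ennreal_leI)
qed (simp add: not_less top_unique)

text \<open>Rounding the time down to a grid gives jointly measurable functions that are piecewise constant in
  time; they converge by continuity.\<close>
lemma curves_jointly_measurable:
  fixes X :: "real \<Rightarrow> 'a::euclidean_space \<Rightarrow> 'a"
  assumes cont: "\<And>x. continuous_on {0..1} (\<lambda>t. X t x)"
    and meas: "\<And>t. t \<in> {0..1} \<Longrightarrow> X t \<in> borel_measurable borel"
  shows "(\<lambda>z. indicator ({0<..<1} \<times> UNIV) z *\<^sub>R X (fst z) (snd z)) \<in> borel_measurable borel"
proof -
  let ?f = "\<lambda>n t. real_of_int \<lfloor>real (Suc n) * t\<rfloor> / real (Suc n)"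
  define d where "d n t = max 0 (min 1 (real_of_int \<lfloor>real (Suc n) * t\<rfloor> / real (Suc n)))" for n t
  define Y where "Y n z = indicator ({0<..<1} \<times> UNIV) z *\<^sub>R X (d n (fst z)) (snd z)" for n and z :: "real \<times> 'a"
  have slab: "{0<..<1::real} \<times> (UNIV :: 'a set) \<in> sets borel"
    by (intro borel_open open_Times) auto
  have Y: "Y n \<in> borel_measurable borel" for n
  proof -
    have 1: "(\<lambda>z. X (max 0 (min 1 (real_of_int i / real (Suc n)))) (snd z)) \<in> borel_measurable (borel :: (real \<times> 'a) measure)" for i :: int
      by (rule measurable_compose[OF borel_measurable_continuous_onI[OF continuous_on_snd[OF continuous_on_id]] meas]) auto
    have 2: "(\<lambda>z. \<lfloor>real (Suc n) * fst z\<rfloor>) \<in> measurable (borel :: (real \<times> 'a) measure) (count_space UNIV)"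
    proof -
      have "(\<lambda>z. real (Suc n) * fst z) \<in> borel_measurable (borel :: (real \<times> 'a) measure)"
        by (intro borel_measurable_continuous_onI continuous_intros)
      then show ?thesis by measurable
    qed
    have "(\<lambda>z. X (d n (fst z)) (snd z)) \<in> borel_measurable (borel :: (real \<times> 'a) measure)"
      unfolding d_def by (rule measurable_compose_countable[OF 1 2])
    then show ?thesis
      unfolding Y_def using slab by (intro borel_measurable_scaleR borel_measurable_indicator)
  qed
  show ?thesis
  proof (rule borel_measurable_LIMSEQ_metric[OF Y])
    fix z :: "real \<times> 'a"
    show "(\<lambda>n. Y n z) \<longlonglongrightarrow> indicator ({0<..<1} \<times> UNIV) z *\<^sub>R X (fst z) (snd z)"
    proof (cases "z \<in> {0<..<1} \<times> UNIV")
      case True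
      then have t: "0 < fst z" "fst z < 1" by auto
      have "(\<lambda>n. ?f n (fst z)) \<longlonglongrightarrow> fst z"
      proof (rule tendsto_sandwich[where f = "\<lambda>n. fst z - inverse (real (Suc n))" and h = "\<lambda>n. fst z"])
        show "(\<lambda>n. fst z - inverse (real (Suc n))) \<longlonglongrightarrow> fst z"
          using tendsto_diff[OF tendsto_const LIMSEQ_inverse_real_of_nat, of "fst z"] by simp
        show "\<forall>\<^sub>F n in sequentially. fst z - inverse (real (Suc n)) \<le> ?f n (fst z)"
        proof (rule always_eventually, rule allI)
          fix n
          have "real (Suc n) * fst z - 1 \<le> real_of_int \<lfloor>real (Suc n) * fst z\<rfloor>" by linarith
          then have "(real (Suc n) * fst z - 1) / real (Suc n) \<le> ?f n (fst z)"
            by (intro divide_right_mono) auto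
          moreover have "(real (Suc n) * fst z - 1) / real (Suc n) = fst z - inverse (real (Suc n))"
            by (simp add: field_simps del: of_nat_Suc)
          ultimately show "fst z - inverse (real (Suc n)) \<le> ?f n (fst z)"
            by simp
        qed
        show "\<forall>\<^sub>F n in sequentially. ?f n (fst z) \<le> fst z"
        proof (rule always_eventually, rule allI)
          fix n
          have "real_of_int \<lfloor>real (Suc n) * fst z\<rfloor> \<le> real (Suc n) * fst z" by linarith
          then have "?f n (fst z) \<le> real (Suc n) * fst z / real (Suc n)"
            by (intro divide_right_mono) auto
          then show "?f n (fst z) \<le> fst z"
            by (simp del: of_nat_Suc)
        qed
      qed simp
      then have "(\<lambda>n. d n (fst z)) \<longlonglongrightarrow> max 0 (min 1 (fst z))"
        unfolding d_def by (intro tendsto_intros)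
      then have "(\<lambda>n. d n (fst z)) \<longlonglongrightarrow> fst z" using t by simp
      moreover have "d n (fst z) \<in> {0..1}" for n by (auto simp: d_def)
      ultimately have "(\<lambda>n. X (d n (fst z)) (snd z)) \<longlonglongrightarrow> X (fst z) (snd z)"
        using t by (intro continuous_on_tendsto_compose[OF cont]) auto
      then show ?thesis using True by (simp add: Y_def)
    qed (simp add: Y_def)
  qed
qed

lemma set_borel_measurable_subset_borel:
  fixes f :: "'a::euclidean_space \<Rightarrow> 'b::euclidean_space"
  assumes f: "set_borel_measurable lborel A f" and B: "B \<in> sets borel" "B \<subseteq> A"
  shows "(\<lambda>z. indicator B z *\<^sub>R f z) \<in> borel_measurable borel"
proof -
  have "(\<lambda>z. indicator B z *\<^sub>R (indicator A z *\<^sub>R f z)) \<in> borel_measurable borel"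
  proof (rule borel_measurable_scaleR)
    show "(\<lambda>z. indicator A z *\<^sub>R f z) \<in> borel_measurable borel"
      using f unfolding set_borel_measurable_def by simp
  qed (use B(1) in \<open>rule borel_measurable_indicator\<close>)
  moreover have "(\<lambda>z. indicator B z *\<^sub>R (indicator A z *\<^sub>R f z)) = (\<lambda>z. indicator B z *\<^sub>R f z)"
    using B(2) by (auto simp: fun_eq_iff split: split_indicator)
  ultimately show ?thesis by simp
qed

lemma kantorovich_distance_le_action:
  fixes \<rho>0 \<rho>1 :: "'a::euclidean_space \<Rightarrow> real"
  assumes p: "1 < p" and \<rho>0: "prob_density \<rho>0" and \<rho>1: "prob_density \<rho>1"
    and adm: "admissible_pair \<rho>0 \<rho>1 \<rho> V"
  shows "kantorovich_distance p \<rho>0 \<rho>1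
    \<le> (\<integral>\<^sup>+(t, x)\<in>{0<..<1} \<times> UNIV. ennreal (\<rho> t x * cost p (V t x)) \<partial>lborel)"
proof -
  let ?P = "law \<rho>0"
  let ?slab = "{0<..<1::real} \<times> (UNIV :: 'a set)"
  note [measurable] = prob_density_measurable[OF \<rho>0] prob_density_measurable[OF \<rho>1]
  obtain X where lag: "Lagrange_coordinate V X"
    and Xm: "\<And>t. t \<in> {0..1} \<Longrightarrow> X t \<in> borel_measurable borel"
    and push: "\<And>t. t \<in> {0..1} \<Longrightarrow> distr ?P lborel (X t) = density lborel (\<lambda>x. ennreal (\<rho> t x))"
    using adm unfolding admissible_pair_def by blast
  have \<rho>_nonneg: "\<And>t x. t \<in> {0..1} \<Longrightarrow> 0 \<le> \<rho> t x" and \<rho>_1: "AE x in lborel. \<rho> 1 x = \<rho>1 x"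
    using adm unfolding admissible_pair_def by blast+
  have \<rho>_meas: "set_borel_measurable lborel ({0..1} \<times> UNIV) (\<lambda>(t, x). \<rho> t x)"
    and V_meas: "set_borel_measurable lborel ({0..1} \<times> UNIV) (\<lambda>(t, x). V t x)"
    using adm unfolding admissible_pair_def by blast+
  have slab: "?slab \<in> sets borel" by (intro borel_open open_Times) auto
  have slab_sub: "?slab \<subseteq> {0..1} \<times> UNIV" by auto
  have X0: "X 0 x = x" and der: "t \<in> {0..1} \<Longrightarrow> ((\<lambda>s. X s x) has_vector_derivative V t (X t x)) (at t within {0..1})" for x t
    using lag unfolding Lagrange_coordinate_def by blast+
  have cont: "continuous_on {0..1} (\<lambda>t. X t x)" for x
    unfolding continuous_on_eq_continuous_within using der has_vector_derivative_continuous by blast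
  define XX where "XX z = indicator ?slab z *\<^sub>R X (fst z) (snd z)" for z
  define VV where "VV z = indicator ?slab z *\<^sub>R V (fst z) (snd z)" for z
  define RR where "RR z = indicator ?slab z *\<^sub>R \<rho> (fst z) (snd z)" for z
  have XX: "XX \<in> borel_measurable borel"
    unfolding XX_def by (rule curves_jointly_measurable[OF cont Xm])
  have VV: "VV \<in> borel_measurable borel"
    unfolding VV_def using set_borel_measurable_subset_borel[OF V_meas slab slab_sub] by (simp add: case_prod_unfold)
  have RR: "RR \<in> borel_measurable borel"
    unfolding RR_def using set_borel_measurable_subset_borel[OF \<rho>_meas slab slab_sub] by (simp add: case_prod_unfold)
  have RR_nonneg: "0 \<le> RR z" for z
    using \<rho>_nonneg[of "fst z" "snd z"] by (auto simp: RR_def split: split_indicator)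
  have [measurable]: "(cost p :: 'a \<Rightarrow> real) \<in> borel_measurable borel"
    by (rule borel_measurable_continuous_onI[OF continuous_on_cost[OF p]])
  have cVV: "(\<lambda>z. cost p (VV z)) \<in> borel_measurable borel"
    by (rule measurable_compose[OF VV]) measurable
  let ?e = "\<lambda>t x. ennreal (indicator {0<..<1} t * cost p (VV (t, XX (t, x))))"
  have "transport_map \<rho>0 \<rho>1 (X 1)"
  proof (subst transport_map_iff[OF \<rho>0 \<rho>1], intro conjI)
    show "X 1 \<in> borel_measurable borel" by (rule Xm) simp
    have "distr ?P borel (X 1) = distr ?P lborel (X 1)" by (rule distr_cong) auto
    also have "\<dots> = density lborel (\<lambda>x. ennreal (\<rho> 1 x))" by (rule push) simp
    also have "\<dots> = law \<rho>1"
    proof (rule density_cong)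
      have "(\<lambda>x. (1 :: real, x :: 'a)) \<in> measurable lborel lborel"
        by (simp add: borel_measurable_continuous_onI continuous_intros)
      then have "(\<lambda>x. indicator ({0..1} \<times> UNIV) (1 :: real, x) *\<^sub>R (case (1, x) of (t, x) \<Rightarrow> \<rho> t x)) \<in> borel_measurable lborel"
        by (rule measurable_compose[OF _ \<rho>_meas[unfolded set_borel_measurable_def]])
      moreover have "indicator ({0..1} \<times> UNIV) (1 :: real, x) *\<^sub>R (case (1, x) of (t, x) \<Rightarrow> \<rho> t x) = \<rho> 1 x" for x :: 'a
        by simp
      ultimately have "\<rho> 1 \<in> borel_measurable lborel" by (simp only:)
      then show "(\<lambda>x. ennreal (\<rho> 1 x)) \<in> borel_measurable lborel" by simp
      show "AE x in lborel. ennreal (\<rho> 1 x) = ennreal (\<rho>1 x)" using \<rho>_1 by eventually_elim simp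
    qed simp
    finally show "distr ?P borel (X 1) = law \<rho>1" .
  qed
  then have "kantorovich_distance p \<rho>0 \<rho>1 \<le> transport_cost p \<rho>0 (X 1)"
    unfolding kantorovich_distance_def by (intro INF_lower) simp
  also have "\<dots> = (\<integral>\<^sup>+x. ennreal (cost p (X 1 x - x)) \<partial>?P)"
  proof -
    have [measurable]: "X 1 \<in> borel_measurable borel" by (rule Xm) simp
    show ?thesis
      unfolding transport_cost_def using p
      by (subst nn_integral_density)
        (auto simp: cost_diff_commute ennreal_mult' prob_density_nonneg[OF \<rho>0] mult.commute cost_nonneg
          intro!: nn_integral_cong)
  qed
  also have "\<dots> \<le> (\<integral>\<^sup>+x. (\<integral>\<^sup>+t. ?e t x \<partial>lborel) \<partial>?P)"
  proof (rule nn_integral_mono)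
    fix x
    have eq: "indicator {0<..<1} t * cost p (VV (t, XX (t, x))) = indicator {0<..<1} t * cost p (V t (X t x))" for t
      by (auto simp: VV_def XX_def split: split_indicator)
    have "(\<lambda>t. XX (t, x)) \<in> borel_measurable borel"
      by (rule measurable_compose[OF _ XX]) (intro borel_measurable_continuous_onI continuous_intros)
    then have "(\<lambda>t. (t, XX (t, x))) \<in> borel_measurable borel"
      by (intro borel_measurable_Pair) auto
    then have "(\<lambda>t. cost p (VV (t, XX (t, x)))) \<in> borel_measurable borel"
      by (rule measurable_compose[OF _ cVV])
    then have m: "(\<lambda>t. indicator {0<..<1} t * cost p (V t (X t x))) \<in> borel_measurable borel"
      unfolding eq[symmetric] by (intro borel_measurable_times borel_measurable_indicator) auto
    have "ennreal (cost p (X 1 x - X 0 x)) \<le> (\<integral>\<^sup>+t. ennreal (indicator {0<..<1} t * cost p (V t (X t x))) \<partial>lborel)"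
      by (rule cost_displacement_le_action[OF p der m])
    then show "ennreal (cost p (X 1 x - x)) \<le> (\<integral>\<^sup>+t. ?e t x \<partial>lborel)"
      unfolding eq X0 .
  qed
  also have "\<dots> = (\<integral>\<^sup>+t. (\<integral>\<^sup>+x. ?e t x \<partial>?P) \<partial>lborel)"
  proof -
    interpret P: finite_measure ?P by (rule finite_measure_prob_density[OF \<rho>0])
    interpret LP: pair_sigma_finite lborel ?P ..
    have s: "sets (lborel \<Otimes>\<^sub>M ?P) = sets (borel :: (real \<times> 'a) measure)"
      by (simp add: borel_prod[symmetric] cong: sets_pair_measure_cong)
    have "(\<lambda>z. (fst z, XX z)) \<in> borel_measurable borel"
      by (intro borel_measurable_Pair XX borel_measurable_continuous_onI continuous_on_fst continuous_on_id)
    from measurable_compose[OF this cVV]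
    have 1: "(\<lambda>z. cost p (VV (fst z, XX z))) \<in> borel_measurable borel" .
    have "(\<lambda>z::real \<times> 'a. indicator {0<..<1} (fst z) :: real) \<in> borel_measurable borel"
      by (rule measurable_compose[OF borel_measurable_continuous_onI[OF continuous_on_fst[OF continuous_on_id]]]) auto
    then have "(\<lambda>z. ennreal (indicator {0<..<1} (fst z) * cost p (VV (fst z, XX z)))) \<in> borel_measurable borel"
      using 1 by (intro measurable_compose[OF borel_measurable_times measurable_ennreal])
    then have "case_prod (\<lambda>t x. ?e t x) \<in> borel_measurable (lborel \<Otimes>\<^sub>M ?P)"
      by (simp add: measurable_cong_sets[OF s refl] case_prod_unfold)
    from LP.Fubini'[OF this] show ?thesis .
  qed
  also have "\<dots> = (\<integral>\<^sup>+t. (\<integral>\<^sup>+x. ennreal (RR (t, x) * cost p (VV (t, x))) \<partial>lborel) \<partial>lborel)"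
  proof (rule nn_integral_cong)
    fix t :: real
    show "(\<integral>\<^sup>+x. ?e t x \<partial>?P)
        = (\<integral>\<^sup>+x. ennreal (RR (t, x) * cost p (VV (t, x))) \<partial>lborel)"
    proof (cases "t \<in> {0<..<1}")
      case True
      then have t: "t \<in> {0..1}" by simp
      have Vt: "(\<lambda>x. cost p (VV (t, x))) \<in> borel_measurable borel"
        by (rule measurable_compose[OF _ cVV]) (intro borel_measurable_continuous_onI continuous_intros)
      have Rt: "(\<lambda>x. RR (t, x)) \<in> borel_measurable borel"
        by (rule measurable_compose[OF _ RR]) (intro borel_measurable_continuous_onI continuous_intros)
      have Rt': "(\<lambda>x. RR (t, x)) = \<rho> t" using True by (auto simp: RR_def)
      have Xt: "XX (t, x) = X t x" for x using True by (simp add: XX_def)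
      have "(\<integral>\<^sup>+x. ?e t x \<partial>?P)
          = (\<integral>\<^sup>+x. ennreal (cost p (VV (t, X t x))) \<partial>?P)"
        using True Xt by simp
      also have "\<dots> = (\<integral>\<^sup>+x. ennreal (cost p (VV (t, x))) \<partial>distr ?P lborel (X t))"
        using Xm[OF t] Vt by (subst nn_integral_distr) auto
      also have "\<dots> = (\<integral>\<^sup>+x. ennreal (RR (t, x)) * ennreal (cost p (VV (t, x))) \<partial>lborel)"
        unfolding push[OF t] Rt'[symmetric] using Rt Vt by (subst nn_integral_density) auto
      also have "\<dots> = (\<integral>\<^sup>+x. ennreal (RR (t, x) * cost p (VV (t, x))) \<partial>lborel)"
        by (intro nn_integral_cong) (simp add: ennreal_mult RR_nonneg cost_nonneg[OF p])
      finally show ?thesis .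
    qed (simp add: RR_def)
  qed
  also have "\<dots> = (\<integral>\<^sup>+z. ennreal (RR z * cost p (VV z)) \<partial>(lborel \<Otimes>\<^sub>M lborel))"
  proof (rule lborel.nn_integral_fst)
    have "(\<lambda>z. ennreal (RR z * cost p (VV z))) \<in> borel_measurable borel"
      using RR cVV by (intro measurable_compose[OF borel_measurable_times measurable_ennreal])
    then show "(\<lambda>z. ennreal (RR z * cost p (VV z))) \<in> borel_measurable (lborel \<Otimes>\<^sub>M lborel)"
      by (simp add: lborel_prod)
  qed
  also have "\<dots> = (\<integral>\<^sup>+(t, x)\<in>?slab. ennreal (\<rho> t x * cost p (V t x)) \<partial>lborel)"
    unfolding lborel_prod
    by (intro nn_integral_cong) (auto simp: RR_def VV_def split: split_indicator)
  finally show ?thesis .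
qed


section \<open>Identification of the weak solution\<close>

lemma integrable_L2_mult:
  fixes f g :: "'a::euclidean_space \<Rightarrow> real"
  assumes "L2_function f" "L2_function g"
  shows "integrable lborel (\<lambda>x. f x * g x)"
proof (rule Bochner_Integration.integrable_bound)
  show "integrable lborel (\<lambda>x. (norm (f x))\<^sup>2 + (norm (g x))\<^sup>2)"
    using assms by (intro Bochner_Integration.integrable_add) (auto simp: L2_function_def)
  show "(\<lambda>x. f x * g x) \<in> borel_measurable lborel"
    using assms by (intro borel_measurable_times) (auto simp: L2_function_def)
  show "AE x in lborel. norm (f x * g x) \<le> norm ((norm (f x))\<^sup>2 + (norm (g x))\<^sup>2)"
  proof (rule AE_I2)
    fix x
    have "2 * (\<bar>f x\<bar> * \<bar>g x\<bar>) \<le> \<bar>f x\<bar>\<^sup>2 + \<bar>g x\<bar>\<^sup>2"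
      using sum_squares_bound[of "\<bar>f x\<bar>" "\<bar>g x\<bar>"] by (simp add: mult.assoc)
    moreover have "0 \<le> \<bar>f x\<bar> * \<bar>g x\<bar>" by simp
    ultimately have "\<bar>f x\<bar> * \<bar>g x\<bar> \<le> \<bar>f x\<bar>\<^sup>2 + \<bar>g x\<bar>\<^sup>2" by linarith
    then show "norm (f x * g x) \<le> norm ((norm (f x))\<^sup>2 + (norm (g x))\<^sup>2)"
      by (simp add: abs_mult)
  qed
qed

lemma L2_function_diff:
  fixes f g :: "'a::euclidean_space \<Rightarrow> real"
  assumes "L2_function f" "L2_function g"
  shows "L2_function (\<lambda>x. f x - g x)"
proof -
  have "integrable lborel (\<lambda>x. (norm (f x))\<^sup>2 + (norm (g x))\<^sup>2 - 2 * (f x * g x))"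
    using assms integrable_L2_mult[OF assms] by (auto simp: L2_function_def)
  moreover have "(norm (f x))\<^sup>2 + (norm (g x))\<^sup>2 - 2 * (f x * g x) = (norm (f x - g x))\<^sup>2" for x
    by (simp add: power2_diff mult.assoc)
  ultimately show ?thesis
    using assms by (simp add: L2_function_def borel_measurable_diff)
qed

lemma L2_function_bounded_support:
  fixes f :: "'a::euclidean_space \<Rightarrow> real"
  assumes f: "f \<in> borel_measurable borel" and bd: "\<And>x. \<bar>f x\<bar> \<le> B" and K: "compact K" "\<And>x. x \<notin> K \<Longrightarrow> f x = 0"
  shows "L2_function f"
  unfolding L2_function_def
proof
  have "integrable lborel (\<lambda>x. indicator K x * B\<^sup>2)"
    using borel_compact[OF K(1)] emeasure_bounded_finite[OF compact_imp_bounded[OF K(1)]]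
    by (intro integrable_mult_left integrable_real_indicator) simp_all
  then show "integrable lborel (\<lambda>x. (norm (f x))\<^sup>2)"
  proof (rule Bochner_Integration.integrable_bound)
    show "AE x in lborel. norm ((norm (f x))\<^sup>2) \<le> norm (indicator K x * B\<^sup>2)"
    proof (rule AE_I2)
      fix x
      have "\<bar>f x\<bar>\<^sup>2 \<le> B\<^sup>2" by (rule power_mono[OF bd]) simp
      then show "norm ((norm (f x))\<^sup>2) \<le> norm (indicator K x * B\<^sup>2)"
        using K(2)[of x] by (auto split: split_indicator)
    qed
  qed (use f in simp)
qed (use f in simp)

text \<open>The boundary term of the weak formulation, as a functional of the test function, determines the terminal
  trace.\<close>
lemma terminal_trace_unique:
  fixes f g \<mu> :: "'a::euclidean_space \<Rightarrow> real"
  assumes f: "L2_function f" and g: "L2_function g" and \<mu>: "integrable lborel \<mu>"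
    and eq: "\<And>\<zeta> d K. C1_grad \<zeta> d \<Longrightarrow> compact K \<Longrightarrow> (\<And>x. x \<notin> K \<Longrightarrow> \<zeta> x = 0) \<Longrightarrow>
      (LINT x|lborel. f x * \<zeta> x - \<mu> x * \<zeta> x) = (LINT x|lborel. g x * \<zeta> x - \<mu> x * \<zeta> x)"
  shows "AE x in lborel. f x = g x"
proof -
  have "AE x in lborel. f x - g x = 0"
  proof (rule AE_zero_if_test_integrals_zero)
    show "(\<lambda>x. f x - g x) \<in> borel_measurable borel"
      using f g by (auto simp: L2_function_def)
    show "set_integrable lborel (cbox a b) (\<lambda>x. f x - g x)" for a b
    proof -
      have "L2_function (indicat_real (cbox a b))"
        by (rule L2_function_bounded_support[where K = "cbox a b" and B = 1])
          (auto split: split_indicator)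
      from integrable_L2_mult[OF this L2_function_diff[OF f g]] show ?thesis
        by (simp add: set_integrable_def)
    qed
    fix \<zeta> :: "'a \<Rightarrow> real" and d K assume \<zeta>: "C1_grad \<zeta> d" and K: "compact K" "\<And>x. x \<notin> K \<Longrightarrow> \<zeta> x = 0"
    have cont: "continuous_on UNIV \<zeta>" using C1_grad_continuous[OF \<zeta>] .
    then have "bounded (\<zeta> ` K)"
      using K(1) by (intro compact_imp_bounded compact_continuous_image) (auto elim: continuous_on_subset)
    then obtain B0 where B0: "\<And>x. x \<in> K \<Longrightarrow> \<bar>\<zeta> x\<bar> \<le> B0" by (auto simp: bounded_iff)
    define B where "B = max 0 B0"
    have B: "\<bar>\<zeta> x\<bar> \<le> B" for x
      using B0[of x] K(2)[of x] by (cases "x \<in> K") (auto simp: B_def)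
    have \<zeta>m: "\<zeta> \<in> borel_measurable borel" using cont by (rule borel_measurable_continuous_onI)
    have L2: "L2_function \<zeta>" by (rule L2_function_bounded_support[OF \<zeta>m B K])
    have "integrable lborel (\<lambda>x. B * \<mu> x)" using \<mu> by simp
    then have i\<mu>: "integrable lborel (\<lambda>x. \<mu> x * \<zeta> x)"
    proof (rule Bochner_Integration.integrable_bound)
      show "AE x in lborel. norm (\<mu> x * \<zeta> x) \<le> norm (B * \<mu> x)"
      proof (rule AE_I2)
        fix x
        have "\<bar>\<mu> x\<bar> * \<bar>\<zeta> x\<bar> \<le> \<bar>\<mu> x\<bar> * B" by (intro mult_left_mono B) simp
        then show "norm (\<mu> x * \<zeta> x) \<le> norm (B * \<mu> x)"
          by (simp add: abs_mult B_def mult.commute)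
      qed
    qed (use \<mu> \<zeta>m in auto)
    note i = integrable_L2_mult[OF f L2] integrable_L2_mult[OF g L2]
    have "(LINT x|lborel. f x * \<zeta> x) = (LINT x|lborel. g x * \<zeta> x)"
      using eq[OF \<zeta> K] i i\<mu> by (simp add: Bochner_Integration.integral_diff)
    then show "(LINT x|lborel. (f x - g x) * \<zeta> x) = 0"
      using i by (simp add: left_diff_distrib Bochner_Integration.integral_diff)
  qed
  then show ?thesis by eventually_elim simp
qed

context flow_with_density
begin

lemma unique_solution_identified:
  assumes uniq: "unique_weak_solution \<rho> V \<rho>0"
  shows "AE z in lborel. z \<in> slab \<longrightarrow> \<rho> (fst z) (snd z) = l z"
    and "AE x in lborel. \<rho> 1 x = \<rho>1 x"
    and "continuity_equation \<rho> V \<rho>0 \<rho>1"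
    and "set_integrable lborel slab (\<lambda>(t, x). \<rho> t x * cost p (V t x))"
    and "(LINT (t, x):slab|lborel. \<rho> t x * cost p (V t x)) = (LINT x|P. cost p (M x - x))"
proof -
  let ?f = "\<lambda>\<rho> \<psi>t \<psi>x z. indicator slab z *\<^sub>R (case z of (t, x) \<Rightarrow> \<rho> t x * \<psi>t t x + (\<rho> t x *\<^sub>R V t x) \<bullet> \<psi>x t x)"
  let ?F = "\<lambda>\<rho> \<psi>t \<psi>x. LINT (t, x):slab|lborel. \<rho> t x * \<psi>t t x + (\<rho> t x *\<^sub>R V t x) \<bullet> \<psi>x t x"
  have sol: "Linf_L1_Linf \<rho>" "L2_function (\<rho> 1)" "continuity_equation \<rho> V \<rho>0 (\<rho> 1)"
    using uniq unfolding unique_weak_solution_def weak_solution_def by blast+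
  have "AE z in lborel. fst z \<in> {0<..<1} \<longrightarrow> lam (fst z) (snd z) = \<rho> (fst z) (snd z)"
    using uniq weak_solution_lam unfolding unique_weak_solution_def case_prod_unfold by blast
  then show ae: "AE z in lborel. z \<in> slab \<longrightarrow> \<rho> (fst z) (snd z) = l z"
    by eventually_elim (auto simp: lam_def)
  have cong: "?F \<rho> \<psi>t \<psi>x
      = ?F lam \<psi>t \<psi>x"
    if \<psi>: "C1_test \<psi> \<psi>t \<psi>x" for \<psi> \<psi>t \<psi>x
    unfolding set_lebesgue_integral_def
  proof (rule integral_cong_AE)
    show "(\<lambda>z. ?f \<rho> \<psi>t \<psi>x z) \<in> borel_measurable lborel"
      "(\<lambda>z. ?f lam \<psi>t \<psi>x z) \<in> borel_measurable lborel"
      using sol(3) continuity_equation_lam \<psi> unfolding continuity_equation_def set_integrable_def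
      by (blast intro: borel_measurable_integrable)+
    show "AE z in lborel. ?f \<rho> \<psi>t \<psi>x z
        = ?f lam \<psi>t \<psi>x z"
      using ae by eventually_elim (auto simp: lam_def split: split_indicator)
  qed
  have eq_\<rho>: "?F \<rho> \<psi>t \<psi>x
      = (LINT x|lborel. \<rho> 1 x * \<psi> 1 x - \<rho>0 x * \<psi> 0 x)"
    and eq_lam: "?F lam \<psi>t \<psi>x
      = (LINT x|lborel. \<rho>1 x * \<psi> 1 x - \<rho>0 x * \<psi> 0 x)"
    if "C1_test \<psi> \<psi>t \<psi>x" for \<psi> \<psi>t \<psi>x
    using sol(3) continuity_equation_lam that unfolding continuity_equation_def by blast+
  show "AE x in lborel. \<rho> 1 x = \<rho>1 x"
  proof (rule terminal_trace_unique[OF sol(2) L2_\<rho>1])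
    show "integrable lborel \<rho>0" using \<rho>0 by (simp add: prob_density_def)
    fix \<zeta> :: "'a \<Rightarrow> real" and d K assume "C1_grad \<zeta> d" and "compact K" "\<And>x. x \<notin> K \<Longrightarrow> \<zeta> x = 0"
    then have \<psi>: "C1_test (\<lambda>_. \<zeta>) (\<lambda>_ _. 0) (\<lambda>_. d)" by (rule C1_test_static)
    show "(LINT x|lborel. \<rho> 1 x * \<zeta> x - \<rho>0 x * \<zeta> x) = (LINT x|lborel. \<rho>1 x * \<zeta> x - \<rho>0 x * \<zeta> x)"
      by (rule trans[OF trans[OF eq_\<rho>[OF \<psi>, symmetric] cong[OF \<psi>]] eq_lam[OF \<psi>]])
  qed
  show "continuity_equation \<rho> V \<rho>0 \<rho>1"
    unfolding continuity_equation_def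
  proof (intro allI impI conjI)
    fix \<psi> \<psi>t :: "real \<Rightarrow> 'a \<Rightarrow> real" and \<psi>x assume \<psi>: "C1_test \<psi> \<psi>t \<psi>x"
    show "set_integrable lborel slab (\<lambda>(t, x). \<rho> t x * \<psi>t t x + (\<rho> t x *\<^sub>R V t x) \<bullet> \<psi>x t x)"
      using sol(3) \<psi> unfolding continuity_equation_def by blast
    show "?F \<rho> \<psi>t \<psi>x
        = (LINT x|lborel. \<rho>1 x * \<psi> 1 x - \<rho>0 x * \<psi> 0 x)"
      by (rule trans[OF cong[OF \<psi>] eq_lam[OF \<psi>]])
  qed
  define Rb where "Rb z = indicator slab z *\<^sub>R \<rho> (fst z) (snd z)" for z
  define Wb where "Wb z = indicator slab z *\<^sub>R (\<rho> (fst z) (snd z) *\<^sub>R V (fst z) (snd z))" for z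
  have Rb: "Rb \<in> borel_measurable borel"
    using sol(1) unfolding Rb_def Linf_L1_Linf_def set_borel_measurable_def case_prod_unfold by simp
  have Wb: "Wb \<in> borel_measurable borel"
    unfolding Wb_def by (rule momentum_measurable[OF sol(3)])
  \<comment> \<open>The velocity itself need not be measurable where the density vanishes; there the energy density
    is \<open>0\<close>, and elsewhere the velocity is momentum over density.\<close>
  have eq: "indicator slab z *\<^sub>R (case z of (t, x) \<Rightarrow> \<rho> t x * cost p (V t x)) = Rb z * cost p (inverse (Rb z) *\<^sub>R Wb z)" for z
    by (cases "Rb z = 0") (auto simp: Rb_def Wb_def split: split_indicator)
  have m: "(\<lambda>z. Rb z * cost p (inverse (Rb z) *\<^sub>R Wb z)) \<in> borel_measurable lborel"
  proof -
    have "(\<lambda>z. inverse (Rb z) *\<^sub>R Wb z) \<in> borel_measurable borel"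
      using Rb Wb by (intro borel_measurable_scaleR borel_measurable_inverse)
    then have "(\<lambda>z. cost p (inverse (Rb z) *\<^sub>R Wb z)) \<in> borel_measurable borel"
      by (rule measurable_compose) measurable
    then show ?thesis using Rb by (simp add: borel_measurable_times)
  qed
  have ae': "AE z in lborel. l z * cost p (V (fst z) (snd z)) = Rb z * cost p (inverse (Rb z) *\<^sub>R Wb z)"
    unfolding eq[symmetric] using ae
  proof eventually_elim
    case (elim z)
    then show ?case using l_off_slab[of z] by (cases "z \<in> slab") (auto simp: case_prod_unfold)
  qed
  show "set_integrable lborel slab (\<lambda>(t, x). \<rho> t x * cost p (V t x))"
    unfolding set_integrable_def eq
    by (rule integrable_cong_AE_imp[OF kinetic_energy_lam(1) m ae'])
  show "(LINT (t, x):slab|lborel. \<rho> t x * cost p (V t x)) = (LINT x|P. cost p (M x - x))"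
    unfolding set_lebesgue_integral_def eq kinetic_energy_lam(2)[symmetric]
    by (rule integral_cong_AE[symmetric, OF borel_measurable_integrable[OF kinetic_energy_lam(1)] m ae'])
qed

end


section \<open>Duality\<close>

lemma dual_c_conjugate_lax_hopf:
  assumes "dual_c_conjugate p u v"
  shows "lax_hopf p v 0 x = - u x"
proof -
  have "u x = (INF y. cost p (x - y) - v y)"
    using assms unfolding dual_c_conjugate_def by blast
  also have "\<dots> = - (SUP y. v y - cost p (x - y))"
    by (simp add: Inf_real_def image_image)
  finally show ?thesis by (simp add: lax_hopf_0)
qed

text \<open>\<open>J\<close> is the dual functional restricted to pairs \<open>(- lax_hopf p v 0, v)\<close>. For \<open>v\<close> in
  the domain of \<open>J\<close> such a pair is feasible, and the given dual maximizer is of this form, so the maxima agree; equality of the primal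
  and dual values then forces the constraint to be active at \<open>\<rho>0\<close>-almost every \<open>(x, M x)\<close>.\<close>
lemma J_maximizer_contact:
  fixes \<rho>0 \<rho>1 v :: "'a::euclidean_space \<Rightarrow> real"
  assumes p: "1 < p" and \<rho>0: "prob_density \<rho>0" and \<rho>1: "prob_density \<rho>1"
    and standing: "mass_transfer_theorem p \<rho>0 \<rho>1" and max: "J_maximizer p \<rho>0 \<rho>1 v"
    and v[measurable]: "v \<in> borel_measurable borel" and lax[measurable]: "lax_hopf p v 0 \<in> borel_measurable borel"
  obtains M where "transport_map \<rho>0 \<rho>1 M"
    "AE x in law \<rho>0. lax_hopf p v 0 x = v (M x) - cost p (M x - x)"
    "kantorovich_distance p \<rho>0 \<rho>1 = ennreal (LINT x|law \<rho>0. cost p (M x - x))"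
    "(LINT x|lborel. \<rho>0 x * (- lax_hopf p v 0 x) + \<rho>1 x * v x)
       = (LINT x|law \<rho>0. cost p (M x - x))"
proof -
  let ?P = "law \<rho>0" and ?Q = "law \<rho>1"
  note [measurable] = prob_density_measurable[OF \<rho>0] prob_density_measurable[OF \<rho>1]
  have [measurable]: "(cost p :: 'a \<Rightarrow> real) \<in> borel_measurable borel"
    by (rule borel_measurable_continuous_onI[OF continuous_on_cost[OF p]])
  obtain u w M where w: "dual_maximizer p \<rho>0 \<rho>1 u w" "dual_c_conjugate p u w"
    and M: "transport_map \<rho>0 \<rho>1 M"
    and cost_M: "transport_cost p \<rho>0 M = kantorovich_distance p \<rho>0 \<rho>1"
    and kant: "kantorovich_distance p \<rho>0 \<rho>1 = ennreal (dual_value \<rho>0 \<rho>1 u w)"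
    using standing unfolding mass_transfer_theorem_def by blast
  have Mm[measurable]: "M \<in> borel_measurable borel" using M unfolding transport_map_def by blast
  have distr: "distr ?P borel M = ?Q" using M transport_map_iff[OF \<rho>0 \<rho>1] by blast
  have feas: "dual_feasible p \<rho>0 \<rho>1 u w" using w(1) unfolding dual_maximizer_def by blast
  define D where "D = dual_value \<rho>0 \<rho>1 u w"
  have v_dom: "v \<in> J_domain p \<rho>0 \<rho>1" using max unfolding J_maximizer_def by blast
  then have bdd: "\<And>x. bdd_above (range (\<lambda>y. v y - cost p (x - y)))"
    and iv: "integrable lborel (\<lambda>x. \<rho>1 x * v x)" "integrable lborel (\<lambda>x. \<rho>0 x * lax_hopf p v 0 x)"
    unfolding J_domain_def by auto
  have J_v: "J p \<rho>0 \<rho>1 v = dual_value \<rho>0 \<rho>1 (\<lambda>x. - lax_hopf p v 0 x) v"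
    unfolding J_def dual_value_def using iv by (simp add: mult.commute)
  have "dual_feasible p \<rho>0 \<rho>1 (\<lambda>x. - lax_hopf p v 0 x) v"
    unfolding dual_feasible_def using iv lax_hopf_0_ge[OF p bdd] by (auto simp: mult.commute algebra_simps)
  then have "J p \<rho>0 \<rho>1 v \<le> D"
    unfolding J_v D_def using w(1) unfolding dual_maximizer_def by blast
  moreover have "D \<le> J p \<rho>0 \<rho>1 v"
  proof -
    have iw: "integrable lborel (\<lambda>x. \<rho>1 x * w x)" "integrable lborel (\<lambda>x. \<rho>0 x * u x)"
      using feas unfolding dual_feasible_def by (auto simp: mult.commute)
    have "w \<in> J_domain p \<rho>0 \<rho>1"
      unfolding J_domain_def
    proof (intro CollectI conjI allI)
      fix x show "bdd_above (range (\<lambda>y. w y - cost p (x - y)))"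
        using feas unfolding dual_feasible_def by (intro bdd_aboveI2[where M = "- u x"]) (simp add: algebra_simps)
    qed (use iw in \<open>auto simp: dual_c_conjugate_lax_hopf[OF w(2)]\<close>)
    moreover have "J p \<rho>0 \<rho>1 w = D"
      unfolding J_def D_def dual_value_def dual_c_conjugate_lax_hopf[OF w(2)] using iw by (simp add: mult.commute)
    ultimately show ?thesis using max unfolding J_maximizer_def by metis
  qed
  ultimately have D: "J p \<rho>0 \<rho>1 v = D" by simp
  have D0: "0 \<le> D"
  proof -
    have "dual_feasible p \<rho>0 \<rho>1 (\<lambda>x. 0) (\<lambda>x. 0)"
      by (simp add: dual_feasible_def cost_nonneg[OF p])
    then have "dual_value \<rho>0 \<rho>1 (\<lambda>x. 0) (\<lambda>x. 0) \<le> D"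
      unfolding D_def using w(1) unfolding dual_maximizer_def by blast
    then show ?thesis by (simp add: dual_value_def)
  qed
  have "(\<integral>\<^sup>+x. ennreal (cost p (M x - x)) \<partial>?P) = transport_cost p \<rho>0 M"
    unfolding transport_cost_def
    by (subst nn_integral_density) (auto simp: cost_diff_commute ennreal_mult' prob_density_nonneg[OF \<rho>0]
        mult.commute cost_nonneg[OF p] intro!: nn_integral_cong)
  then have "has_bochner_integral ?P (\<lambda>x. cost p (M x - x)) D"
    using D0 unfolding cost_M kant D_def[symmetric]
    by (intro has_bochner_integral_nn_integral) (auto simp: cost_nonneg[OF p])
  then have ic: "integrable ?P (\<lambda>x. cost p (M x - x))" "(LINT x|?P. cost p (M x - x)) = D"
    by (auto simp: has_bochner_integral_iff)
  have iu: "integrable ?P (lax_hopf p v 0)"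
    using iv(2) by (subst integrable_density) (auto simp: prob_density_nonneg[OF \<rho>0])
  have ivM: "integrable ?P (\<lambda>x. v (M x))"
  proof -
    have "integrable ?Q v"
      using iv(1) by (subst integrable_density) (auto simp: prob_density_nonneg[OF \<rho>1])
    then show ?thesis
      unfolding distr[symmetric] by (subst (asm) integrable_distr_eq) auto
  qed
  have "(LINT x|?P. v (M x)) = (LINT x|?Q. v x)"
    unfolding distr[symmetric] by (subst integral_distr) auto
  also have "\<dots> = (LINT x|lborel. \<rho>1 x * v x)"
    by (subst integral_density) (auto simp: prob_density_nonneg[OF \<rho>1])
  finally have vM: "(LINT x|?P. v (M x)) = (LINT x|lborel. \<rho>1 x * v x)" .
  have uP: "(LINT x|?P. lax_hopf p v 0 x) = (LINT x|lborel. \<rho>0 x * lax_hopf p v 0 x)"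
    by (subst integral_density) (auto simp: prob_density_nonneg[OF \<rho>0])
  have D': "(LINT x|lborel. \<rho>1 x * v x) - (LINT x|lborel. \<rho>0 x * lax_hopf p v 0 x) = D"
    using D iv unfolding J_def by simp
  let ?gap = "\<lambda>x. cost p (M x - x) + lax_hopf p v 0 x - v (M x)"
  have "(LINT x|?P. ?gap x) = 0"
    using ic iu ivM vM uP D' by (simp add: Bochner_Integration.integral_diff Bochner_Integration.integral_add)
  moreover have gap_nonneg: "0 \<le> ?gap x" for x
    using lax_hopf_0_ge[OF p bdd, of "M x" x] by (simp add: cost_diff_commute[of p x])
  moreover have "integrable ?P ?gap" using ic iu ivM by simp
  ultimately have "AE x in ?P. ?gap x = 0"
    using integral_nonneg_eq_0_iff_AE[of ?P ?gap] by simp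
  then have contact: "AE x in ?P. lax_hopf p v 0 x = v (M x) - cost p (M x - x)"
    by eventually_elim simp
  have "(LINT x|lborel. \<rho>0 x * (- lax_hopf p v 0 x) + \<rho>1 x * v x) = D"
    using D' iv by (simp add: Bochner_Integration.integral_diff)
  then show ?thesis
    using ic kant by (intro that[OF M contact]) (simp_all add: D_def)
qed

theorem mainTheorem1:
  fixes p q :: real
    and \<rho>0 \<rho>1 vbar ubar :: "real ^ 'n \<Rightarrow> real"
    and \<phi>bar \<rho>bar :: "real \<Rightarrow> real ^ 'n \<Rightarrow> real"
    and Vbar :: "real \<Rightarrow> real ^ 'n \<Rightarrow> real ^ 'n"
  assumes p: "1 < p" and pq: "1 / p + 1 / q = 1"
    and \<rho>0: "prob_density \<rho>0" "H1_function \<rho>0" "Linf_function \<rho>0"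
    and \<rho>1: "prob_density \<rho>1"
    and standing: "mass_transfer_theorem p \<rho>0 \<rho>1"
    and vbar_max: "J_maximizer p \<rho>0 \<rho>1 vbar"
    and vbar_Lipschitz: "\<exists>L. L-lipschitz_on UNIV vbar"
    and vbar_semi_convex: "semi_convex vbar"
    and vbar_nondegenerate:
      "2 < p \<Longrightarrow> \<exists>\<kappa>>0. AE x in lborel. vbar differentiable (at x) \<and> \<kappa> \<le> (norm (grad vbar x))\<^sup>2"
    and \<phi>bar: "\<phi>bar = lax_hopf p vbar"
    and ubar: "ubar = (\<lambda>x. - \<phi>bar 0 x)"
    and Vbar: "Vbar = (\<lambda>t x. flux q (grad (\<phi>bar t) x))"
    and \<rho>bar: "unique_weak_solution \<rho>bar Vbar \<rho>0"
  shows "(AE x in lborel. \<rho>bar 1 x = \<rho>1 x)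
    \<and>
      (set_integrable lborel ({0<..<1} \<times> UNIV)
         (\<lambda>(t, x). 1 / p * \<rho>bar t x * norm (Vbar t x) powr p) \<and>
       (LINT x|lborel. \<rho>0 x * ubar x + \<rho>1 x * vbar x)
         = (LINT (t, x):{0<..<1} \<times> UNIV|lborel. 1 / p * \<rho>bar t x * norm (Vbar t x) powr p))
    \<and>
      ((AE (t, x) in lborel. t \<in> {0<..<1} \<longrightarrow> 0 \<le> \<rho>bar t x) \<and>
       continuity_equation \<rho>bar Vbar \<rho>0 \<rho>1 \<and>
       set_integrable lborel ({0<..<1} \<times> UNIV) (\<lambda>(t, x). \<rho>bar t x * cost p (Vbar t x)) \<and>
       kantorovich_distance p \<rho>0 \<rho>1
         = ennreal (LINT (t, x):{0<..<1} \<times> UNIV|lborel. \<rho>bar t x * cost p (Vbar t x)) \<and>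
       (\<forall>\<rho> V. admissible_pair \<rho>0 \<rho>1 \<rho> V \<longrightarrow>
          ennreal (LINT (t, x):{0<..<1} \<times> UNIV|lborel. \<rho>bar t x * cost p (Vbar t x))
            \<le> (\<integral>\<^sup>+(t, x)\<in>{0<..<1} \<times> UNIV. ennreal (\<rho> t x * cost p (V t x)) \<partial>lborel)))"
proof -
  let ?P = "law \<rho>0"
  obtain L where L: "L-lipschitz_on UNIV vbar" using vbar_Lipschitz by blast
  obtain C where C: "0 \<le> C" "semiconvex_with C vbar"
    by (rule semi_convex_imp_semiconvex_with[OF vbar_semi_convex])
  obtain K0 where K0: "AE x in lborel. \<bar>\<rho>0 x\<bar> \<le> K0"
    using \<rho>0(3) unfolding Linf_function_def by blast
  have bdd: "\<And>x. bdd_above (range (\<lambda>y. vbar y - cost p (x - y)))"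
    using vbar_max unfolding J_maximizer_def J_domain_def by auto
  have meas: "vbar \<in> borel_measurable borel" "lax_hopf p vbar 0 \<in> borel_measurable borel"
    using lipschitz_on_continuous_on[OF L] lipschitz_on_continuous_on[OF lipschitz_lax_hopf_0[OF p bdd L]]
    by (auto intro: borel_measurable_continuous_onI)
  obtain M where M: "transport_map \<rho>0 \<rho>1 M"
    and contact: "AE x in ?P. lax_hopf p vbar 0 x = vbar (M x) - cost p (M x - x)"
    and kant: "kantorovich_distance p \<rho>0 \<rho>1 = ennreal (LINT x|?P. cost p (M x - x))"
    and dual: "(LINT x|lborel. \<rho>0 x * (- lax_hopf p vbar 0 x) + \<rho>1 x * vbar x) = (LINT x|?P. cost p (M x - x))"
    by (rule J_maximizer_contact[OF p \<rho>0(1) \<rho>1 standing vbar_max meas])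
  have "\<exists>r>0. AE x in ?P. 2 < p \<longrightarrow> r \<le> norm (M x - x)"
  proof (cases "2 < p")
    case True
    then obtain \<kappa> where \<kappa>: "\<kappa> > 0" "AE x in lborel. \<kappa> \<le> (norm (grad vbar x))\<^sup>2"
      using vbar_nondegenerate by (auto elim: eventually_mono)
    \<comment> \<open>The lower gradient bound holds at \<open>M x\<close> for \<open>\<rho>0\<close>-almost every \<open>x\<close> because the image of
      \<open>\<rho>0\<close> under \<open>M\<close> has a density.\<close>
    have Mm: "M \<in> measurable ?P borel" and distr: "distr ?P borel M = law \<rho>1"
      using M transport_map_iff[OF \<rho>0(1) \<rho>1] by auto
    have "AE y in distr ?P borel M. \<kappa> \<le> (norm (grad vbar y))\<^sup>2"
      unfolding distr using \<kappa>(2) prob_density_measurable[OF \<rho>1]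
      by (subst AE_density) (auto elim: eventually_mono)
    from AE_distrD[OF Mm this] contact
    have "AE x in ?P. \<kappa> powr (1 / (2 * (p - 1))) \<le> norm (M x - x)"
    proof eventually_elim
      case (elim x)
      then have "contact p vbar x (M x)" by unfold_locales (use p bdd in auto)
      from contact.speed_ge[OF this C(2) \<kappa>(1) elim(1)] show ?case .
    qed
    then show ?thesis
      using \<kappa>(1) by (intro exI[of _ "\<kappa> powr (1 / (2 * (p - 1)))"]) auto
  qed (auto intro: exI[of _ 1])
  then obtain r where r: "0 < r" "AE x in ?P. 2 < p \<longrightarrow> r \<le> norm (M x - x)" by blast
  interpret characteristic_flow p q C L \<rho>0 \<rho>1 vbar M K0 r
    by unfold_locales (use p pq \<rho>0(1) K0 \<rho>1 bdd L C M contact r in auto)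
  obtain l where l: "l \<in> borel_measurable borel" "\<And>z. 0 \<le> l z" "\<And>z. l z \<le> density_const"
      "\<And>z. z \<notin> rays \<Longrightarrow> l z = 0" "flow_measure = density lborel (\<lambda>z. ennreal (l z))"
    by (rule flow_density_exists) blast
  interpret flow_with_density p q C L \<rho>0 \<rho>1 vbar M K0 r l
    by unfold_locales (use l in auto)
  have "Vbar = V" by (simp add: Vbar \<phi>bar V_def fun_eq_iff)
  then have sol: "unique_weak_solution \<rho>bar V \<rho>0" using \<rho>bar by simp
  note res = unique_solution_identified[OF sol]
  have nonneg: "AE (t, x) in lborel. t \<in> {0<..<1} \<longrightarrow> 0 \<le> \<rho>bar t x"
    using res(1) by eventually_elim (auto simp: l(2))
  have energy: "1 / p * \<rho>bar t x * norm (V t x) powr p = \<rho>bar t x * cost p (V t x)" for t x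
    by (simp add: cost_def)
  have "(LINT x|lborel. \<rho>0 x * ubar x + \<rho>1 x * vbar x) = (LINT x|?P. cost p (M x - x))"
    unfolding ubar \<phi>bar by (rule dual)
  moreover have "kantorovich_distance p \<rho>0 \<rho>1
      \<le> (\<integral>\<^sup>+(t, x)\<in>{0<..<1} \<times> UNIV. ennreal (\<rho> t x * cost p (W t x)) \<partial>lborel)"
    if "admissible_pair \<rho>0 \<rho>1 \<rho> W" for \<rho> W
    using kantorovich_distance_le_action[OF p \<rho>0(1) \<rho>1 that] .
  ultimately show ?thesis
    unfolding \<open>Vbar = V\<close> energy using res(2-5) nonneg kant by simp
qed

end
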